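(* Assume $z$ is a $6$-vertex. There is a short exact sequence of $A$-modules $$0\to b_1A+b_2A\to e_zA\to(\bar b_4,\bar b_5)A\to0.$$ The kernel $b_1A+b_2A$ and the cokernel $(\bar b_4,\bar b_5)A$ both have a rhombus filtration with three quotients.
   Context: Tiling. Let $\mathrm p:\mathbb R^3\to\mathbb R^2$ be linear with $\mathrm p(\mathbf e_1)=(-\frac{\sqrt3}{2},-\frac12)$, $\mathrm p(\mathbf e_2)=(\frac{\sqrt3}{2},-\frac12)$, $\mathrm p(\mathbf e_3)=(0,1)$. For $\{i,j,k\}=\{1,2,3\}$ let $R_k=\{\lambda \mathrm p(\mathbf e_i)+\mu \mathrm p(\mathbf e_j):0\le\lambda,\mu\le1\}$. Let $\mathbf M=\begin{pmatrix}0&1&0\\0&0&1\\1&-1&-1\end{pmatrix}$ with columns $\mathbf c_1,\mathbf c_2,\mathbf c_3$. A pair $(z,k)$, $z\in\mathbb Z^3$, represents the rhombus $\mathrm p(z)+R_k$. Put $\mathcal P_0=\{(0,1),(0,2),(0,3)\}$ and $\mathcal P_{i+1}=\bigcup_{(z,k)\in\mathcal P_i}\mathcal R(z,k)$, where $\mathcal R(z,1)=\{(\mathbf Mz,3),(\mathbf Mz+\mathbf c_2,1),(\mathbf Mz+\mathbf c_3,2)\}$, $\mathcal R(z,2)=\{(\mathbf Mz,1)\}$, $\mathcal R(z,3)=\{(\mathbf Mz,2)\}$. Then $\mathcal P_i\subset\mathcal P_{i+1}$ and $\bigcup_i\mathcal P_i$ is a tiling of the plane by rhombi (the Rauzy tiling).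 Algebra $A$. Let $Q$ be the quiver whose vertices are the vertices of the Rauzy tiling, with each edge replaced by two arrows in opposite directions; $\bar b$ is the arrow opposite to $b$. Let $k$ be a field. Paths are composed left to right and modules are right modules. The Rauzy algebra is $A=kQ/I$, where $I$ is generated by: (1) a path of length two along two distinct edges that are not both edges of one rhombus is zero; (2) the two paths of length two joining opposite vertices of a rhombus (along its boundary) are equal; (3) for each vertex $z$, $s_1(z)D_1(z)=s_2(z)D_2(z)=s_3(z)D_3(z)$, where $D_a(z)=L_a^+(z)-L_a^-(z)$, $L_a^{\pm}(z)=g\bar g$ if there is an arrow $g:z\to z\pm\mathrm p(\mathbf e_a)$ and $L_a^\pm(z)=0$ otherwise, and $s_a(z)\in\{\pm1\}$ is a fixed choice of signs such that whenever $z,x$ are joined by an edge parallel to $\mathrm p(\mathbf e_a)$, $s_a(x)=-s_a(z)$ and $s_c(x)=s_c(z)$ for $c\ne a$ (such signs are determined by their values at one vertex). $e_z$ is the trivial path at $z$ and $S_z$ the simple module at $z$. Local notation. An $n$-vertex is a vertex $z$ with exactly $n$ edges. Its neighbours are labelled $x_1,\dots,x_n$ counterclockwise (starting anywhere), and $b_j:z\to x_j$ is the corresponding arrow. $(\bar b_4,\bar b_5)A$ is the submodule of $e_{x_4}A\oplus e_{x_5}A$ generated by the element $(\bar b_4,\bar b_5)$. Rhombus modules. For a rhombus of the tiling with opposite vertices $z,y$ and remaining vertices $u,v$, the rhombus module $R^y_z$ is the (unique up to isomorphism) $A$-module with top $S_y$, socle $S_z$ and $\mathrm{rad}/\mathrm{soc}\cong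 S_u\oplus S_v$; explicitly $R^y_z=pA$ with $p$ the path of length two from $z$ to $y$ around the rhombus. A module $M$ has a rhombus filtration (with $r$ quotients) if there are submodules $0=M_0\subset M_1\subset\dots\subset M_r=M$ with each $M_j/M_{j-1}$ a rhombus module. *)

theory Defs
  imports
    "HOL-Analysis.Analysis"
    "HOL-Library.Poly_Mapping"
    "HOL-Algebra.Module"
    "HOL-Algebra.QuotRing"
    "HOL-Algebra.Generated_Groups"
begin

section \<open>The Rauzy tiling\<close>

type_synonym pt = "real^2"

definition proj :: "real^3 \<Rightarrow> pt" where
  "proj v = v $ 1 *\<^sub>R vector [- sqrt 3 / 2, - 1 / 2]
          + v $ 2 *\<^sub>R vector [sqrt 3 / 2, - 1 / 2]
          + v $ 3 *\<^sub>R vector [0, 1]"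

definition proj_int :: "int^3 \<Rightarrow> pt" where
  "proj_int z = proj (\<chi> i. of_int (z $ i))"

text \<open>Indices \<open>1, 2, 3\<close> are elements of the numeral type \<^typ>\<open>3\<close> (where \<open>3 = 0\<close>).\<close>

definition pe :: "3 \<Rightarrow> pt" where
  "pe a = proj (axis a 1)"

definition subst_mat :: "int^3^3" where
  "subst_mat = vector [vector [0, 1, 0], vector [0, 0, 1], vector [1, - 1, - 1]]"

definition subst_tile :: "(int^3) \<times> 3 \<Rightarrow> ((int^3) \<times> 3) set" where
  "subst_tile = (\<lambda>(z, k). let w = subst_mat *v z in
     if k = 1 then {(w, 3), (w + column 2 subst_mat, 1), (w + column 3 subst_mat, 2)}
     else if k = 2 then {(w, 1)}
     else {(w, 2)})"

primrec patch :: "nat \<Rightarrow> ((int^3) \<times> 3) set" where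
  "patch 0 = {(0, 1), (0, 2), (0, 3)}"
| "patch (Suc n) = (\<Union>t\<in>patch n. subst_tile t)"

definition rauzy_tiling :: "((int^3) \<times> 3) set" where
  "rauzy_tiling = (\<Union>n. patch n)"

text \<open>\<open>rhombus z u y v\<close>: the points \<open>z, u, y, v\<close> are, in cyclic order, the four corners of
  \<open>p(w) + R\<^sub>k\<close> for some tile \<open>(w, k)\<close>. The starting corner is arbitrary, and so is the
  orientation, because \<open>i\<close> and \<open>j\<close> may be exchanged.\<close>

definition rhombus :: "pt \<Rightarrow> pt \<Rightarrow> pt \<Rightarrow> pt \<Rightarrow> bool" where
  "rhombus z u y v \<longleftrightarrow>
     (\<exists>(w, k)\<in>rauzy_tiling. \<exists>i j n. {i, j, k} = {1, 2, 3} \<and>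
        [z, u, y, v] = rotate n [proj_int w, proj_int w + pe i,
                                 proj_int w + pe i + pe j, proj_int w + pe j])"

definition tvertex :: "pt \<Rightarrow> bool" where
  "tvertex z \<longleftrightarrow> (\<exists>u y v. rhombus z u y v)"

definition tedge :: "pt \<Rightarrow> pt \<Rightarrow> bool" where
  "tedge z u \<longleftrightarrow> (\<exists>y v. rhombus z u y v)"

definition neighbours :: "pt \<Rightarrow> pt set" where
  "neighbours z = {x. tedge z x}"

definition n_vertex :: "nat \<Rightarrow> pt \<Rightarrow> bool" where
  "n_vertex n z \<longleftrightarrow> tvertex z \<and> finite (neighbours z) \<and> card (neighbours z) = n"

text \<open>\<open>x 1, \<dots>, x n\<close> enumerates the neighbours of \<open>z\<close> by strictly increasing polar angle
  (as seen from \<open>z\<close>) within one full turn.\<close>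

definition ccw_labelling :: "pt \<Rightarrow> nat \<Rightarrow> (nat \<Rightarrow> pt) \<Rightarrow> bool" where
  "ccw_labelling z n x \<longleftrightarrow>
     bij_betw x {1..n} (neighbours z) \<and>
     (\<exists>\<theta> r :: nat \<Rightarrow> real.
        (\<forall>j\<in>{1..n}. r j > 0 \<and> x j = z + r j *\<^sub>R vector [cos (\<theta> j), sin (\<theta> j)]) \<and>
        strict_mono_on {1..n} \<theta> \<and> \<theta> n < \<theta> 1 + 2 * pi)"

definition sign_choice :: "(3 \<Rightarrow> pt \<Rightarrow> int) \<Rightarrow> bool" where
  "sign_choice s \<longleftrightarrow>
     (\<forall>z a. tvertex z \<longrightarrow> s a z \<in> {1, - 1}) \<and>
     (\<forall>z x a. tedge z x \<and> (\<exists>t. x - z = t *\<^sub>R pe a) \<longrightarrow>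
        s a x = - s a z \<and> (\<forall>c. c \<noteq> a \<longrightarrow> s c x = s c z))"


section \<open>The path algebra\<close>

text \<open>The quiver has no two parallel arrows, so a path is the nonempty list of the vertices it
  visits; \<open>[z]\<close> is the trivial path at \<open>z\<close> and \<open>[z, x]\<close> the arrow \<open>z \<rightarrow> x\<close>.\<close>

definition is_path :: "pt list \<Rightarrow> bool" where
  "is_path p \<longleftrightarrow> p \<noteq> [] \<and> (\<forall>z\<in>set p. tvertex z) \<and> successively tedge p"

type_synonym 'k pathcomb = "pt list \<Rightarrow>\<^sub>0 'k"

definition path_mult :: "'k::field pathcomb \<Rightarrow> 'k pathcomb \<Rightarrow> 'k pathcomb" where
  "path_mult f g =
     (\<Sum>p\<in>Poly_Mapping.keys f. \<Sum>q\<in>Poly_Mapping.keys g.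
        if last p = hd q
        then Poly_Mapping.single (p @ tl q) (Poly_Mapping.lookup f p * Poly_Mapping.lookup g q)
        else 0)"

text \<open>The quiver is infinite, so neither \<open>kQ\<close> nor \<open>A\<close> has a unit: the field \<open>one\<close> of the ring
  record is meaningless throughout, and all notions below avoid it.\<close>

definition path_algebra :: "'k::field pathcomb ring" where
  "path_algebra = \<lparr>carrier = {f. Poly_Mapping.keys f \<subseteq> {p. is_path p}},
     mult = path_mult, one = undefined, zero = 0, add = (+)\<rparr>"

locale nonunital_ring = abelian_group R for R (structure) +
  assumes nm_closed: "\<lbrakk>a \<in> carrier R; b \<in> carrier R\<rbrakk> \<Longrightarrow> a \<otimes> b \<in> carrier R"
    and nm_assoc: "\<lbrakk>a \<in> carrier R; b \<in> carrier R; c \<in> carrier R\<rbrakk> \<Longrightarrow>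
      (a \<otimes> b) \<otimes> c = a \<otimes> (b \<otimes> c)"
    and nl_distr: "\<lbrakk>a \<in> carrier R; b \<in> carrier R; c \<in> carrier R\<rbrakk> \<Longrightarrow>
      (a \<oplus> b) \<otimes> c = a \<otimes> c \<oplus> b \<otimes> c"
    and nr_distr: "\<lbrakk>a \<in> carrier R; b \<in> carrier R; c \<in> carrier R\<rbrakk> \<Longrightarrow>
      c \<otimes> (a \<oplus> b) = c \<otimes> a \<oplus> c \<otimes> b"

definition two_sided_ideal :: "'a set \<Rightarrow> ('a, 'b) ring_scheme \<Rightarrow> bool" where
  "two_sided_ideal I R \<longleftrightarrow> additive_subgroup I R \<and>
     (\<forall>a\<in>carrier R. \<forall>x\<in>I. a \<otimes>\<^bsub>R\<^esub> x \<in> I \<and> x \<otimes>\<^bsub>R\<^esub> a \<in> I)"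

definition generated_ideal :: "('a, 'b) ring_scheme \<Rightarrow> 'a set \<Rightarrow> 'a set" where
  "generated_ideal R S = \<Inter>{I. two_sided_ideal I R \<and> S \<subseteq> I}"


section \<open>The Rauzy algebra\<close>

definition scale :: "'k::field \<Rightarrow> 'k pathcomb \<Rightarrow> 'k pathcomb" where
  "scale c f = Poly_Mapping.map ((*) c) f"

definition loop :: "pt \<Rightarrow> pt \<Rightarrow> 'k::field pathcomb" where
  "loop z x = (if tedge z x then Poly_Mapping.single [z, x, z] 1 else 0)"

definition loop_diff :: "3 \<Rightarrow> pt \<Rightarrow> 'k::field pathcomb" where
  "loop_diff a z = loop z (z + pe a) - loop z (z - pe a)"

text \<open>Two distinct edges of a rhombus that meet in \<open>v\<close> are consecutive along its boundary; hence
  \<open>\<exists>t. rhombus u v w t\<close> says that \<open>{u, v}\<close> and \<open>{v, w}\<close> are both edges of one rhombus.\<close>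

definition relations :: "(3 \<Rightarrow> pt \<Rightarrow> int) \<Rightarrow> 'k::field pathcomb set" where
  "relations s =
     {Poly_Mapping.single [u, v, w] 1 | u v w.
        tedge u v \<and> tedge v w \<and> u \<noteq> w \<and> \<not> (\<exists>t. rhombus u v w t)}
   \<union> {Poly_Mapping.single [z, u, y] 1 - Poly_Mapping.single [z, v, y] 1 | z u y v.
        rhombus z u y v}
   \<union> {scale (of_int (s a z)) (loop_diff a z) - scale (of_int (s c z)) (loop_diff c z) | a c z.
        tvertex z}"

definition rauzy_ideal :: "(3 \<Rightarrow> pt \<Rightarrow> int) \<Rightarrow> 'k::field pathcomb set" where
  "rauzy_ideal s = generated_ideal path_algebra (relations s)"

definition rauzy_algebra :: "(3 \<Rightarrow> pt \<Rightarrow> int) \<Rightarrow> 'k::field pathcomb set ring" where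
  "rauzy_algebra s = path_algebra Quot (rauzy_ideal s)"

definition path_class :: "(3 \<Rightarrow> pt \<Rightarrow> int) \<Rightarrow> pt list \<Rightarrow> 'k::field pathcomb set" where
  "path_class s p = rauzy_ideal s +>\<^bsub>path_algebra\<^esub> Poly_Mapping.single p 1"


section \<open>Right modules\<close>

text \<open>Right modules reuse the record of left modules: \<open>a \<odot>\<^bsub>M\<^esub> m\<close> stands for \<open>m \<cdot> a\<close>.
  As \<open>A\<close> has no unit, \<open>M A = M\<close> replaces the axiom \<open>m \<cdot> 1 = m\<close>. Since \<open>A\<close> contains
  the scalar multiples of the trivial paths, the action of \<open>A\<close> determines the structure of \<open>M\<close>
  as a vector space over \<open>k\<close>, which is therefore not recorded separately.\<close>

locale right_module = A?: nonunital_ring A + M?: abelian_group M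
    for A (structure) and M (structure) +
  assumes act_closed: "\<lbrakk>a \<in> carrier A; m \<in> carrier M\<rbrakk> \<Longrightarrow> a \<odot>\<^bsub>M\<^esub> m \<in> carrier M"
    and act_l_distr: "\<lbrakk>a \<in> carrier A; b \<in> carrier A; m \<in> carrier M\<rbrakk> \<Longrightarrow>
      (a \<oplus> b) \<odot>\<^bsub>M\<^esub> m = a \<odot>\<^bsub>M\<^esub> m \<oplus>\<^bsub>M\<^esub> b \<odot>\<^bsub>M\<^esub> m"
    and act_r_distr: "\<lbrakk>a \<in> carrier A; m \<in> carrier M; n \<in> carrier M\<rbrakk> \<Longrightarrow>
      a \<odot>\<^bsub>M\<^esub> (m \<oplus>\<^bsub>M\<^esub> n) = a \<odot>\<^bsub>M\<^esub> m \<oplus>\<^bsub>M\<^esub> a \<odot>\<^bsub>M\<^esub> n"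
    and act_assoc: "\<lbrakk>a \<in> carrier A; b \<in> carrier A; m \<in> carrier M\<rbrakk> \<Longrightarrow>
      (a \<otimes> b) \<odot>\<^bsub>M\<^esub> m = b \<odot>\<^bsub>M\<^esub> (a \<odot>\<^bsub>M\<^esub> m)"
    and act_unital: "carrier M = generate (add_monoid M)
      {a \<odot>\<^bsub>M\<^esub> m | a m. a \<in> carrier A \<and> m \<in> carrier M}"

text \<open>The library's \<open>submodule N A M\<close> (an additive subgroup closed under the action) applies
  verbatim.\<close>

definition restrict_module :: "('a, 'm) module \<Rightarrow> 'm set \<Rightarrow> ('a, 'm) module" where
  "restrict_module M N = M\<lparr>carrier := N\<rparr>"

definition quotient_module :: "('a, 'm) module \<Rightarrow> 'm set \<Rightarrow> ('a, 'm set) module" where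
  "quotient_module M N = \<lparr>carrier = a_rcosets\<^bsub>M\<^esub> N, mult = undefined, one = undefined,
     zero = N, add = set_add M, smult = (\<lambda>a X. \<Union>m\<in>X. N +>\<^bsub>M\<^esub> (a \<odot>\<^bsub>M\<^esub> m))\<rparr>"

definition module_dsum :: "('a, 'm) module \<Rightarrow> ('a, 'n) module \<Rightarrow> ('a, 'm \<times> 'n) module" where
  "module_dsum M N = \<lparr>carrier = carrier M \<times> carrier N, mult = undefined, one = undefined,
     zero = (\<zero>\<^bsub>M\<^esub>, \<zero>\<^bsub>N\<^esub>),
     add = (\<lambda>(m, n) (m', n'). (m \<oplus>\<^bsub>M\<^esub> m', n \<oplus>\<^bsub>N\<^esub> n')),
     smult = (\<lambda>a (m, n). (a \<odot>\<^bsub>M\<^esub> m, a \<odot>\<^bsub>N\<^esub> n))\<rparr>"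

definition regular_module :: "('a, 'b) ring_scheme \<Rightarrow> ('a, 'a) module" where
  "regular_module A = \<lparr>carrier = carrier A, mult = undefined, one = undefined,
     zero = \<zero>\<^bsub>A\<^esub>, add = add A, smult = (\<lambda>a m. m \<otimes>\<^bsub>A\<^esub> a)\<rparr>"

definition generated_submodule ::
    "('a, 'b) ring_scheme \<Rightarrow> ('a, 'm) module \<Rightarrow> 'm set \<Rightarrow> 'm set" where
  "generated_submodule A M S = \<Inter>{N. submodule N A M \<and> S \<subseteq> N}"

definition module_hom ::
    "('a, 'b) ring_scheme \<Rightarrow> ('a, 'm) module \<Rightarrow> ('a, 'n) module \<Rightarrow> ('m \<Rightarrow> 'n) set" where
  "module_hom A M N = {f. f \<in> carrier M \<rightarrow> carrier N \<and>
     (\<forall>m\<in>carrier M. \<forall>n\<in>carrier M. f (m \<oplus>\<^bsub>M\<^esub> n) = f m \<oplus>\<^bsub>N\<^esub> f n) \<and>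
     (\<forall>a\<in>carrier A. \<forall>m\<in>carrier M. f (a \<odot>\<^bsub>M\<^esub> m) = a \<odot>\<^bsub>N\<^esub> f m)}"

definition module_iso ::
    "('a, 'b) ring_scheme \<Rightarrow> ('a, 'm) module \<Rightarrow> ('a, 'n) module \<Rightarrow> bool" where
  "module_iso A M N \<longleftrightarrow> (\<exists>f\<in>module_hom A M N. bij_betw f (carrier M) (carrier N))"

definition short_exact ::
    "('a, 'b) ring_scheme \<Rightarrow> ('a, 'l) module \<Rightarrow> ('a, 'm) module \<Rightarrow> ('a, 'n) module \<Rightarrow>
     ('l \<Rightarrow> 'm) \<Rightarrow> ('m \<Rightarrow> 'n) \<Rightarrow> bool" where
  "short_exact A L M N f g \<longleftrightarrow>
     right_module A L \<and> right_module A M \<and> right_module A N \<and>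
     f \<in> module_hom A L M \<and> g \<in> module_hom A M N \<and>
     inj_on f (carrier L) \<and> f ` carrier L = a_kernel M N g \<and> g ` carrier M = carrier N"

definition maximal_submodule ::
    "('a, 'b) ring_scheme \<Rightarrow> ('a, 'm) module \<Rightarrow> 'm set \<Rightarrow> bool" where
  "maximal_submodule A M N \<longleftrightarrow> submodule N A M \<and> N \<noteq> carrier M \<and>
     (\<forall>N'. submodule N' A M \<and> N \<subseteq> N' \<longrightarrow> N' = N \<or> N' = carrier M)"

definition simple_submodule ::
    "('a, 'b) ring_scheme \<Rightarrow> ('a, 'm) module \<Rightarrow> 'm set \<Rightarrow> bool" where
  "simple_submodule A M N \<longleftrightarrow> submodule N A M \<and> N \<noteq> {\<zero>\<^bsub>M\<^esub>} \<and>
     (\<forall>N'. submodule N' A M \<and> N' \<subseteq> N \<longrightarrow> N' = {\<zero>\<^bsub>M\<^esub>} \<or> N' = N)"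

definition module_rad :: "('a, 'b) ring_scheme \<Rightarrow> ('a, 'm) module \<Rightarrow> 'm set" where
  "module_rad A M = carrier M \<inter> \<Inter>{N. maximal_submodule A M N}"

definition module_soc :: "('a, 'b) ring_scheme \<Rightarrow> ('a, 'm) module \<Rightarrow> 'm set" where
  "module_soc A M = generated_submodule A M (\<Union>{N. simple_submodule A M N})"


section \<open>Modules over the Rauzy algebra\<close>

text \<open>\<open>S\<^sub>z\<close> is the field \<open>k\<close>, on which the class of a combination of paths acts as the
  coefficient of \<open>[z]\<close>. This coefficient does not depend on the representative, because all
  relations are combinations of paths of length two.\<close>

definition simple_module :: "pt \<Rightarrow> ('k::field pathcomb set, 'k) module" where
  "simple_module z = \<lparr>carrier = UNIV, mult = undefined, one = undefined, zero = 0, add = (+),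
     smult = (\<lambda>a c. c * Poly_Mapping.lookup (SOME f. f \<in> a) [z])\<rparr>"

definition rhombus_module ::
    "(3 \<Rightarrow> pt \<Rightarrow> int) \<Rightarrow> ('k::field pathcomb set, 'm) module \<Rightarrow> bool" where
  "rhombus_module s M \<longleftrightarrow>
     (let A = rauzy_algebra s; R = module_rad A M; S = module_soc A M in
      right_module A M \<and>
      (\<exists>z u y v. rhombus z u y v \<and> S \<subseteq> R \<and>
         module_iso A (quotient_module M R) (simple_module y) \<and>
         module_iso A (restrict_module M S) (simple_module z) \<and>
         module_iso A (quotient_module (restrict_module M R) S)
           (module_dsum (simple_module u) (simple_module v))))"

definition rhombus_filtration ::
    "(3 \<Rightarrow> pt \<Rightarrow> int) \<Rightarrow> ('k::field pathcomb set, 'm) module \<Rightarrow> nat \<Rightarrow> bool" where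
  "rhombus_filtration s M r \<longleftrightarrow>
     (\<exists>F :: nat \<Rightarrow> 'm set. F 0 = {\<zero>\<^bsub>M\<^esub>} \<and> F r = carrier M \<and>
        (\<forall>j\<le>r. submodule (F j) (rauzy_algebra s) M) \<and>
        (\<forall>j<r. F j \<subseteq> F (Suc j) \<and>
           rhombus_module s (quotient_module (restrict_module M (F (Suc j))) (F j))))"

definition right_ideal_module ::
    "(3 \<Rightarrow> pt \<Rightarrow> int) \<Rightarrow> 'k::field pathcomb set set \<Rightarrow>
     ('k pathcomb set, 'k pathcomb set) module" where
  "right_ideal_module s N = restrict_module (regular_module (rauzy_algebra s)) N"

definition principal_right_ideal :: "('a, 'b) ring_scheme \<Rightarrow> 'a \<Rightarrow> 'a set" where
  "principal_right_ideal A x = (\<lambda>a. x \<otimes>\<^bsub>A\<^esub> a) ` carrier A"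

definition eA :: "(3 \<Rightarrow> pt \<Rightarrow> int) \<Rightarrow> pt \<Rightarrow>
    ('k::field pathcomb set, 'k pathcomb set) module" where
  "eA s z = right_ideal_module s
     (principal_right_ideal (rauzy_algebra s) (path_class s [z]))"

definition arrows_sum :: "(3 \<Rightarrow> pt \<Rightarrow> int) \<Rightarrow> pt \<Rightarrow> pt \<Rightarrow> pt \<Rightarrow>
    ('k::field pathcomb set, 'k pathcomb set) module" where
  "arrows_sum s z x y = right_ideal_module s
     (principal_right_ideal (rauzy_algebra s) (path_class s [z, x])
        <+>\<^bsub>rauzy_algebra s\<^esub>
      principal_right_ideal (rauzy_algebra s) (path_class s [z, y]))"

text \<open>The submodule of \<open>e\<^sub>x A \<oplus> e\<^sub>y A\<close> generated by the pair of arrows \<open>(x \<rightarrow> z, y \<rightarrow> z)\<close>.\<close>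

definition arrow_pair_module :: "(3 \<Rightarrow> pt \<Rightarrow> int) \<Rightarrow> pt \<Rightarrow> pt \<Rightarrow> pt \<Rightarrow>
    ('k::field pathcomb set, 'k pathcomb set \<times> 'k pathcomb set) module" where
  "arrow_pair_module s z x y = restrict_module (module_dsum (eA s x) (eA s y))
     (generated_submodule (rauzy_algebra s) (module_dsum (eA s x) (eA s y))
        {(path_class s [x, z], path_class s [y, z])})"

end

theory Submission
  imports Defs
begin

text \<open>
  The left eigenvector \<open>(1, wt2, wt3)\<close> of the substitution matrix assigns a height to each point
  of the lattice, and the Rauzy tiling consists of all \<open>(z, k)\<close> for which the height of \<open>z\<close>
  lies between 0 and the weight of \<open>k\<close>. The substitution is bijective on these pairs, and the
  finite relation \<open>near\<close> between neighbouring pairs is inherited by their parents; this shows that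
  the patches exhaust them. In particular every edge has exactly one rhombus on each side.

  The latter fact makes a certain functional on closed paths of length four, symmetric up to sign
  under rotation, vanish on the ideal of relations. It certifies that the required paths are nonzero
  in \<open>A\<close>, and no basis of \<open>e\<^sub>z A\<close> has to be computed.

  A subquotient \<open>(F + m A) / F\<close> is a rhombus module as soon as all paths that leave the rhombus
  move \<open>m\<close> into \<open>F\<close> but the path across the rhombus does not. Writing \<open>y\<^sub>j\<close> for the
  corner opposite to \<open>z\<close> in the rhombus at \<open>x\<^sub>j, x\<^sub>j\<^sub>+\<^sub>1\<close>, this is applied to \<open>m\<close> equal to the path from
  \<open>z\<close> to \<open>y\<^sub>1\<close>, to \<open>b\<^sub>1\<close> and to \<open>b\<^sub>2\<close> in the kernel, and to the images of
  \<open>b\<^sub>3\<close>, \<open>b\<^sub>6\<close> and \<open>e\<^sub>z\<close> in the cokernel. Exactness follows by comparing coefficients along the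
  latter filtration.
\<close>

section \<open>The tiling as a stepped plane\<close>

text \<open>The relations show directly that paths vanish or coincide, but never that a path is
  nonzero; that is the obstacle the trace removes. Every path that has to survive extends, up to
  sign, to a closed path of length four with trace 1 or -1, which is nonzero in any field. Length
  four is the natural place: all paths \<open>z, x, z, x, z\<close> agree up to sign and are killed
  by every further arrow. Signs matter only for the consistency of the trace. Elsewhere paths are
  compared up to sign, because they are only tested for membership in submodules. The path across a
  rhombus is shown to lie outside an earlier step of a filtration by looking at its end point: the
  earlier step has nothing at that vertex, so it suffices that the path is nonzero. Injectivity
  modulo the kernel uses no dimension count. The same rhombus conditions hold for b_3, b_6 and the
  trivial path over the kernel inside A and over the earlier steps inside the cokernel, so vanishing
  coefficients carry over from one side to the other. As A has no unit, finite sums of trivial paths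
  replace it throughout.\<close>

lemma three_neq [simp]: "(1::3) \<noteq> 2" "(2::3) \<noteq> 1" "(1::3) \<noteq> 3" "(3::3) \<noteq> 1" "(2::3) \<noteq> 3" "(3::3) \<noteq> 2"
  by simp_all

text \<open>The cubic says that \<open>t = 1 + x\<close> satisfies \<open>t^3 = t^2 + t + 1\<close>,
  so \<open>x\<close> is the tribonacci constant minus one. The narrow interval feeds all later
  numerical comparisons of heights.\<close>

lemma wt2_exists: "\<exists>x::real. 0.83928 \<le> x \<and> x \<le> 0.83929 \<and> x ^ 3 + 2 * x\<^sup>2 - 2 = 0"
  by (rule IVT) (auto intro!: continuous_intros simp: field_simps power_numeral_reduce)

definition wt2 :: real where
  "wt2 = (SOME x. 0.83928 \<le> x \<and> x \<le> 0.83929 \<and> x ^ 3 + 2 * x\<^sup>2 - 2 = 0)"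
text \<open>With \<open>t = 1 + wt2\<close> this is \<open>t^2 - t - 1\<close>, the reciprocal of
  \<open>t\<close>.\<close>

definition wt3 :: real where "wt3 = wt2\<^sup>2 + wt2 - 1"

lemma wt2_bounds: "0.83928 \<le> wt2" "wt2 \<le> 0.83929" and wt2_root: "wt2 ^ 3 + 2 * wt2\<^sup>2 - 2 = 0"
  using someI_ex[OF wt2_exists] unfolding wt2_def by auto

lemma wt2_wt2: "wt2 * wt2 = 1 + wt3 - wt2" and wt2_wt3: "wt2 * wt3 = 1 - wt3"
  using wt2_root by (simp_all add: wt3_def power2_eq_square power3_eq_cube algebra_simps)

lemma wt3_bounds: "0.54366 \<le> wt3" "wt3 \<le> 0.54371"
proof -
  have "0.83928 * 0.83928 \<le> wt2 * wt2" "wt2 * wt2 \<le> 0.83929 * 0.83929"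
    using wt2_bounds by - (rule mult_mono; simp)+
  then show "0.54366 \<le> wt3" "wt3 \<le> 0.54371"
    using wt2_bounds by (auto simp: wt3_def power2_eq_square)
qed

lemmas wt_bounds = wt2_bounds wt3_bounds

section \<open>Heights and the substitution\<close>

definition ht :: "int \<Rightarrow> int \<Rightarrow> int \<Rightarrow> real" where
  "ht a b c = of_int a + of_int b * wt2 + of_int c * wt3"

definition wt :: "3 \<Rightarrow> real" where
  "wt k = (if k = 1 then 1 else if k = 2 then wt2 else wt3)"

lemma wt_simps [simp]: "wt 1 = 1" "wt 2 = wt2" "wt 3 = wt3"
  by (simp_all add: wt_def)

definition slab :: "int \<Rightarrow> int \<Rightarrow> int \<Rightarrow> 3 \<Rightarrow> bool" where
  "slab a b c k \<longleftrightarrow> 0 \<le> ht a b c \<and> ht a b c < wt k"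

definition tile :: "int \<Rightarrow> int \<Rightarrow> int \<Rightarrow> 3 \<Rightarrow> bool" where
  "tile a b c k \<longleftrightarrow> (vector [a, b, c], k) \<in> rauzy_tiling"

lemma subst_mat_vector: "subst_mat *v vector [a, b, c] = vector [b, c, a - b - c]"
  by (simp add: subst_mat_def matrix_vector_mult_def vec_eq_iff forall_3 sum_3)

lemma subst_mat_columns: "column 2 subst_mat = vector [1, 0, - 1]" "column 3 subst_mat = vector [0, 1, - 1]"
  by (simp_all add: subst_mat_def column_def vec_eq_iff forall_3)

lemma vector3_add: "vector [a, b, c] + vector [a', b', c'] = (vector [a + a', b + b', c + c'] :: int^3)"
  by (simp add: vec_eq_iff forall_3)

lemma vector3_eq_iff: "vector [a, b, c] = (vector [a', b', c'] :: int^3) \<longleftrightarrow> a = a' \<and> b = b' \<and> c = c'"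
  by (auto simp: vec_eq_iff forall_3)

lemma vector3_surj: "\<exists>a b c. (w :: int^3) = vector [a, b, c]"
  by (intro exI[of _ "w $ 1"] exI[of _ "w $ 2"] exI[of _ "w $ 3"]) (simp add: vec_eq_iff forall_3)

definition child :: "int \<Rightarrow> int \<Rightarrow> int \<Rightarrow> 3 \<Rightarrow> int \<Rightarrow> int \<Rightarrow> int \<Rightarrow> 3 \<Rightarrow> bool" where
  "child a b c k a' b' c' k' \<longleftrightarrow> (vector [a', b', c'], k') \<in> subst_tile (vector [a, b, c], k)"

text \<open>Solved for the parent, because neighbourhoods are traced from children back to
  parents.\<close>

lemma child_iff:
  "child a b c k a' b' c' k' \<longleftrightarrow>
     (k = 2 \<and> k' = 1 \<and> a = a' + b' + c' \<and> b = a' \<and> c = b') \<or>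
     (k = 1 \<and> k' = 1 \<and> a = a' + b' + c' \<and> b = a' - 1 \<and> c = b') \<or>
     (k = 3 \<and> k' = 2 \<and> a = a' + b' + c' \<and> b = a' \<and> c = b') \<or>
     (k = 1 \<and> k' = 2 \<and> a = a' + b' + c' \<and> b = a' \<and> c = b' - 1) \<or>
     (k = 1 \<and> k' = 3 \<and> a = a' + b' + c' \<and> b = a' \<and> c = b')"
  using exhaust_3[of k] exhaust_3[of k']
  by (elim disjE; simp add: child_def subst_tile_def Let_def subst_mat_vector subst_mat_columns vector3_add vector3_eq_iff; presburger?)

text \<open>The triple \<open>(a + b + c, a, b)\<close> is the preimage of \<open>(a, b, c)\<close>
  under \<open>subst_mat\<close>. The eigenvalue belonging to the height is \<open>wt3\<close>, and
  its reciprocal is \<open>1 + wt2\<close>.\<close>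

lemma beta_ht:
  "ht (a + b + c) a b = (1 + wt2) * ht a b c"
proof -
  have "(1 + wt2) * ht a b c = of_int a + of_int a * wt2 + of_int b * wt2 + of_int b * (wt2 * wt2) + of_int c * wt3 + of_int c * (wt2 * wt3)"
    by (simp add: ht_def algebra_simps)
  then show ?thesis by (simp add: ht_def wt2_wt2 wt2_wt3 algebra_simps)
qed

lemma ht_step: "ht a b (c + n) = ht a b c + of_int n * wt3" "ht a (b + n) c = ht a b c + of_int n * wt2"
  "ht (a + n) b c = ht a b c + of_int n"
  "ht a b (c - n) = ht a b c - of_int n * wt3" "ht a (b - n) c = ht a b c - of_int n * wt2"
  "ht (a - n) b c = ht a b c - of_int n"
  by (simp_all add: ht_def algebra_simps)

text \<open>Stretched by \<open>1 + wt2\<close>, the height intervals of types 1, 2, 3 become [0, 1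
  + wt2), [0, 1 + wt3) and [0, 1). The first is cut at \<open>wt2\<close> into those of parents of
  types 2 and 1, the second at \<open>wt3\<close> into those of types 3 and 1, the third is that of
  type 1. The same partition read backwards gives \<open>slab_parent\<close>.\<close>

lemma slab_child: "slab a b c k" if "child a' b' c' k' a b c k" "slab a' b' c' k'"
proof -
  have e: "ht (a + b + c) a b = (1 + wt2) * ht a b c" by (rule beta_ht)
  have p: "1 + wt2 > 0" using wt_bounds by simp
  have lo: "0 \<le> ht a b c \<longleftrightarrow> 0 \<le> ht (a + b + c) a b"
    unfolding e using p by (simp add: zero_le_mult_iff)
  have hi: "ht a b c < x \<longleftrightarrow> ht (a + b + c) a b < (1 + wt2) * x" for x
    unfolding e using p by simp
  have w: "(1 + wt2) * wt2 = 1 + wt3" "(1 + wt2) * wt3 = 1"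
    by (simp_all add: algebra_simps wt2_wt2 wt2_wt3)
  show ?thesis
    using that wt_bounds unfolding slab_def lo hi child_iff
    by (elim conjE disjE) (simp_all add: w ht_step)
qed

lemma slab_parent: "\<exists>a' b' c' k'. child a' b' c' k' a b c k \<and> slab a' b' c' k'" if "slab a b c k"
proof -
  have e: "ht (a + b + c) a b = (1 + wt2) * ht a b c" by (rule beta_ht)
  have p: "1 + wt2 > 0" using wt_bounds by simp
  have lo: "0 \<le> ht a b c \<longleftrightarrow> 0 \<le> ht (a + b + c) a b"
    unfolding e using p by (simp add: zero_le_mult_iff)
  have hi: "ht a b c < x \<longleftrightarrow> ht (a + b + c) a b < (1 + wt2) * x" for x
    unfolding e using p by simp
  have w: "(1 + wt2) * wt2 = 1 + wt3" "(1 + wt2) * wt3 = 1"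
    by (simp_all add: algebra_simps wt2_wt2 wt2_wt3)
  note s = that[unfolded slab_def lo hi]
  consider "k = 1" | "k = 2" | "k = 3" using exhaust_3[of k] by blast
  then show ?thesis
  proof cases
    case 1
    show ?thesis
    proof (cases "ht (a + b + c) a b < wt2")
      case True
      then show ?thesis using s 1 wt_bounds
        by (intro exI[of _ "a + b + c"] exI[of _ a] exI[of _ b] exI[of _ 2]) (simp add: child_iff slab_def)
    next
      case False
      then show ?thesis using s 1 wt_bounds
        by (intro exI[of _ "a + b + c"] exI[of _ "a - 1"] exI[of _ b] exI[of _ 1]) (simp add: child_iff slab_def ht_step)
    qed
  next
    case 2
    show ?thesis
    proof (cases "ht (a + b + c) a b < wt3")
      case True
      then show ?thesis using s 2 wt_bounds
        by (intro exI[of _ "a + b + c"] exI[of _ a] exI[of _ b] exI[of _ 3]) (simp add: child_iff slab_def)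
    next
      case False
      then show ?thesis using s 2 wt_bounds
        by (intro exI[of _ "a + b + c"] exI[of _ "a"] exI[of _ "b - 1"] exI[of _ 1]) (simp add: child_iff slab_def ht_step w)
    qed
  next
    case 3
    then show ?thesis using s wt_bounds
      by (intro exI[of _ "a + b + c"] exI[of _ a] exI[of _ b] exI[of _ 1]) (simp add: child_iff slab_def w)
  qed
qed

lemma zero_vector3: "(0 :: int^3) = vector [0, 0, 0]"
  by (simp add: vec_eq_iff forall_3)

lemma patch_0_iff: "(vector [a, b, c], k) \<in> patch 0 \<longleftrightarrow> a = 0 \<and> b = 0 \<and> c = 0"
  using exhaust_3[of k] by (auto simp: zero_vector3 vector3_eq_iff)

lemma patch_Suc_iff:
  "(vector [a, b, c], k) \<in> patch (Suc n) \<longleftrightarrow> (\<exists>a' b' c' k'. (vector [a', b', c'], k') \<in> patch n \<and> child a' b' c' k' a b c k)"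
proof
  assume "(vector [a, b, c], k) \<in> patch (Suc n)"
  then obtain w k' where "(w, k') \<in> patch n" "(vector [a, b, c], k) \<in> subst_tile (w, k')" by auto
  then show "\<exists>a' b' c' k'. (vector [a', b', c'], k') \<in> patch n \<and> child a' b' c' k' a b c k"
    using vector3_surj[of w] by (auto simp: child_def)
qed (auto simp: child_def)

lemma patch_slab: "(vector [a, b, c], k) \<in> patch n \<Longrightarrow> slab a b c k"
proof (induction n arbitrary: a b c k)
  case 0
  then show ?case using exhaust_3[of k] wt_bounds by (auto simp: patch_0_iff slab_def ht_def simp del: patch.simps)
next
  case (Suc n)
  then show ?case unfolding patch_Suc_iff using slab_child by blast
qed

lemma tile_slab: "tile a b c k \<Longrightarrow> slab a b c k"
  using patch_slab by (auto simp: tile_def rauzy_tiling_def)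

lemma tile_child:
  assumes "child a' b' c' k' a b c k" and "tile a' b' c' k'"
  shows "tile a b c k"
proof -
  obtain n where "(vector [a', b', c'], k') \<in> patch n" using assms(2) by (auto simp: tile_def rauzy_tiling_def)
  then have "(vector [a, b, c], k) \<in> patch (Suc n)" using assms(1) patch_Suc_iff by blast
  then show ?thesis unfolding tile_def rauzy_tiling_def by blast
qed

lemma tile_zero: "tile 0 0 0 k"
  unfolding tile_def rauzy_tiling_def using patch_0_iff by blast

text \<open>Differences between two tiles: the closure of the steps between adjacent tiles under passing to
  parents, restricted to the pairs that both fit into the slab.\<close>

definition near :: "(3 \<times> int \<times> int \<times> int \<times> 3) set" where
  "near = {(1, - 1, 0, 1, 1), (1, - 1, 0, 1, 2), (1, - 1, 0, 1, 3), (1, - 1, 1, - 1, 2),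
    (1, - 1, 1, 0, 1), (1, - 1, 1, 0, 2), (1, 0, - 1, 0, 1), (1, 0, - 1, 1, 1),
    (1, 0, 0, - 1, 1), (1, 0, 0, 0, 1), (1, 0, 0, 0, 2), (1, 0, 0, 0, 3),
    (1, 0, 0, 1, 1), (1, 0, 0, 1, 2), (1, 0, 1, - 1, 1), (1, 0, 1, - 1, 2),
    (1, 0, 1, 0, 1), (1, 1, - 1, 0, 1), (1, 1, 0, - 1, 1), (2, 0, - 1, 1, 1),
    (2, 0, - 1, 1, 2), (2, 0, - 1, 1, 3), (2, 0, 0, - 1, 1), (2, 0, 0, - 1, 2),
    (2, 0, 0, 0, 1), (2, 0, 0, 0, 2), (2, 0, 0, 0, 3), (2, 0, 0, 1, 2),
    (2, 0, 1, - 1, 2), (2, 1, - 1, 0, 1), (2, 1, - 1, 1, 1), (2, 1, 0, - 1, 1),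
    (3, 0, 0, 0, 1), (3, 0, 0, 0, 2), (3, 0, 0, 0, 3), (3, 0, 1, - 1, 2),
    (3, 1, 0, - 1, 1)}"

definition parent_opts :: "3 \<Rightarrow> (3 \<times> int \<times> int) set" where
  "parent_opts k = (if k = 1 then {(2, 0, 0), (1, 1, 0)} else if k = 2 then {(3, 0, 0), (1, 0, 1)} else {(1, 0, 0)})"

lemma child_parent_opts:
  "child x y z l a b c k \<Longrightarrow> \<exists>(m, v, w)\<in>parent_opts k. l = m \<and> x = a + b + c \<and> y = a - v \<and> z = b - w"
  unfolding child_iff parent_opts_def by (elim disjE) simp_all

text \<open>The inverse of \<open>subst_mat\<close> contracts the two directions complementary to
  the height but stretches the height. The bounds, which hold for differences of two parents in the
  slab, are what keeps the set of differences finite.\<close>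

lemma near_closed:
  "\<forall>(k, p, q, r, k')\<in>near. \<forall>(l, v, w)\<in>parent_opts k. \<forall>(l', v', w')\<in>parent_opts k'.
     - wt l < ht (p + q + r) (p + v - v') (q + w - w') \<and> ht (p + q + r) (p + v - v') (q + w - w') < wt l'
     \<longrightarrow> (l, p + q + r, p + v - v', q + w - w', l') \<in> near"
  using wt_bounds
  apply (simp only: near_def ball_simps prod.case)
  apply (intro conjI TrueI; simp add: parent_opts_def ht_def)
  done

lemma near_parents:
  assumes "(k, p, q, r, k') \<in> near"
    and "child x y z l a b c k" and "child x' y' z' l' (a + p) (b + q) (c + r) k'"
    and "slab x y z l" and "slab x' y' z' l'"
  shows "(l, x' - x, y' - y, z' - z, l') \<in> near"
proof -
  have *: "ht x' y' z' = ht x y z + ht (x' - x) (y' - y) (z' - z)"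
    by (simp add: ht_def algebra_simps)
  have h: "- wt l < ht (x' - x) (y' - y) (z' - z)" "ht (x' - x) (y' - y) (z' - z) < wt l'"
    using assms(4,5) unfolding slab_def * by auto
  obtain v w where v: "(l, v, w) \<in> parent_opts k" "x = a + b + c" "y = a - v" "z = b - w"
    using child_parent_opts[OF assms(2)] by auto
  obtain v' w' where v': "(l', v', w') \<in> parent_opts k'" "x' = (a + p) + (b + q) + (c + r)" "y' = (a + p) - v'" "z' = (b + q) - w'"
    using child_parent_opts[OF assms(3)] by auto
  have e: "x' - x = p + q + r" "y' - y = p + v - v'" "z' - z = q + w - w'"
    using v v' by simp_all
  show ?thesis
    using near_closed assms(1) v(1) v'(1) h unfolding e by fast
qed

text \<open>Base of the induction over patches: every candidate next to the tiles at the origin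
  either leaves the slab or appears within three substitutions. The facts \<open>1\<close>,
  \<open>2\<close>, \<open>3\<close> are these generations.\<close>

lemma near_zero_tile: "\<forall>(k, p, q, r, k')\<in>near. slab p q r k' \<longrightarrow> tile p q r k'"
proof -
  have z: "tile 0 0 0 k" for k by (rule tile_zero)
  have 1: "tile 1 0 (- 1) 1" "tile 0 1 (- 1) 2"
    by (rule tile_child[OF _ z[of 1]], simp add: child_iff)+
  have 2: "tile 1 (- 1) 0 1" "tile 1 (- 1) 1 1" "tile 0 0 1 2"
    apply (rule tile_child[OF _ 1(2)], simp add: child_iff)
    apply (rule tile_child[OF _ 1(1)], simp add: child_iff)
    apply (rule tile_child[OF _ 1(1)], simp add: child_iff)
    done
  have 3: "tile 0 0 1 1" "tile 0 1 (- 1) 1" "tile 0 1 0 1"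
    apply (rule tile_child[OF _ 2(1)], simp add: child_iff)
    apply (rule tile_child[OF _ 2(3)], simp add: child_iff)
    apply (rule tile_child[OF _ 2(2)], simp add: child_iff)
    done
  show ?thesis
    using wt_bounds
    apply (simp only: near_def ball_simps prod.case)
    apply (intro conjI TrueI; simp add: z 1 2 3; simp add: slab_def ht_def)
    done
qed

text \<open>Induction on the generation of the known tile. Both pairs pass to parents in the slab,
  which are again \<open>near\<close>; the known parent lies in the previous patch, so the other
  parent is a tile, and then so is its child.\<close>

lemma tile_near:
  "(vector [a, b, c], k) \<in> patch n \<Longrightarrow> (k, p, q, r, k') \<in> near \<Longrightarrow> slab (a + p) (b + q) (c + r) k'
     \<Longrightarrow> tile (a + p) (b + q) (c + r) k'"
proof (induction n arbitrary: a b c k p q r k')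
  case 0
  then have "a = 0" "b = 0" "c = 0" using patch_0_iff by blast+
  then show ?case using 0 near_zero_tile by fastforce
next
  case (Suc n)
  obtain x y z l where p: "(vector [x, y, z], l) \<in> patch n" "child x y z l a b c k"
    using Suc.prems(1) patch_Suc_iff by blast
  obtain x' y' z' l' where p': "child x' y' z' l' (a + p) (b + q) (c + r) k'" "slab x' y' z' l'"
    using slab_parent[OF Suc.prems(3)] by blast
  have n: "(l, x' - x, y' - y, z' - z, l') \<in> near"
    using near_parents[OF Suc.prems(2) p(2) p'(1) patch_slab[OF p(1)] p'(2)] .
  have "tile (x + (x' - x)) (y + (y' - y)) (z + (z' - z)) l'"
    by (rule Suc.IH[OF p(1) n]) (use p'(2) in simp)
  then show ?case using tile_child[OF p'(1)] by simp
qed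

lemma tile_move:
  assumes "tile a b c k" "(k, p, q, r, k') \<in> near" "a' = a + p" "b' = b + q" "c' = c + r" "slab a' b' c' k'"
  shows "tile a' b' c' k'"
  using assms tile_near unfolding tile_def rauzy_tiling_def by auto

text \<open>Since the second and third coordinates determine a tile of type 1, such tiles form a copy of
  \<open>\<int>\<^sup>2\<close>, along which \<open>near\<close> is followed from the origin.\<close>

lemma slab_1_ex: "\<exists>a. slab a b c 1"
proof -
  have "slab (- \<lfloor>of_int b * wt2 + of_int c * wt3\<rfloor>) b c 1"
    unfolding slab_def ht_def by (simp; linarith)
  then show ?thesis ..
qed

lemma slab_1_unique: "slab a b c 1 \<Longrightarrow> slab a' b c 1 \<Longrightarrow> a = a'"
    unfolding slab_def ht_def by simp

text \<open>A step in the second or third coordinate changes the height by \<open>wt2\<close> or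
  \<open>wt3\<close>, both below 1, so the first coordinate moves by at most 1. The remaining
  combinations missing from \<open>near\<close> violate the height bounds.\<close>

lemma slab_1_step:
  assumes "slab a b c 1" "slab a' b' c' 1"
    and "b' = b + 1 \<and> c' = c \<or> b' = b - 1 \<and> c' = c \<or> b' = b \<and> c' = c + 1 \<or> b' = b \<and> c' = c - 1"
  shows "(1, a' - a, b' - b, c' - c, 1) \<in> near"
proof -
  have "-2 < real_of_int (a' - a)" "real_of_int (a' - a) < 2"
    using assms wt_bounds by (auto simp: slab_def ht_def algebra_simps)
  then have c: "a' - a = -1 \<or> a' - a = 0 \<or> a' - a = 1" by linarith
  have *: "ht a' b' c' = ht a b c + ht (a' - a) (b' - b) (c' - c)"
    by (simp add: ht_def algebra_simps)
  have h: "- 1 < ht (a' - a) (b' - b) (c' - c)" "ht (a' - a) (b' - b) (c' - c) < 1"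
    using assms(1,2) unfolding slab_def * by auto
  show ?thesis
    using c assms(3) h wt_bounds
    by (elim disjE conjE; simp add: near_def ht_def)
qed

lemma slab_1_tile: "slab a b c 1 \<Longrightarrow> tile a b c 1"
proof -
  have step: "(\<forall>a. slab a b' c' 1 \<longrightarrow> tile a b' c' 1)"
    if "\<forall>a. slab a b c 1 \<longrightarrow> tile a b c 1"
      "b' = b + 1 \<and> c' = c \<or> b' = b - 1 \<and> c' = c \<or> b' = b \<and> c' = c + 1 \<or> b' = b \<and> c' = c - 1" for b c b' c'
  proof (intro allI impI)
    fix a' assume s': "slab a' b' c' 1"
    obtain a where s: "slab a b c 1" using slab_1_ex by blast
    show "tile a' b' c' 1"
      by (rule tile_move[OF _ slab_1_step[OF s s' that(2)] _ _ _ s']) (use that(1) s in auto)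
  qed
  have 0: "\<forall>a. slab a 0 0 1 \<longrightarrow> tile a 0 0 1"
  proof (intro allI impI)
    fix a assume "slab a 0 0 1"
    moreover have "slab 0 0 0 1" by (simp add: slab_def ht_def)
    ultimately show "tile a 0 0 1" using slab_1_unique tile_zero by blast
  qed
  have 1: "\<forall>a. slab a b 0 1 \<longrightarrow> tile a b 0 1" for b
    by (induction b rule: int_induct[where k = 0]) (use 0 step in blast)+
  have "\<forall>a. slab a b c 1 \<longrightarrow> tile a b c 1"
    by (induction c rule: int_induct[where k = 0]) (use 1 step in blast)+
  then show "slab a b c 1 \<Longrightarrow> tile a b c 1" by blast
qed

theorem tile_iff_slab: "tile a b c k \<longleftrightarrow> slab a b c k"
proof
  assume s: "slab a b c k"
  \<comment> \<open>All weights are at most 1, so the slab of type \<open>k\<close> is contained in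
    that of type 1; afterwards \<open>(1, 0, 0, 0, k)\<close> in \<open>near\<close> changes the
    type in place.\<close>
  then have t: "tile a b c 1"
    using wt_bounds exhaust_3[of k] by (intro slab_1_tile) (auto simp: slab_def)
  show "tile a b c k"
    by (rule tile_move[OF t, of 0 0 0]) (use s exhaust_3[of k] in \<open>auto simp: near_def\<close>)
qed (rule tile_slab)

section \<open>Vertices, edges and rhombi\<close>

lemma pe_simps: "pe 1 = vector [- sqrt 3 / 2, - 1 / 2]" "pe 2 = vector [sqrt 3 / 2, - 1 / 2]" "pe 3 = vector [0, 1]"
  by (simp_all add: pe_def proj_def axis_def vec_eq_iff forall_2)

lemma pe_scaled_eq_iff:
  assumes "e \<in> {1, -1}" "e' \<in> {1, - 1 :: real}"
  shows "e *\<^sub>R pe a = e' *\<^sub>R pe b \<longleftrightarrow> e = e' \<and> a = b"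
  using assms exhaust_3[of a] exhaust_3[of b]
  by (elim disjE; auto simp: pe_simps vec_eq_iff forall_2)

section \<open>Lifting the vertices of the tiling to the lattice\<close>

definition hgt :: "int^3 \<Rightarrow> real" where
  "hgt w = (\<Sum>k\<in>UNIV. of_int (w $ k) * wt k)"

lemma hgt_add: "hgt (w + w') = hgt w + hgt w'" and hgt_diff: "hgt (w - w') = hgt w - hgt w'"
  and hgt_axis: "hgt (axis k 1) = wt k"
  using exhaust_3[of k] by (auto simp: hgt_def sum_3 algebra_simps axis_def)

lemma proj_int_add: "proj_int (w + w') = proj_int w + proj_int w'"
  and proj_int_diff: "proj_int (w - w') = proj_int w - proj_int w'"
  and proj_int_axis: "proj_int (axis k 1) = pe k"
  using exhaust_3[of k] by (auto simp: proj_int_def proj_def pe_simps vec_eq_iff forall_2 algebra_simps axis_def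
     add_divide_distrib diff_divide_distrib)

lemma hgt_0 [simp]: "hgt 0 = 0" and proj_int_0 [simp]: "proj_int 0 = 0"
  by (simp_all add: hgt_def proj_int_def proj_def vec_eq_iff)

lemma wt_pos: "0 < wt k"
  using exhaust_3[of k] wt_bounds by auto

lemma rauzy_tiling_iff: "(w, k) \<in> rauzy_tiling \<longleftrightarrow> 0 \<le> hgt w \<and> hgt w < wt k"
proof -
  obtain a b c where w: "w = vector [a, b, c]" using vector3_surj by blast
  show ?thesis
    using tile_iff_slab[of a b c k] by (simp add: w tile_def slab_def hgt_def sum_3 ht_def)
qed

definition wsum :: real where "wsum = 1 + wt2 + wt3"

lemma proj_int_components:
  "proj_int w $ 1 = sqrt 3 / 2 * of_int (w $ 2 - w $ 1)"
  "proj_int w $ 2 = of_int (2 * w $ 3 - w $ 1 - w $ 2) / 2"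
  by (simp_all add: proj_int_def proj_def algebra_simps diff_divide_distrib)

text \<open>The kernel of \<open>proj_int\<close> is spanned by (1, 1, 1), whose height is
  \<open>wsum\<close>, and a half-open interval of that length meets each fibre at most once. Every
  vertex thus has one canonical lift.\<close>

lemma hgt_unique:
  assumes "proj_int w = proj_int w'" "0 \<le> hgt w" "hgt w < wsum" "0 \<le> hgt w'" "hgt w' < wsum"
  shows "w = w'"
proof -
  have eq: "real_of_int (w $ 2 - w $ 1) = real_of_int (w' $ 2 - w' $ 1)"
    "real_of_int (2 * w $ 3 - w $ 1 - w $ 2) = real_of_int (2 * w' $ 3 - w' $ 1 - w' $ 2)"
    using arg_cong[OF assms(1), of "\<lambda>x. x $ 1"] arg_cong[OF assms(1), of "\<lambda>x. x $ 2"]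
    unfolding proj_int_components by simp_all
  define m where "m = w $ 1 - w' $ 1"
  have m: "w $ 1 = w' $ 1 + m" "w $ 2 = w' $ 2 + m" "w $ 3 = w' $ 3 + m"
    using eq unfolding of_int_eq_iff m_def by linarith+
  have "hgt w = hgt w' + of_int m * wsum"
    by (simp add: hgt_def sum_3 m wsum_def algebra_simps)
  then have "\<bar>of_int m * wsum\<bar> < wsum" using assms by linarith
  moreover have "wsum > 0" using wt_bounds by (simp add: wsum_def)
  ultimately have "\<bar>real_of_int m\<bar> < 1" by (simp add: abs_mult)
  then have "m = 0" by linarith
  then show ?thesis using m by (simp add: vec_eq_iff forall_3)
qed

text \<open>An edge traversed against \<open>pe a\<close> has its lower end at the far side;
  \<open>low\<close> is the height lost on the way there.\<close>

definition low :: "real \<Rightarrow> 3 \<Rightarrow> real" where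
  "low e a = (if e < 0 then wt a else 0)"

definition triple :: "3 \<Rightarrow> 3 \<Rightarrow> 3 \<Rightarrow> bool" where
  "triple a b c \<longleftrightarrow> a \<noteq> b \<and> b \<noteq> c \<and> a \<noteq> c"

lemma triple_set: "{a, b, c} = {1, 2, 3 :: 3} \<longleftrightarrow> triple a b c"
proof -
  have "{a, b, c} = {1, 2, 3} \<longleftrightarrow> 1 \<in> {a, b, c} \<and> 2 \<in> {a, b, c} \<and> 3 \<in> {a, b, c}"
    using exhaust_3 by blast
  then show ?thesis
    using exhaust_3[of a] exhaust_3[of b] exhaust_3[of c]
    by (elim disjE; simp add: triple_def)
qed

lemma triple_ex: "a \<noteq> b \<Longrightarrow> \<exists>c. triple a b c"
  using exhaust_3[of a] exhaust_3[of b] by (elim disjE; simp add: triple_def; metis three_neq)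

lemma triple_rotate: "triple a b c \<Longrightarrow> triple b a c" "triple a b c \<Longrightarrow> triple c b a" "triple a b c \<Longrightarrow> triple a c b"
  by (auto simp: triple_def)

lemma triple_wsum: "triple a b c \<Longrightarrow> wt a + wt b + wt c = wsum"
  using exhaust_3[of a] exhaust_3[of b] exhaust_3[of c] by (auto simp: triple_def wsum_def)

definition sgn1 :: "real \<Rightarrow> bool" where "sgn1 e \<longleftrightarrow> e = 1 \<or> e = - 1"

text \<open>Here \<open>w\<close> is the lift of the corner, the bounded quantity is the height of
  the base point of the tile (reached by descending along each edge that is traversed backwards),
  and \<open>c\<close> is the type of the tile.\<close>

definition corner :: "int^3 \<Rightarrow> real \<Rightarrow> 3 \<Rightarrow> real \<Rightarrow> 3 \<Rightarrow> 3 \<Rightarrow> bool" where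
  "corner w e a e' b c \<longleftrightarrow> sgn1 e \<and> sgn1 e' \<and> triple a b c \<and>
     0 \<le> hgt w - low e a - low e' b \<and> hgt w - low e a - low e' b < wt c"

lemma rotate4_cases:
  fixes A B C D :: 'a
  assumes "[z, u, y, v] = rotate n [A, B, C, D]"
  shows "z = A \<and> u = B \<and> y = C \<and> v = D \<or> z = B \<and> u = C \<and> y = D \<and> v = A \<or>
         z = C \<and> u = D \<and> y = A \<and> v = B \<or> z = D \<and> u = A \<and> y = B \<and> v = C"
proof -
  have r: "[z, u, y, v] = rotate (n mod 4) [A, B, C, D]"
    using assms by (subst (asm) rotate_conv_mod) simp
  have "n mod 4 = 0 \<or> n mod 4 = Suc 0 \<or> n mod 4 = Suc (Suc 0) \<or> n mod 4 = Suc (Suc (Suc 0))" by presburger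
  then show ?thesis using r by (elim disjE) simp_all
qed

lemma corner_rhombus:
  assumes "corner w e a e' b c"
  shows "rhombus (proj_int w) (proj_int w + e *\<^sub>R pe a) (proj_int w + e *\<^sub>R pe a + e' *\<^sub>R pe b) (proj_int w + e' *\<^sub>R pe b)"
proof -
  define w0 where "w0 = w - (if e < 0 then axis a 1 else 0) - (if e' < 0 then axis b 1 else 0)"
  have h: "hgt w0 = hgt w - low e a - low e' b"
    by (simp add: w0_def hgt_diff hgt_axis low_def)
  have t: "(w0, c) \<in> rauzy_tiling"
    using assms h by (simp add: corner_def rauzy_tiling_iff)
  have p: "proj_int w = proj_int w0 + (if e < 0 then pe a else 0) + (if e' < 0 then pe b else 0)"
    by (simp add: w0_def proj_int_diff proj_int_axis)
  have abc: "{a, b, c} = {1, 2, 3}" "{b, a, c} = {1, 2, 3}"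
    using assms triple_rotate(1) by (auto simp: corner_def triple_set)
  have R: "rhombus z u y v" if "[z, u, y, v] = rotate n [proj_int w0, proj_int w0 + pe i, proj_int w0 + pe i + pe j, proj_int w0 + pe j]"
    "{i, j, c} = {1, 2, 3}" for z u y v n i j
    using that t unfolding rhombus_def by blast
  have "e = 1 \<and> e' = 1 \<or> e = 1 \<and> e' = -1 \<or> e = -1 \<and> e' = -1 \<or> e = -1 \<and> e' = 1"
    using assms by (auto simp: corner_def sgn1_def)
  then show ?thesis
  proof (elim disjE)
    assume "e = 1 \<and> e' = 1"
    then show ?thesis by (intro R[of _ _ _ _ 0 a b]) (use p abc in auto)
  next
    assume "e = 1 \<and> e' = -1"
    then show ?thesis by (intro R[of _ _ _ _ "Suc 0" b a]) (use p abc in \<open>auto simp: algebra_simps\<close>)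
  next
    assume "e = -1 \<and> e' = -1"
    then show ?thesis by (intro R[of _ _ _ _ "Suc (Suc 0)" a b]) (use p abc in \<open>auto simp: algebra_simps\<close>)
  next
    assume "e = -1 \<and> e' = 1"
    then show ?thesis by (intro R[of _ _ _ _ "Suc (Suc (Suc 0))" b a]) (use p abc in \<open>auto simp: algebra_simps\<close>)
  qed
qed

lemma rhombus_corner:
  assumes "rhombus z u y v"
  shows "\<exists>w e a e' b c. corner w e a e' b c \<and> z = proj_int w \<and> u = z + e *\<^sub>R pe a \<and> y = z + e *\<^sub>R pe a + e' *\<^sub>R pe b
    \<and> v = z + e' *\<^sub>R pe b"
proof -
  obtain w0 k i j n where t: "(w0, k) \<in> rauzy_tiling" "{i, j, k} = {1, 2, 3}"
    "[z, u, y, v] = rotate n [proj_int w0, proj_int w0 + pe i, proj_int w0 + pe i + pe j, proj_int w0 + pe j]"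
    using assms unfolding rhombus_def by blast
  have tr: "triple i j k" "triple j i k" using t(2) triple_rotate(1) by (auto simp: triple_set)
  have h: "0 \<le> hgt w0" "hgt w0 < wt k" using t(1) by (auto simp: rauzy_tiling_iff)
  show ?thesis
    using rotate4_cases[OF t(3)]
  proof (elim disjE)
    assume "z = proj_int w0 \<and> u = proj_int w0 + pe i \<and> y = proj_int w0 + pe i + pe j \<and> v = proj_int w0 + pe j"
    then show ?thesis
      by (intro exI[of _ w0] exI[of _ 1] exI[of _ i] exI[of _ j] exI[of _ k]) (use h tr in \<open>auto simp: corner_def sgn1_def low_def\<close>)
  next
    assume "z = proj_int w0 + pe i \<and> u = proj_int w0 + pe i + pe j \<and> y = proj_int w0 + pe j \<and> v = proj_int w0"
    then show ?thesis
      by (intro exI[of _ "w0 + axis i 1"] exI[of _ 1] exI[of _ j] exI[of _ "-1"] exI[of _ i] exI[of _ k])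
        (use h tr in \<open>auto simp: corner_def sgn1_def low_def hgt_add hgt_axis proj_int_add proj_int_axis\<close>)
  next
    assume "z = proj_int w0 + pe i + pe j \<and> u = proj_int w0 + pe j \<and> y = proj_int w0 \<and> v = proj_int w0 + pe i"
    then show ?thesis
      by (intro exI[of _ "w0 + axis i 1 + axis j 1"] exI[of _ "-1"] exI[of _ i] exI[of _ "-1"] exI[of _ j] exI[of _ k])
        (use h tr in \<open>auto simp: corner_def sgn1_def low_def hgt_add hgt_axis proj_int_add proj_int_axis\<close>)
  next
    assume "z = proj_int w0 + pe j \<and> u = proj_int w0 \<and> y = proj_int w0 + pe i \<and> v = proj_int w0 + pe i + pe j"
    then show ?thesis
      by (intro exI[of _ "w0 + axis j 1"] exI[of _ "-1"] exI[of _ j] exI[of _ 1] exI[of _ i] exI[of _ k])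
        (use h tr in \<open>auto simp: corner_def sgn1_def low_def hgt_add hgt_axis proj_int_add proj_int_axis\<close>)
  qed
qed

lemma corner_bounds: "corner w e a e' b c \<Longrightarrow> 0 \<le> hgt w \<and> hgt w < wsum"
  using wt_pos[of a] wt_pos[of b] triple_wsum[of a b c] by (auto simp: corner_def low_def split: if_splits)

text \<open>Uniqueness of the lift turns the existence of a rhombus between two given edges into an
  inequality for one number, \<open>hgt w\<close>; all local combinatorics of the tiling is read off
  from it.\<close>

lemma rhombus_iff_corner:
  assumes "triple a b c" "sgn1 e" "sgn1 e'" "proj_int w = z" "0 \<le> hgt w" "hgt w < wsum"
  shows "(\<exists>y. rhombus z (z + e *\<^sub>R pe a) y (z + e' *\<^sub>R pe b)) \<longleftrightarrow> corner w e a e' b c"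
proof
  assume "\<exists>y. rhombus z (z + e *\<^sub>R pe a) y (z + e' *\<^sub>R pe b)"
  then obtain w' f i f' j k where c: "corner w' f i f' j k" "z = proj_int w'"
    "z + e *\<^sub>R pe a = z + f *\<^sub>R pe i" "z + e' *\<^sub>R pe b = z + f' *\<^sub>R pe j"
    using rhombus_corner by blast
  have "w' = w" using hgt_unique corner_bounds[OF c(1)] assms c(2) by metis
  moreover have "e = f" "a = i" "e' = f'" "b = j"
    using c pe_scaled_eq_iff[of e f a i] pe_scaled_eq_iff[of e' f' b j] assms(2,3)
    by (auto simp: corner_def sgn1_def)
  moreover have "c = k"
    using assms(1) c(1) \<open>a = i\<close> \<open>b = j\<close> exhaust_3[of a] exhaust_3[of b] exhaust_3[of c] exhaust_3[of k]
    by (auto simp: corner_def triple_def)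
  ultimately show "corner w e a e' b c" using c by simp
qed (use corner_rhombus assms in blast)

definition rh :: "pt \<Rightarrow> pt \<Rightarrow> pt \<Rightarrow> bool" where
  "rh z u v \<longleftrightarrow> (\<exists>y. rhombus z u y v)"

lemma rhombus_rotate: "rhombus z u y v \<Longrightarrow> rhombus u y v z"
proof -
  have *: "[z, u, y, v] = rotate n xs \<Longrightarrow> [u, y, v, z] = rotate (Suc n) xs" for n and xs :: "pt list"
    by (metis append_Cons append_Nil rotate1.simps(2) rotate_Suc)
  assume "rhombus z u y v"
  then show ?thesis unfolding rhombus_def using * by blast
qed

lemma corner_swap: "corner w e a e' b c \<Longrightarrow> corner w e' b e a c"
  by (auto simp: corner_def triple_def)

lemma rhombus_flip:
  assumes "rhombus z u y v"
  shows "rhombus z v y u"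
proof -
  obtain w e a e' b c where c: "corner w e a e' b c" and p: "z = proj_int w" "u = z + e *\<^sub>R pe a"
    "y = z + e *\<^sub>R pe a + e' *\<^sub>R pe b" "v = z + e' *\<^sub>R pe b"
    using rhombus_corner[OF assms] by blast
  have "y = proj_int w + e' *\<^sub>R pe b + e *\<^sub>R pe a" using p by simp
  then show ?thesis using corner_rhombus[OF corner_swap[OF c]] p by (simp add: algebra_simps)
qed

lemma rhombus_reverse: "rhombus z u y v \<Longrightarrow> rhombus u z v y"
  by (blast intro: rhombus_rotate rhombus_flip)

lemma rh_commute: "rh z u v \<longleftrightarrow> rh z v u"
  unfolding rh_def using rhombus_flip by blast

lemma tedge_commute: "tedge z u \<Longrightarrow> tedge u z"
  unfolding tedge_def using rhombus_reverse by blast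

lemma tedge_tvertex: "tedge z u \<Longrightarrow> tvertex z" "tedge z u \<Longrightarrow> tvertex u"
  unfolding tedge_def tvertex_def using rhombus_rotate by blast+

lemma rhombus_tedge: "rhombus z u y v \<Longrightarrow> tedge z u" "rhombus z u y v \<Longrightarrow> tedge u y"
  "rhombus z u y v \<Longrightarrow> tedge y v" "rhombus z u y v \<Longrightarrow> tedge v z"
  "rhombus z u y v \<Longrightarrow> tedge u z" "rhombus z u y v \<Longrightarrow> tedge y u"
  "rhombus z u y v \<Longrightarrow> tedge v y" "rhombus z u y v \<Longrightarrow> tedge z v"
  unfolding tedge_def using rhombus_rotate rhombus_reverse by blast+

lemma rhombus_dirs:
  assumes "rhombus z u y v"
  obtains e a e' b where "sgn1 e" "sgn1 e'" "a \<noteq> b" "u = z + e *\<^sub>R pe a" "v = z + e' *\<^sub>R pe b"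
    "y = z + e *\<^sub>R pe a + e' *\<^sub>R pe b"
  using rhombus_corner[OF assms] by (auto simp: corner_def triple_def)

lemma tedge_dir:
  assumes "tedge z u"
  obtains e a where "sgn1 e" "u = z + e *\<^sub>R pe a"
  using assms rhombus_dirs unfolding tedge_def by metis

lemma sgn1_cases: "sgn1 e \<Longrightarrow> e \<in> {1, -1}"
  by (auto simp: sgn1_def)

lemma dir_eq_iff: "sgn1 e \<Longrightarrow> sgn1 e' \<Longrightarrow> e *\<^sub>R pe a = e' *\<^sub>R pe b \<longleftrightarrow> e = e' \<and> a = b"
  by (rule pe_scaled_eq_iff[OF sgn1_cases sgn1_cases])

lemma dir_nonzero: "sgn1 e \<Longrightarrow> e *\<^sub>R pe a \<noteq> 0"
  using dir_eq_iff[of e "-e" a a] by (auto simp: sgn1_def)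

lemma rhombus_opposite: "rhombus z u y v \<Longrightarrow> y = u + v - z"
  by (erule rhombus_dirs) simp

lemma rhombus_distinct:
  assumes "rhombus z u y v"
  shows "z \<noteq> u" "z \<noteq> v" "z \<noteq> y" "u \<noteq> v" "u \<noteq> y" "v \<noteq> y"
proof -
  obtain e a e' b where d: "sgn1 e" "sgn1 e'" "a \<noteq> b" "u = z + e *\<^sub>R pe a" "v = z + e' *\<^sub>R pe b"
    "y = z + e *\<^sub>R pe a + e' *\<^sub>R pe b"
    using assms by (rule rhombus_dirs)
  have "e *\<^sub>R pe a \<noteq> e' *\<^sub>R pe b" "e *\<^sub>R pe a \<noteq> (- e') *\<^sub>R pe b"
    using d dir_eq_iff[of e e' a b] dir_eq_iff[of e "- e'" a b] by (auto simp: sgn1_def)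
  then show "z \<noteq> u" "z \<noteq> v" "z \<noteq> y" "u \<noteq> v" "u \<noteq> y" "v \<noteq> y"
    using d dir_nonzero by (auto simp: add_eq_0_iff add.assoc)
qed

lemma tedge_neq: "tedge z u \<Longrightarrow> z \<noteq> u"
  unfolding tedge_def using rhombus_distinct by blast

text \<open>In any rhombus that exhibits the edge, the lower end of the edge is the base of the tile
  or lies one step along the other side above it. Its height therefore ranges over the sum of the
  two weights that do not belong to the edge.\<close>

lemma tedge_corner:
  assumes "tedge x (x + e *\<^sub>R pe b)" "sgn1 e" "triple a b c"
  obtains w where "x = proj_int w" "0 \<le> hgt w" "hgt w < wsum" "0 \<le> hgt w - low e b" "hgt w - low e b < wt a + wt c"
proof -
  obtain y v where "rhombus x (x + e *\<^sub>R pe b) y v" using assms(1) unfolding tedge_def by blast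
  then obtain w f i f' j k where w: "corner w f i f' j k" "x = proj_int w" "x + e *\<^sub>R pe b = x + f *\<^sub>R pe i"
    using rhombus_corner by blast
  have "e = f" "b = i" using w dir_eq_iff[of e f b i] assms(2) by (auto simp: corner_def)
  have "wt b + wt j + wt k = wsum" "wt a + wt b + wt c = wsum"
    using triple_wsum[of i j k] triple_wsum[OF assms(3)] w(1) \<open>b = i\<close> by (auto simp: corner_def)
  then have "wt j + wt k = wt a + wt c" by simp
  then show thesis
    using that[OF w(2)] corner_bounds[OF w(1)] w(1) wt_pos[of j] wt_pos[of k] \<open>e = f\<close> \<open>b = i\<close>
    by (auto simp: corner_def low_def split: if_splits)
qed

text \<open>Let h be the height of the lower end of the edge, so 0 \<le> h <
  \<open>wt a + wt c\<close>. In order of occurrence the four rhombi exist iff h <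
  \<open>wt c\<close>, \<open>wt a\<close> \<le> h, h < \<open>wt a\<close>, \<open>wt c\<close>
  \<le> h. Both differences count how many of h < \<open>wt a\<close>, h < \<open>wt c\<close> hold,
  minus one. This is the arithmetic form of having one rhombus on each side of an edge.\<close>

lemma rhombus_sides:
  assumes "tedge x (x + e *\<^sub>R pe b)" "sgn1 e" "a \<noteq> b" "c \<noteq> b"
  shows "of_bool (rh x (x + pe a) (x + e *\<^sub>R pe b)) - of_bool (rh x (x - pe a) (x + e *\<^sub>R pe b)) =
    (of_bool (rh x (x + pe c) (x + e *\<^sub>R pe b)) - of_bool (rh x (x - pe c) (x + e *\<^sub>R pe b)) :: int)"
proof (cases "a = c")
  case False
  with assms have t: "triple a b c" "triple c b a" by (auto simp: triple_def)
  obtain w where w: "x = proj_int w" "0 \<le> hgt w" "hgt w < wsum" "0 \<le> hgt w - low e b" "hgt w - low e b < wt a + wt c"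
    using tedge_corner[OF assms(1,2) t(1)] .
  have s: "sgn1 1" "sgn1 (- 1)" by (auto simp: sgn1_def)
  have 1: "rh x (x + f *\<^sub>R pe a) (x + e *\<^sub>R pe b) \<longleftrightarrow> corner w f a e b c" if "sgn1 f" for f
    unfolding rh_def by (rule rhombus_iff_corner) (use that w assms t in auto)
  have 2: "rh x (x + f *\<^sub>R pe c) (x + e *\<^sub>R pe b) \<longleftrightarrow> corner w f c e b a" if "sgn1 f" for f
    unfolding rh_def by (rule rhombus_iff_corner) (use that w assms t in auto)
  show ?thesis
    using 1[OF s(1)] 1[OF s(2)] 2[OF s(1)] 2[OF s(2)] w t s assms(2) wt_pos[of a] wt_pos[of c]
    by (auto simp: corner_def low_def of_bool_def)
qed simp

text \<open>Edges have only six possible directions, so a vertex with six neighbours uses all of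
  them.\<close>

lemma n_vertex_6:
  assumes "n_vertex 6 z" "sgn1 e"
  shows "tedge z (z + e *\<^sub>R pe a)"
proof -
  let ?N = "(\<lambda>(e, a). z + e *\<^sub>R pe a) ` ({1, -1} \<times> UNIV)"
  have "neighbours z \<subseteq> ?N"
    by (force simp: neighbours_def sgn1_def elim!: tedge_dir)
  moreover have "card ?N \<le> 6"
    by (rule order.trans[OF card_image_le]) (auto simp: card_cartesian_product)
  ultimately have "neighbours z = ?N"
    using assms(1) by (intro card_seteq) (auto simp: n_vertex_def)
  then show ?thesis using assms(2) by (force simp: neighbours_def sgn1_def)
qed

text \<open>The six edges force \<open>hgt w\<close> to be at least each weight and below the sum of
  any two of them. Equal signs then violate one of the bounds of a corner, and opposite signs
  satisfy both.\<close>

lemma n_vertex_6_rh: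
  assumes "n_vertex 6 z" "sgn1 e" "sgn1 e'" "a \<noteq> b"
  shows "rh z (z + e *\<^sub>R pe a) (z + e' *\<^sub>R pe b) \<longleftrightarrow> e' = - e"
proof -
  obtain c where t: "triple a b c" using triple_ex[OF assms(4)] by blast
  have s: "sgn1 1" "sgn1 (- 1)" by (auto simp: sgn1_def)
  obtain w where w: "z = proj_int w" "0 \<le> hgt w" "hgt w < wsum"
    using tedge_corner[OF n_vertex_6[OF assms(1,2)] assms(2), of b a c] t by (auto simp: triple_def)
  have g: "0 \<le> hgt w - low f j \<and> hgt w - low f j < wt i + wt k" if f: "sgn1 f" "triple i j k" for f i j k
  proof -
    obtain w' where "z = proj_int w'" "0 \<le> hgt w'" "hgt w' < wsum" "0 \<le> hgt w' - low f j" "hgt w' - low f j < wt i + wt k"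
      using tedge_corner[OF n_vertex_6[OF assms(1) f(1)] f] .
    then show ?thesis using hgt_unique[of w w'] w by simp
  qed
  have r: "rh z (z + e *\<^sub>R pe a) (z + e' *\<^sub>R pe b) \<longleftrightarrow> corner w e a e' b c"
    unfolding rh_def by (rule rhombus_iff_corner) (use w assms t in auto)
  show ?thesis
    unfolding r
    using g[OF s(1), of a b c] g[OF s(1), of b a c] g[OF s(1), of a c b] g[OF s(2), of a b c] g[OF s(2), of b a c] g[OF s(2), of a c b]
      assms(2,3) t
    by (auto simp: corner_def low_def sgn1_def triple_def)
qed

section \<open>The neighbourhood of a 6-vertex\<close>

text \<open>Chosen together with \<open>dsign\<close> so that \<open>dir n\<close> is the unit
  vector at angle 30 + 60 n degrees. Integer indices modulo 6 make cyclic shifts painless.\<close>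

definition axis_of :: "int \<Rightarrow> 3" where
  "axis_of n = (if n mod 3 = 0 then 1 else if n mod 3 = 1 then 3 else 2)"

definition dsign :: "int \<Rightarrow> real" where
  "dsign n = (if even n then - 1 else 1)"

definition dir :: "int \<Rightarrow> pt" where
  "dir n = dsign n *\<^sub>R pe (axis_of n)"

lemma sgn1_dsign: "sgn1 (dsign n)"
  by (simp add: dsign_def sgn1_def)

lemma dir_plus_3: "dir (n + 3) = - dir n"
  by (simp add: dir_def dsign_def axis_of_def)

text \<open>Both sides change sign under \<open>n + 3\<close>, so it is enough to compare
  \<open>n = 0, 1, 2\<close>.\<close>

lemma dir_polar: "dir n = vector [cos (pi / 6 + of_int n * (pi / 3)), sin (pi / 6 + of_int n * (pi / 3))]" (is "_ = ?p n")
proof -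
  have p: "?p (n + 3) = - ?p n" for n
  proof -
    have "pi / 6 + of_int (n + 3) * (pi / 3) = pi / 6 + of_int n * (pi / 3) + pi" by (simp add: algebra_simps)
    then show ?thesis by (simp only: cos_periodic_pi sin_periodic_pi) (simp add: vec_eq_iff forall_2)
  qed
  have a: "pi / 6 + pi / 3 = pi / 2" "pi / 6 + 2 * (pi / 3) = pi - pi / 6" by simp_all
  have 0: "dir 0 = ?p 0"
    by (simp add: dir_def dsign_def axis_of_def pe_simps vec_eq_iff forall_2 cos_30 sin_30)
  have 1: "dir 1 = ?p 1"
    by (simp add: a dir_def dsign_def axis_of_def pe_simps vec_eq_iff forall_2)
  have 2: "dir 2 = ?p 2"
    unfolding of_int_numeral a(2) cos_pi_minus sin_pi_minus
    by (simp add: dir_def dsign_def axis_of_def pe_simps vec_eq_iff forall_2 cos_30 sin_30)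
  have r: "dir r = ?p r" if "r \<in> {0, 1, 2}" for r using that 0 1 2 by blast
  have "dir (r + 3 * q) = ?p (r + 3 * q)" if "r \<in> {0, 1, 2}" for q r
  proof (induction q rule: int_induct[where k = 0])
    case base
    show ?case using r[OF that] by simp
  next
    case (step1 q)
    show ?case using step1(2) dir_plus_3[of "r + 3 * q"] p[of "r + 3 * q"] by (simp add: algebra_simps)
  next
    case (step2 q)
    show ?case using step2(2) dir_plus_3[of "r + 3 * (q - 1)"] p[of "r + 3 * (q - 1)"] by (simp add: algebra_simps)
  qed
  moreover have "n mod 3 \<in> {0, 1, 2}" by (simp; presburger)
  moreover have "n mod 3 + 3 * (n div 3) = n" by simp
  ultimately show ?thesis by metis
qed

lemma dir_sum: "dir (n + 1) + dir (n - 1) = dir n"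
proof -
  define t where "t = pi / 6 + of_int n * (pi / 3)"
  have e: "pi / 6 + of_int (n + 1) * (pi / 3) = t + pi / 3" "pi / 6 + of_int (n - 1) * (pi / 3) = t - pi / 3"
    by (simp_all add: t_def algebra_simps add_divide_distrib diff_divide_distrib)
  show ?thesis
    unfolding dir_polar e t_def[symmetric]
    by (simp add: vec_eq_iff forall_2 cos_add cos_diff sin_add sin_diff cos_60 sin_60)
qed

lemma axis_of_eq_iff: "axis_of m = axis_of n \<longleftrightarrow> m mod 3 = n mod 3"
  unfolding axis_of_def by (auto split: if_splits; presburger)

lemma dsign_eq_iff: "dsign m = dsign n \<longleftrightarrow> even m = even n" "dsign m = - dsign n \<longleftrightarrow> even m \<noteq> even n"
  unfolding dsign_def by auto

lemma mod_6_iff: "m mod 6 = n mod 6 \<longleftrightarrow> even m = even n \<and> m mod 3 = n mod (3::int)"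
proof -
  have "6 dvd d \<longleftrightarrow> even d \<and> 3 dvd d" for d :: int by presburger
  from this[of "m - n"] show ?thesis by (simp add: mod_eq_dvd_iff)
qed

lemma dir_inj_iff: "dir m = dir n \<longleftrightarrow> m mod 6 = n mod 6"
  unfolding dir_def dir_eq_iff[OF sgn1_dsign sgn1_dsign] axis_of_eq_iff dsign_eq_iff mod_6_iff by blast

lemma dir_surj: "sgn1 e \<Longrightarrow> \<exists>n. e *\<^sub>R pe a = dir n"
proof -
  assume "sgn1 e"
  then consider "e = 1" | "e = - 1" by (auto simp: sgn1_def)
  moreover have "\<exists>n. pe a = dir n"
    using exhaust_3[of a]
  proof (elim disjE)
    assume "a = 1" then show ?thesis by (intro exI[of _ 3]) (simp add: dir_def dsign_def axis_of_def)
  next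
    assume "a = 2" then show ?thesis by (intro exI[of _ 5]) (simp add: dir_def dsign_def axis_of_def)
  next
    assume "a = 3" then show ?thesis by (intro exI[of _ 1]) (simp add: dir_def dsign_def axis_of_def)
  qed
  then obtain n where "pe a = dir n" by blast
  ultimately show ?thesis using dir_plus_3[of n] by cases (auto intro: exI[of _ n] exI[of _ "n + 3"])
qed

lemma neighbours_dir:
  assumes "n_vertex 6 z"
  shows "tedge z u \<longleftrightarrow> (\<exists>n. u = z + dir n)"
proof
  assume "tedge z u"
  then show "\<exists>n. u = z + dir n" by (metis tedge_dir dir_surj)
qed (use n_vertex_6[OF assms sgn1_dsign] in \<open>auto simp: dir_def\<close>)

lemma mod_3_distinct:
  fixes m n :: int
  shows "m mod 3 \<noteq> n mod 3 \<longleftrightarrow> n mod 3 = (m + 1) mod 3 \<or> m mod 3 = (n + 1) mod 3"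
proof -
  have s: "(m + 1) mod 3 = (m mod 3 + 1) mod 3" "(n + 1) mod 3 = (n mod 3 + 1) mod 3"
    by (simp_all add: mod_add_left_eq)
  have g: "a \<noteq> b \<longleftrightarrow> b = (a + 1) mod 3 \<or> a = (b + 1) mod 3" if "a = 0 \<or> a = 1 \<or> a = 2" "b = 0 \<or> b = 1 \<or> b = 2" for a b :: int
    using that by (elim disjE; simp)
  have "k mod 3 = 0 \<or> k mod 3 = 1 \<or> k mod 3 = 2" for k :: int
    using pos_mod_bound[of 3 k] pos_mod_sign[of 3 k] by linarith
  from g[OF this this] show ?thesis unfolding s .
qed

text \<open>A rhombus requires different axes (indices distinct modulo 3) and opposite signs
  (indices of different parity), and together these say that the indices differ by one modulo
  6.\<close>

lemma rh_dir:
  assumes "n_vertex 6 z"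
  shows "rh z (z + dir m) (z + dir n) \<longleftrightarrow> n mod 6 = (m + 1) mod 6 \<or> m mod 6 = (n + 1) mod 6"
proof (cases "axis_of m = axis_of n")
  case True
  have "\<not> rh z (z + dir m) (z + dir n)"
  proof
    assume "rh z (z + dir m) (z + dir n)"
    then obtain y where "rhombus z (z + dir m) y (z + dir n)" unfolding rh_def by blast
    then obtain e a e' b where d: "sgn1 e" "sgn1 e'" "a \<noteq> b" "z + dir m = z + e *\<^sub>R pe a" "z + dir n = z + e' *\<^sub>R pe b"
      by (rule rhombus_dirs)
    show False using True d dir_eq_iff[OF sgn1_dsign d(1), of m "axis_of m" a] dir_eq_iff[OF sgn1_dsign d(2), of n "axis_of n" b]
      by (simp add: dir_def)
  qed
  moreover have "n mod 3 \<noteq> (m + 1) mod 3" "m mod 3 \<noteq> (n + 1) mod 3"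
    using True mod_3_distinct[of m n] unfolding axis_of_eq_iff by blast+
  then have "\<not> (n mod 6 = (m + 1) mod 6 \<or> m mod 6 = (n + 1) mod 6)"
    unfolding mod_6_iff by blast
  ultimately show ?thesis by blast
next
  case False
  have "rh z (z + dir m) (z + dir n) \<longleftrightarrow> dsign n = - dsign m"
    unfolding dir_def by (rule n_vertex_6_rh[OF assms sgn1_dsign sgn1_dsign False])
  moreover have "n mod 3 = (m + 1) mod 3 \<or> m mod 3 = (n + 1) mod 3"
    using False mod_3_distinct[of m n] unfolding axis_of_eq_iff by blast
  moreover have "even n = even (m + 1) \<longleftrightarrow> even n \<noteq> even m" "even m = even (n + 1) \<longleftrightarrow> even n \<noteq> even m" by auto
  ultimately show ?thesis unfolding dsign_eq_iff mod_6_iff by blast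
qed

lemma int_strict_run:
  fixes N :: "nat \<Rightarrow> int"
  assumes "strict_mono_on {1..6} N" "N 6 < N 1 + 6" "j \<in> {1..6}"
  shows "N j = N 1 + int j - 1"
proof -
  have l: "N i < N (i + 1)" if "i \<in> {1..5}" for i
    using that assms(1) by (auto simp: strict_mono_on_def)
  have "N 1 < N 2" "N 2 < N 3" "N 3 < N 4" "N 4 < N 5" "N 5 < N 6"
    using l[of 1] l[of 2] l[of 3] l[of 4] l[of 5] by (simp_all add: numeral_eq_Suc)
  moreover have "j = 1 \<or> j = 2 \<or> j = 3 \<or> j = 4 \<or> j = 5 \<or> j = 6" using assms(3) by auto
  ultimately show ?thesis using assms(2) by auto
qed

text \<open>Each polar angle is pi/6 + N pi/3, with full turns absorbed into the integer N. The
  integers then inherit the strict order of the angles, and six of them within less than one turn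
  must be consecutive.\<close>

lemma ccw_labelling_6:
  assumes "n_vertex 6 z" "ccw_labelling z 6 x"
  obtains c where "\<And>j. j \<in> {1..6} \<Longrightarrow> x j = z + dir (c + int j)"
proof -
  obtain \<theta> r :: "nat \<Rightarrow> real" where b: "bij_betw x {1..6} (neighbours z)"
    and r: "\<And>j. j \<in> {1..6} \<Longrightarrow> r j > 0 \<and> x j = z + r j *\<^sub>R vector [cos (\<theta> j), sin (\<theta> j)]"
    and m: "strict_mono_on {1..6} \<theta>" "\<theta> 6 < \<theta> 1 + 2 * pi"
    using assms(2) unfolding ccw_labelling_def by blast
  have "\<exists>N. \<theta> j = pi / 6 + of_int N * (pi / 3) \<and> x j = z + dir N" if j: "j \<in> {1..6}" for j
  proof -
    have "x j \<in> neighbours z" using b j by (auto simp: bij_betw_def)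
    then obtain n where n: "x j = z + dir n" using neighbours_dir[OF assms(1)] by (auto simp: neighbours_def)
    define t where "t = pi / 6 + of_int n * (pi / 3)"
    have e: "r j * cos (\<theta> j) = cos t" "r j * sin (\<theta> j) = sin t"
      using n r[OF j] by (auto simp: dir_polar t_def vec_eq_iff forall_2)
    have "(r j)\<^sup>2 = (r j * cos (\<theta> j))\<^sup>2 + (r j * sin (\<theta> j))\<^sup>2"
      by (simp add: power_mult_distrib flip: distrib_left)
    also have "\<dots> = 1" by (simp add: e)
    finally have "r j = 1" using r[OF j] by (simp add: power2_eq_1_iff)
    then have "sin (\<theta> j) = sin t \<and> cos (\<theta> j) = cos t" using e by simp
    then obtain q :: int where q: "\<theta> j = t + 2 * of_int q * pi"
      using sin_cos_eq_iff[of "\<theta> j" t] by (auto simp: algebra_simps)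
    have "dir (n + 6 * q) = dir n" by (simp add: dir_inj_iff)
    then show ?thesis
      using n q by (intro exI[of _ "n + 6 * q"]) (simp add: t_def algebra_simps)
  qed
  then obtain N where N: "\<And>j. j \<in> {1..6} \<Longrightarrow> \<theta> j = pi / 6 + of_int (N j) * (pi / 3)" "\<And>j. j \<in> {1..6} \<Longrightarrow> x j = z + dir (N j)"
    by metis
  have "strict_mono_on {1..6} N"
  proof (rule strict_mono_onI)
    fix i j :: nat assume ij: "i \<in> {1..6}" "j \<in> {1..6}" "i < j"
    then have "\<theta> i < \<theta> j" using m(1) by (auto simp: strict_mono_on_def)
    then show "N i < N j" using N(1)[OF ij(1)] N(1)[OF ij(2)] by simp
  qed
  moreover have "N 6 < N 1 + 6"
  proof -
    have "of_int (N 6) * (pi / 3) < (of_int (N 1) + 6) * (pi / 3)"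
      using m(2) N(1)[of 6] N(1)[of 1] by (simp add: algebra_simps)
    then have "real_of_int (N 6) < of_int (N 1) + 6" using mult_less_cancel_right_pos[of "pi / 3"] by simp
    then show ?thesis by linarith
  qed
  ultimately have r: "N j = N 1 + int j - 1" if "j \<in> {1..6}" for j using that by (rule int_strict_run)
  show thesis
  proof (rule that[of "N 1 - 1"])
    fix j :: nat assume j: "j \<in> {1..6}"
    show "x j = z + dir (N 1 - 1 + int j)"
      using N(2)[OF j, unfolded r[OF j]] by (simp add: algebra_simps)
  qed
qed

section \<open>A trace on closed paths of length four\<close>

definition axis_at :: "pt \<Rightarrow> pt \<Rightarrow> 3" where
  "axis_at x u = (THE a. \<exists>e. sgn1 e \<and> u = x + e *\<^sub>R pe a)"

definition orient :: "pt \<Rightarrow> pt \<Rightarrow> int" where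
  "orient x u = (if u = x + pe (axis_at x u) then 1 else - 1)"

definition edge_sign :: "(3 \<Rightarrow> pt \<Rightarrow> int) \<Rightarrow> pt \<Rightarrow> pt \<Rightarrow> int" where
  "edge_sign s x u = s (axis_at x u) x"

text \<open>A signed comparison of the two sides of the edge from \<open>x\<close> to
  \<open>u\<close>. By \<open>rhombus_sides\<close> both axes other than that of the edge give the
  same value.\<close>

definition side_diff :: "pt \<Rightarrow> 3 \<Rightarrow> pt \<Rightarrow> int" where
  "side_diff x a u = of_bool (rh x (x + pe a) u) - of_bool (rh x (x - pe a) u)"

text \<open>The value of the trace on the path \<open>x, u, x, v, x\<close>. For \<open>u = v\<close> it is forced by the third
  relation; the axis following that of the edge stands for either of the two other axes.\<close>

definition pairing :: "(3 \<Rightarrow> pt \<Rightarrow> int) \<Rightarrow> pt \<Rightarrow> pt \<Rightarrow> pt \<Rightarrow> int" where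
  "pairing s x u v =
     (if u = v then - orient x u * side_diff x (axis_at x u + 1) u
      else if rh x u v then - edge_sign s x u * edge_sign s x v else 0)"

text \<open>The closed path is \<open>x, u, y, v, x\<close>. If \<open>u = v\<close> but
  \<open>y\<close> differs from \<open>x\<close>, it is the rotation of a back-and-forth path based
  at \<open>u\<close>, with the sign that a rotation costs; the last case is a trip around a
  rhombus.\<close>

definition trace4 :: "(3 \<Rightarrow> pt \<Rightarrow> int) \<Rightarrow> pt \<Rightarrow> pt \<Rightarrow> pt \<Rightarrow> pt \<Rightarrow> int" where
  "trace4 s x u y v =
     (if y = x then pairing s x u v
      else if u = v then - pairing s u x y
      else if rhombus x u y v then - edge_sign s x u * edge_sign s x v else 0)"

lemma axis_at_dir: "sgn1 e \<Longrightarrow> axis_at x (x + e *\<^sub>R pe a) = a"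
  unfolding axis_at_def by (rule the_equality) (auto simp: dir_eq_iff)

lemma orient_dir: "sgn1 e \<Longrightarrow> real_of_int (orient x (x + e *\<^sub>R pe a)) = e"
  using dir_eq_iff[of e 1 a a] by (auto simp: orient_def axis_at_dir sgn1_def)

lemma edge_sign_dir: "sgn1 e \<Longrightarrow> edge_sign s x (x + e *\<^sub>R pe a) = s a x"
  by (simp add: edge_sign_def axis_at_dir)

lemma sign_choice_edge:
  assumes "sign_choice s" "tedge x (x + e *\<^sub>R pe a)"
  shows "s a (x + e *\<^sub>R pe a) = - s a x" "c \<noteq> a \<Longrightarrow> s c (x + e *\<^sub>R pe a) = s c x"
proof -
  have "\<exists>t. (x + e *\<^sub>R pe a) - x = t *\<^sub>R pe a" by auto
  then show "s a (x + e *\<^sub>R pe a) = - s a x" "c \<noteq> a \<Longrightarrow> s c (x + e *\<^sub>R pe a) = s c x"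
    using assms unfolding sign_choice_def by blast+
qed

lemma sign_choice_square:
  assumes "sign_choice s" "tvertex x"
  shows "s a x * s a x = 1"
proof -
  have "s a x \<in> {1, - 1}" using assms unfolding sign_choice_def by blast
  then show ?thesis by auto
qed

lemma tedge_reverse_dir:
  assumes "tedge x u"
  obtains e a where "sgn1 e" "sgn1 (- e)" "u = x + e *\<^sub>R pe a" "x = u + (- e) *\<^sub>R pe a"
proof -
  obtain e a where d: "sgn1 e" "u = x + e *\<^sub>R pe a" using tedge_dir[OF assms] .
  have "sgn1 (- e)" "x = u + (- e) *\<^sub>R pe a" using d by (auto simp: sgn1_def)
  then show thesis using that d by blast
qed

lemma edge_sign_reverse:
  assumes "sign_choice s" "tedge x u"
  shows "edge_sign s u x = - edge_sign s x u"
proof -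
  obtain e a where d: "sgn1 e" "sgn1 (- e)" "u = x + e *\<^sub>R pe a" "x = u + (- e) *\<^sub>R pe a"
    using tedge_reverse_dir[OF assms(2)] .
  have "edge_sign s u x = s a u" using edge_sign_dir[OF d(2), of s u a] unfolding d(4)[symmetric] .
  also have "\<dots> = - s a x" using sign_choice_edge(1)[OF assms(1), of x e a] assms(2) unfolding d(3)[symmetric] by blast
  also have "s a x = edge_sign s x u" using edge_sign_dir[OF d(1), of s x a] unfolding d(3)[symmetric] by (rule sym)
  finally show ?thesis .
qed

lemma edge_sign_parallel:
  assumes "sign_choice s" "rhombus x u y v"
  shows "edge_sign s u y = edge_sign s x v"
proof -
  obtain e a e' b where d: "sgn1 e" "sgn1 e'" "a \<noteq> b" "u = x + e *\<^sub>R pe a" "v = x + e' *\<^sub>R pe b"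
    "y = x + e *\<^sub>R pe a + e' *\<^sub>R pe b" using rhombus_dirs[OF assms(2)] .
  have "edge_sign s u y = s b u" using edge_sign_dir[OF d(2), of s u b] d(4,6) by simp
  also have "\<dots> = s b x"
    using sign_choice_edge(2)[OF assms(1), of x e a b] rhombus_tedge(1)[OF assms(2)] d(3,4) by simp
  also have "\<dots> = edge_sign s x v" using edge_sign_dir[OF d(2), of s x b] d(5) by simp
  finally show ?thesis .
qed

lemma edge_sign_square: "sign_choice s \<Longrightarrow> tedge x u \<Longrightarrow> edge_sign s x u * edge_sign s x u = 1"
  unfolding edge_sign_def using sign_choice_square tedge_tvertex(1) by blast

lemma pairing_commute: "pairing s x u v = pairing s x v u"
  by (auto simp: pairing_def rh_commute)

lemma rhombus_rh: "rhombus x u y v \<Longrightarrow> rh x u v" "rhombus x u y v \<Longrightarrow> rh u x y" "rhombus x u y v \<Longrightarrow> rh u y x"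
  "rhombus x u y v \<Longrightarrow> rh v x y" "rhombus x u y v \<Longrightarrow> rh v y x" "rhombus x u y v \<Longrightarrow> rh y u v"
  unfolding rh_def using rhombus_rotate rhombus_reverse by blast+

lemma rh_translate:
  assumes "sgn1 e" "a \<noteq> b" "sgn1 f" "u = x + e *\<^sub>R pe a"
  shows "rh x (x + f *\<^sub>R pe b) u \<longleftrightarrow> rh u (u + f *\<^sub>R pe b) x"
proof
  assume "rh x (x + f *\<^sub>R pe b) u"
  then obtain y where r: "rhombus x (x + f *\<^sub>R pe b) y u" unfolding rh_def by blast
  have "y = u + f *\<^sub>R pe b" using rhombus_opposite[OF r] by simp
  then show "rh u (u + f *\<^sub>R pe b) x" using r rhombus_rh(5) by blast
next
  assume "rh u (u + f *\<^sub>R pe b) x"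
  then obtain y where r: "rhombus u (u + f *\<^sub>R pe b) y x" unfolding rh_def by blast
  have "y = x + f *\<^sub>R pe b" using rhombus_opposite[OF r] by simp
  then show "rh x (x + f *\<^sub>R pe b) u" using r rhombus_rh(5) by blast
qed

lemma three_succ [simp]: "a + 1 \<noteq> (a :: 3)" "a \<noteq> a + 1"
  by simp_all

text \<open>Reversing the edge flips its orientation, while the rhombi beside it, seen from the
  other end, point in the same transversal directions.\<close>

lemma pairing_diag_reverse:
  assumes "tedge x u"
  shows "pairing s u x x = - pairing s x u u"
proof -
  obtain e a where d: "sgn1 e" "sgn1 (- e)" "u = x + e *\<^sub>R pe a" "x = u + (- e) *\<^sub>R pe a"
    using tedge_reverse_dir[OF assms] .
  have ax: "axis_at x u = a" "axis_at u x = a"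
    using axis_at_dir[OF d(1), of x a] axis_at_dir[OF d(2), of u a] unfolding d(3)[symmetric] d(4)[symmetric] .
  have "real_of_int (orient u x) = - real_of_int (orient x u)"
    using orient_dir[OF d(1), of x a] orient_dir[OF d(2), of u a] unfolding d(3)[symmetric] d(4)[symmetric] by simp
  then have o: "orient u x = - orient x u" by linarith
  have "sgn1 1" "sgn1 (-1)" by (auto simp: sgn1_def)
  then have "side_diff u (a + 1) x = side_diff x (a + 1) u"
    using rh_translate[OF d(1) _ _ d(3), of "a + 1" 1] rh_translate[OF d(1) _ _ d(3), of "a + 1" "-1"]
    by (simp add: side_diff_def)
  then show ?thesis by (simp add: pairing_def ax o)
qed

text \<open>Around a rhombus, one of the two edge signs is reversed and the other is carried over to
  the parallel edge, whence the minus sign. In the remaining cases rotation exchanges the two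
  \<open>pairing\<close> branches of the definition; only the path along a single edge needs
  \<open>pairing_diag_reverse\<close>.\<close>

lemma trace4_rotate:
  assumes "sign_choice s" "tedge x u" "tedge u y" "tedge y v" "tedge v x"
  shows "trace4 s u y v x = - trace4 s x u y v"
proof -
  have r: "rhombus u y v x \<longleftrightarrow> rhombus x u y v" using rhombus_rotate by blast
  have *: "- edge_sign s u y * edge_sign s u x = edge_sign s x u * edge_sign s x v" if "rhombus x u y v"
    using edge_sign_reverse[OF assms(1,2)] edge_sign_parallel[OF assms(1) that] by simp
  show ?thesis
    using pairing_diag_reverse[OF assms(2), of s] pairing_commute[of s u x y] *
    by (auto simp: trace4_def r)
qed

lemma trace4_nonrhombus:
  assumes "u \<noteq> w" "\<not> (\<exists>t. rhombus u v w t)"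
  shows "trace4 s u v w t = 0"
proof -
  have "\<not> rh v u w" using assms(2) rhombus_rotate rhombus_flip unfolding rh_def by blast
  then show ?thesis using assms by (auto simp: trace4_def pairing_def)
qed

lemma rhombus_unique: "rhombus z u y v \<Longrightarrow> rhombus z u y t \<Longrightarrow> v = t"
  using rhombus_opposite[of z u y v] rhombus_opposite[of z u y t] by simp

text \<open>If \<open>t\<close> is a side corner, one of the two paths goes around the rhombus and
  the other back and forth through \<open>t\<close>; the sign chosen for a trip around a rhombus is
  the one that makes them agree. For any other \<open>t\<close> both values vanish.\<close>

lemma trace4_rhombus:
  assumes "sign_choice s" "rhombus z u y v"
  shows "trace4 s z u y t = trace4 s z v y t"
proof -
  have *: "trace4 s z u y u = trace4 s z v y u" if "rhombus z u y v" for u v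
    using rhombus_distinct[OF that] rhombus_rh[OF that] rhombus_flip[OF that] edge_sign_parallel[OF assms(1) that]
      edge_sign_reverse[OF assms(1) rhombus_tedge(1)[OF that]]
    by (simp add: trace4_def pairing_def)
  consider "t = u" | "t = v" | "t \<noteq> u" "t \<noteq> v" by blast
  then show ?thesis
  proof cases
    case 1 then show ?thesis using *[OF assms(2)] by simp
  next
    case 2 then show ?thesis using *[OF rhombus_flip[OF assms(2)]] by simp
  next
    case 3
    then have "\<not> rhombus z u y t" "\<not> rhombus z v y t"
      using rhombus_unique[OF assms(2)] rhombus_unique[OF rhombus_flip[OF assms(2)]] by blast+
    then show ?thesis using 3 rhombus_distinct[OF assms(2)] by (simp add: trace4_def)
  qed
qed

lemma rh_tedge: "rh z u v \<Longrightarrow> tedge z u" "rh z u v \<Longrightarrow> tedge z v"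
  unfolding rh_def using rhombus_tedge(1,8) by blast+

text \<open>Independence of the right-hand side from \<open>a\<close> is compatibility with the
  third relation. If \<open>a\<close> is the axis of the edge to \<open>v\<close>, only the loop
  along that edge contributes, through the diagonal of \<open>pairing\<close>; otherwise only rhombi
  contribute, and \<open>rhombus_sides\<close> equates the two axes.\<close>

lemma trace4_loops:
  assumes "sign_choice s" "tedge z v"
  shows "s a z * (of_bool (tedge z (z + pe a)) * trace4 s z (z + pe a) z v - of_bool (tedge z (z - pe a)) * trace4 s z (z - pe a) z v) =
    - edge_sign s z v * side_diff z (axis_at z v + 1) v"
proof -
  obtain e b where d: "sgn1 e" "v = z + e *\<^sub>R pe b" using tedge_dir[OF assms(2)] .
  have ax: "axis_at z v = b" using axis_at_dir[OF d(1)] d(2) by simp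
  have sq: "s a z * s a z = 1" using sign_choice_square[OF assms(1) tedge_tvertex(1)[OF assms(2)]] .
  have s1: "sgn1 1" "sgn1 (-1)" by (auto simp: sgn1_def)
  have es: "edge_sign s z v = s b z" using edge_sign_dir[OF d(1)] d(2) by simp
  have ea: "edge_sign s z (z + pe a) = s a z" "edge_sign s z (z - pe a) = s a z"
    using edge_sign_dir[OF s1(1), of s z a] edge_sign_dir[OF s1(2), of s z a] by simp_all
  show ?thesis
  proof (cases "a = b")
    case True
    have nr: "\<not> rh z (z + f *\<^sub>R pe a) v" if f: "sgn1 f" for f
    proof
      assume "rh z (z + f *\<^sub>R pe a) v"
      then obtain y where "rhombus z (z + f *\<^sub>R pe a) y v" unfolding rh_def by blast
      then obtain e' a' f' b' where "sgn1 e'" "sgn1 f'" "a' \<noteq> b'" "z + f *\<^sub>R pe a = z + e' *\<^sub>R pe a'" "v = z + f' *\<^sub>R pe b'"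
        by (rule rhombus_dirs)
      then show False using f d True dir_eq_iff[of f e' a a'] dir_eq_iff[of e f' b b'] by auto
    qed
    have n: "\<not> rh z (z + pe a) v" "\<not> rh z (z - pe a) v" using nr[OF s1(1)] nr[OF s1(2)] by simp_all
    have aa: "axis_at z (z + pe a) = a" "axis_at z (z - pe a) = a"
      using axis_at_dir[OF s1(1), of z a] axis_at_dir[OF s1(2), of z a] by simp_all
    have "v = z + pe a \<or> v = z - pe a" using d True by (auto simp: sgn1_def)
    moreover have "z + pe a \<noteq> z - pe a" using dir_eq_iff[OF s1, of a a] by auto
    ultimately show ?thesis
      using n assms(2) True
      by (elim disjE) (auto simp: trace4_def pairing_def ea[unfolded True] aa[unfolded True] orient_def)
  next
    case False
    have ne: "v \<noteq> z + pe a" "v \<noteq> z - pe a"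
      using dir_eq_iff[OF d(1) s1(1), of b a] dir_eq_iff[OF d(1) s1(2), of b a] False d(2) by auto
    have sd: "side_diff z a v = side_diff z (b + 1) v"
      unfolding side_diff_def using rhombus_sides[of z e b a "b + 1"] assms(2) d False by simp
    have p: "of_bool (tedge z (z + pe a)) * trace4 s z (z + pe a) z v = - of_bool (rh z (z + pe a) v) * (s a z * s b z)"
      "of_bool (tedge z (z - pe a)) * trace4 s z (z - pe a) z v = - of_bool (rh z (z - pe a) v) * (s a z * s b z)"
      using ne rh_tedge(1) by (auto simp: trace4_def pairing_def ea es)
    have "s a z * (- of_bool (rh z (z + pe a) v) * (s a z * s b z) - - of_bool (rh z (z - pe a) v) * (s a z * s b z))
       = (s a z * s a z) * (- s b z * side_diff z a v)"
      by (simp add: side_diff_def algebra_simps)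
    then show ?thesis unfolding p sq ax sd es by simp
  qed
qed

section \<open>Path algebras and their quotients\<close>

lemma sum_lookup_superset:
  fixes f :: "'a \<Rightarrow>\<^sub>0 'k::zero"
  assumes "finite S" "Poly_Mapping.keys f \<subseteq> S" "\<And>p. F p 0 = 0"
  shows "(\<Sum>p\<in>Poly_Mapping.keys f. F p (Poly_Mapping.lookup f p)) = (\<Sum>p\<in>S. F p (Poly_Mapping.lookup f p))"
  using assms by (intro sum.mono_neutral_left) (auto simp: in_keys_iff)

text \<open>A single support argument behind both the additivity of \<open>lin_ext\<close> and the
  distributivity of \<open>path_mult\<close>.\<close>

lemma sum_lookup_add:
  fixes f g :: "'a \<Rightarrow>\<^sub>0 'k::comm_monoid_add"
  assumes "\<And>p. F p 0 = 0" "\<And>p c d. F p (c + d) = F p c + F p d"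
  shows "(\<Sum>p\<in>Poly_Mapping.keys (f + g). F p (Poly_Mapping.lookup (f + g) p)) =
    (\<Sum>p\<in>Poly_Mapping.keys f. F p (Poly_Mapping.lookup f p)) + (\<Sum>p\<in>Poly_Mapping.keys g. F p (Poly_Mapping.lookup g p))"
proof -
  let ?S = "Poly_Mapping.keys f \<union> Poly_Mapping.keys g"
  have "(\<Sum>p\<in>Poly_Mapping.keys (f + g). F p (Poly_Mapping.lookup (f + g) p)) = (\<Sum>p\<in>?S. F p (Poly_Mapping.lookup (f + g) p))"
    by (rule sum_lookup_superset) (use assms keys_add[of f g] in auto)
  also have "\<dots> = (\<Sum>p\<in>?S. F p (Poly_Mapping.lookup f p)) + (\<Sum>p\<in>?S. F p (Poly_Mapping.lookup g p))"
    by (simp add: lookup_add assms(2) sum.distrib)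
  also have "(\<Sum>p\<in>?S. F p (Poly_Mapping.lookup f p)) = (\<Sum>p\<in>Poly_Mapping.keys f. F p (Poly_Mapping.lookup f p))"
    by (rule sum_lookup_superset[symmetric]) (use assms in auto)
  also have "(\<Sum>p\<in>?S. F p (Poly_Mapping.lookup g p)) = (\<Sum>p\<in>Poly_Mapping.keys g. F p (Poly_Mapping.lookup g p))"
    by (rule sum_lookup_superset[symmetric]) (use assms in auto)
  finally show ?thesis .
qed

abbreviation sg :: "pt list \<Rightarrow> 'k \<Rightarrow> 'k::field pathcomb" where
  "sg \<equiv> Poly_Mapping.single"

lemma pathcomb_expand: "f = (\<Sum>p\<in>Poly_Mapping.keys f. sg p (Poly_Mapping.lookup f p))"
  by (rule poly_mapping_eqI) (simp add: lookup_sum lookup_single when_def sum.delta' in_keys_iff cong: if_cong)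

definition lin_ext :: "(pt list \<Rightarrow> 'k) \<Rightarrow> 'k::field pathcomb \<Rightarrow> 'k" where
  "lin_ext \<phi> f = (\<Sum>p\<in>Poly_Mapping.keys f. Poly_Mapping.lookup f p * \<phi> p)"

lemma lin_ext_add: "lin_ext \<phi> (f + g) = lin_ext \<phi> f + lin_ext \<phi> g"
  unfolding lin_ext_def by (rule sum_lookup_add) (auto simp: algebra_simps)

lemma lin_ext_single [simp]: "lin_ext \<phi> (sg p c) = c * \<phi> p"
  by (simp add: lin_ext_def)

lemma lin_ext_zero [simp]: "lin_ext \<phi> 0 = 0"
  by (simp add: lin_ext_def)

lemma lin_ext_uminus: "lin_ext \<phi> (- f) = - lin_ext \<phi> f"
  using lin_ext_add[of \<phi> f "- f"] by (simp add: eq_neg_iff_add_eq_0 add.commute)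

lemma lin_ext_diff: "lin_ext \<phi> (f - g) = lin_ext \<phi> f - lin_ext \<phi> g"
  using lin_ext_add[of \<phi> f "- g"] by (simp add: lin_ext_uminus)

lemma path_mult_add_left: "path_mult (f + g) h = path_mult f h + path_mult g h"
  unfolding path_mult_def
  by (rule sum_lookup_add[where F = "\<lambda>p c. \<Sum>q\<in>Poly_Mapping.keys h. if last p = hd q
        then sg (p @ tl q) (c * Poly_Mapping.lookup h q) else 0"])
    (simp_all add: distrib_right single_add sum.distrib[symmetric] if_distrib[of "\<lambda>x. x + _"] cong: if_cong)

lemma path_mult_add_right: "path_mult h (f + g) = path_mult h f + path_mult h g"
  unfolding path_mult_def sum.distrib[symmetric]
  by (rule sum.cong[OF refl], rule sum_lookup_add[where F = "\<lambda>q c. if last p = hd q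
        then sg (p @ tl q) (Poly_Mapping.lookup h p * c) else 0" for p])
    (auto simp: algebra_simps single_add)

lemma path_mult_zero [simp]: "path_mult 0 f = 0" "path_mult f 0 = 0"
  by (simp_all add: path_mult_def)

lemma path_mult_single:
  "path_mult (sg p c) (sg q d) = (if last p = hd q then sg (p @ tl q) (c * d) else 0)"
  by (cases "c = 0"; cases "d = 0") (auto simp: path_mult_def)

lemma path_mult_uminus_left: "path_mult (- f) g = - path_mult f g"
  using path_mult_add_left[of f "- f" g] by (simp add: eq_neg_iff_add_eq_0 add.commute)

lemma path_mult_uminus_right: "path_mult f (- g) = - path_mult f g"
  using path_mult_add_right[of f g "- g"] by (simp add: eq_neg_iff_add_eq_0 add.commute)

lemma path_mult_diff_left: "path_mult (f - g) h = path_mult f h - path_mult g h"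
  using path_mult_add_left[of f "- g" h] by (simp add: path_mult_uminus_left)

lemma path_mult_diff_right: "path_mult h (f - g) = path_mult h f - path_mult h g"
  using path_mult_add_right[of h f "- g"] by (simp add: path_mult_uminus_right)

definition combs :: "'k::field pathcomb set" where
  "combs = {f. Poly_Mapping.keys f \<subseteq> {p. is_path p}}"

lemma path_algebra_simps [simp]: "carrier path_algebra = combs" "mult path_algebra = path_mult"
  "zero path_algebra = 0" "add path_algebra = (+)"
  by (simp_all add: path_algebra_def combs_def)

lemma combs_zero [simp]: "0 \<in> combs"
  by (simp add: combs_def)

lemma combs_add [simp]: "f \<in> combs \<Longrightarrow> g \<in> combs \<Longrightarrow> f + g \<in> combs"
  unfolding combs_def using keys_add[of f g] by blast

lemma combs_uminus [simp]: "- f \<in> combs \<longleftrightarrow> f \<in> combs"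
  by (simp add: combs_def keys_def)

lemma combs_diff [simp]: "f \<in> combs \<Longrightarrow> g \<in> combs \<Longrightarrow> f - g \<in> combs"
  using combs_add[of f "- g"] by simp

lemma combs_single [simp]: "is_path p \<Longrightarrow> sg p c \<in> combs"
  by (simp add: combs_def)

lemma combs_sum [simp]: "(\<And>i. i \<in> S \<Longrightarrow> f i \<in> combs) \<Longrightarrow> sum f S \<in> combs"
  by (induction S rule: infinite_finite_induct) auto

lemma combs_induct [consumes 1, case_names zero single add]:
  assumes "f \<in> combs" "P 0" "\<And>p c. is_path p \<Longrightarrow> P (sg p c)"
    "\<And>f g. f \<in> combs \<Longrightarrow> g \<in> combs \<Longrightarrow> P f \<Longrightarrow> P g \<Longrightarrow> P (f + g)"
  shows "P f"
proof -
  have "P (\<Sum>p\<in>S. sg p (Poly_Mapping.lookup f p)) \<and> (\<Sum>p\<in>S. sg p (Poly_Mapping.lookup f p)) \<in> combs"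
    if "finite S" "\<forall>p\<in>S. is_path p" for S
    using that by induction (use assms in auto)
  from this[of "Poly_Mapping.keys f"] show ?thesis
    using assms(1) pathcomb_expand[of f] by (auto simp: combs_def)
qed

lemma is_path_nonempty: "is_path p \<Longrightarrow> p \<noteq> []"
  by (simp add: is_path_def)

lemma is_path_join: "is_path p \<Longrightarrow> is_path q \<Longrightarrow> last p = hd q \<Longrightarrow> is_path (p @ tl q)"
  by (cases q) (auto simp: is_path_def successively_append_iff successively_Cons)

lemma is_path_single [simp]: "is_path [z] \<longleftrightarrow> tvertex z"
  by (simp add: is_path_def)

lemma is_path_Cons: "is_path (z # w # p) \<longleftrightarrow> tvertex z \<and> tedge z w \<and> is_path (w # p)"
  by (auto simp: is_path_def)

lemma combs_mult [simp]:
  assumes "f \<in> combs" "g \<in> combs"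
  shows "path_mult f g \<in> combs"
  using assms(1)
proof (induction rule: combs_induct)
  case (single p c)
  show ?case using assms(2) by (induction rule: combs_induct) (use single in \<open>auto simp: path_mult_single path_mult_add_right is_path_join\<close>)
qed (auto simp: path_mult_add_left)

lemma path_mult_assoc:
  assumes "f \<in> combs" "g \<in> combs" "h \<in> combs"
  shows "path_mult (path_mult f g) h = path_mult f (path_mult g h)"
  using assms(1)
proof (induction rule: combs_induct)
  case (single p c)
  show ?case using assms(2)
  proof (induction rule: combs_induct)
    case (single q d)
    note q = this and p = \<open>is_path p\<close>
    show ?case using assms(3)
    proof (induction rule: combs_induct)
      case (single r e)
      obtain y q' where "q = y # q'" using is_path_nonempty[OF q] by (cases q) auto
      then show ?case by (auto simp: path_mult_single algebra_simps)
    qed (auto simp: path_mult_add_right)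
  qed (auto simp: path_mult_add_left path_mult_add_right)
qed (auto simp: path_mult_add_left)

lemma abelian_group_path_algebra: "abelian_group (path_algebra :: 'k::field pathcomb ring)"
proof (rule abelian_groupI)
  fix x :: "'k pathcomb" assume "x \<in> carrier path_algebra"
  then show "\<exists>y\<in>carrier path_algebra. y \<oplus>\<^bsub>path_algebra\<^esub> x = \<zero>\<^bsub>path_algebra\<^esub>"
    by (intro bexI[of _ "- x"]) auto
qed (auto simp: add.assoc add.commute)

section \<open>Computing with representatives in a quotient of the path algebra\<close>

definition cl :: "'k::field pathcomb set \<Rightarrow> 'k pathcomb \<Rightarrow> 'k pathcomb set" where
  "cl I f = I +>\<^bsub>path_algebra\<^esub> f"

locale pideal =
  fixes I :: "'k::field pathcomb set"
  assumes two_sided: "two_sided_ideal I path_algebra"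
begin

abbreviation "A \<equiv> path_algebra Quot I"

lemma subgroup_I: "subgroup I (add_monoid path_algebra)"
  using two_sided by (simp add: two_sided_ideal_def additive_subgroup_def)

lemma I_combs: "f \<in> I \<Longrightarrow> f \<in> combs"
  using subgroup.subset[OF subgroup_I] by auto

lemma I_zero: "0 \<in> I"
  using subgroup.one_closed[OF subgroup_I] by simp

lemma I_add: "f \<in> I \<Longrightarrow> g \<in> I \<Longrightarrow> f + g \<in> I"
  using subgroup.m_closed[OF subgroup_I] by simp

lemma I_uminus: "f \<in> I \<Longrightarrow> - f \<in> I"
proof -
  assume f: "f \<in> I"
  have "inv\<^bsub>add_monoid path_algebra\<^esub> f = - f"
  proof -
    interpret abelian_group "path_algebra :: 'k pathcomb ring" by (rule abelian_group_path_algebra)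
    have "a_inv path_algebra f = - f"
      by (rule minus_equality) (use I_combs[OF f] in auto)
    then show ?thesis by (simp add: a_inv_def)
  qed
  then show ?thesis using subgroup.m_inv_closed[OF subgroup_I f] by simp
qed

lemma I_diff: "f \<in> I \<Longrightarrow> g \<in> I \<Longrightarrow> f - g \<in> I"
  using I_add[of f "- g"] I_uminus by simp

lemma I_mult: "f \<in> I \<Longrightarrow> g \<in> combs \<Longrightarrow> path_mult f g \<in> I" "f \<in> I \<Longrightarrow> g \<in> combs \<Longrightarrow> path_mult g f \<in> I"
  using two_sided by (auto simp: two_sided_ideal_def)

lemma mem_cl_iff: "h \<in> cl I f \<longleftrightarrow> h - f \<in> I"
  by (auto simp: cl_def a_r_coset_def' image_iff intro!: bexI[of _ "h - f"])

lemma cl_self: "f \<in> cl I f"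
  by (simp add: mem_cl_iff I_zero)

lemma cl_eq_iff: "cl I f = cl I g \<longleftrightarrow> f - g \<in> I"
proof
  assume "f - g \<in> I"
  show "cl I f = cl I g"
  proof (intro Set.set_eqI)
    fix h
    show "h \<in> cl I f \<longleftrightarrow> h \<in> cl I g"
      using I_add[of "h - f" "f - g"] I_diff[of "h - g" "f - g"] \<open>f - g \<in> I\<close> by (auto simp: mem_cl_iff)
  qed
qed (metis cl_self mem_cl_iff)

lemma carrier_A: "carrier A = cl I ` combs"
  by (auto simp: FactRing_def A_RCOSETS_def' cl_def)

lemma cl_carrier [simp]: "f \<in> combs \<Longrightarrow> cl I f \<in> carrier A"
  by (simp add: carrier_A)

lemma carrier_A_E: 
  assumes "a \<in> carrier A" obtains f where "f \<in> combs" "a = cl I f"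
  using assms by (auto simp: carrier_A)

lemma zero_A: "zero A = cl I 0"
  using mem_cl_iff[of _ 0] by (auto simp: FactRing_def)

lemma add_A [simp]: "cl I f \<oplus>\<^bsub>A\<^esub> cl I g = cl I (f + g)"
proof -
  have "cl I f \<oplus>\<^bsub>A\<^esub> cl I g = {h + k | h k. h \<in> cl I f \<and> k \<in> cl I g}"
    by (auto simp: FactRing_def set_add_def')
  also have "\<dots> = cl I (f + g)"
  proof (intro Set.set_eqI iffI)
    fix x assume "x \<in> {h + k | h k. h \<in> cl I f \<and> k \<in> cl I g}"
    then obtain h k where "x = h + k" "h - f \<in> I" "k - g \<in> I" by (auto simp: mem_cl_iff)
    then show "x \<in> cl I (f + g)" using I_add[of "h - f" "k - g"] by (simp add: mem_cl_iff algebra_simps)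
  next
    fix x assume "x \<in> cl I (f + g)"
    then have "x = (x - g) + g" "x - g \<in> cl I f" "g \<in> cl I g" by (auto simp: mem_cl_iff I_zero algebra_simps)
    then show "x \<in> {h + k | h k. h \<in> cl I f \<and> k \<in> cl I g}" by blast
  qed
  finally show ?thesis .
qed

lemma mult_A [simp]:
  assumes "f \<in> combs" "g \<in> combs"
  shows "cl I f \<otimes>\<^bsub>A\<^esub> cl I g = cl I (path_mult f g)"
proof -
  have "cl I f \<otimes>\<^bsub>A\<^esub> cl I g = (\<Union>h\<in>cl I f. \<Union>k\<in>cl I g. cl I (path_mult h k))"
    by (simp add: FactRing_def rcoset_mult_def cl_def)
  also have "\<dots> = cl I (path_mult f g)"
  proof -
    have "cl I (path_mult h k) = cl I (path_mult f g)" if "h \<in> cl I f" "k \<in> cl I g" for h k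
    proof -
      have d: "h - f \<in> I" "k - g \<in> I" using that by (auto simp: mem_cl_iff)
      then have k: "k \<in> combs" using I_combs[of "k - g"] combs_add[of "k - g" g] assms(2) by simp
      have "path_mult h k - path_mult f g = path_mult (h - f) k + path_mult f (k - g)"
        by (simp add: path_mult_diff_left path_mult_diff_right)
      then show ?thesis using d k assms by (simp add: cl_eq_iff I_add I_mult)
    qed
    then show ?thesis using cl_self by blast
  qed
  finally show ?thesis .
qed

lemma abelian_group_A: "abelian_group A"
proof (rule abelian_groupI)
  fix x y z assume "x \<in> carrier A" "y \<in> carrier A" "z \<in> carrier A"
  then obtain f g h where e: "f \<in> combs" "x = cl I f" "g \<in> combs" "y = cl I g" "h \<in> combs" "z = cl I h"
    by (auto elim!: carrier_A_E)
  show "x \<oplus>\<^bsub>A\<^esub> y \<in> carrier A" "x \<oplus>\<^bsub>A\<^esub> y \<oplus>\<^bsub>A\<^esub> z = x \<oplus>\<^bsub>A\<^esub> (y \<oplus>\<^bsub>A\<^esub> z)" "x \<oplus>\<^bsub>A\<^esub> y = y \<oplus>\<^bsub>A\<^esub> x" "\<zero>\<^bsub>A\<^esub> \<oplus>\<^bsub>A\<^esub> x = x"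
    using e by (simp_all add: algebra_simps zero_A)
  show "\<exists>y\<in>carrier A. y \<oplus>\<^bsub>A\<^esub> x = \<zero>\<^bsub>A\<^esub>"
    using e by (intro bexI[of _ "cl I (- f)"]) (simp_all add: zero_A)
qed (simp add: zero_A)

lemma nonunital_ring_A: "nonunital_ring A"
proof (intro nonunital_ring.intro nonunital_ring_axioms.intro abelian_group_A)
  fix x y z assume "x \<in> carrier A" "y \<in> carrier A" "z \<in> carrier A"
  then obtain f g h where e: "f \<in> combs" "x = cl I f" "g \<in> combs" "y = cl I g" "h \<in> combs" "z = cl I h"
    by (auto elim!: carrier_A_E)
  show "(x \<otimes>\<^bsub>A\<^esub> y) \<otimes>\<^bsub>A\<^esub> z = x \<otimes>\<^bsub>A\<^esub> (y \<otimes>\<^bsub>A\<^esub> z)"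
    "(x \<oplus>\<^bsub>A\<^esub> y) \<otimes>\<^bsub>A\<^esub> z = x \<otimes>\<^bsub>A\<^esub> z \<oplus>\<^bsub>A\<^esub> y \<otimes>\<^bsub>A\<^esub> z"
    "z \<otimes>\<^bsub>A\<^esub> (x \<oplus>\<^bsub>A\<^esub> y) = z \<otimes>\<^bsub>A\<^esub> x \<oplus>\<^bsub>A\<^esub> z \<otimes>\<^bsub>A\<^esub> y"
    using e by (simp_all add: path_mult_assoc path_mult_add_left path_mult_add_right)
qed (auto elim!: carrier_A_E)

end

section \<open>Modules over quotients of the path algebra\<close>

lemma submoduleI':
  assumes "abelian_group M" "N \<subseteq> carrier M" "\<zero>\<^bsub>M\<^esub> \<in> N" "\<And>x y. x \<in> N \<Longrightarrow> y \<in> N \<Longrightarrow> x \<oplus>\<^bsub>M\<^esub> y \<in> N"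
    "\<And>x. x \<in> N \<Longrightarrow> \<ominus>\<^bsub>M\<^esub> x \<in> N" "\<And>a x. a \<in> carrier R \<Longrightarrow> x \<in> N \<Longrightarrow> a \<odot>\<^bsub>M\<^esub> x \<in> N"
  shows "submodule N R M"
  using assms by (intro submodule.intro submodule_axioms.intro subgroup.intro) (auto simp: a_inv_def[symmetric])

lemma submoduleD:
  assumes "submodule N R M"
  shows "N \<subseteq> carrier M" "\<zero>\<^bsub>M\<^esub> \<in> N" "\<And>x y. x \<in> N \<Longrightarrow> y \<in> N \<Longrightarrow> x \<oplus>\<^bsub>M\<^esub> y \<in> N"
    "\<And>x. x \<in> N \<Longrightarrow> \<ominus>\<^bsub>M\<^esub> x \<in> N" "\<And>a x. a \<in> carrier R \<Longrightarrow> x \<in> N \<Longrightarrow> a \<odot>\<^bsub>M\<^esub> x \<in> N"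
proof -
  have s: "subgroup N (add_monoid M)" using assms by (simp add: submodule_def)
  show "N \<subseteq> carrier M" "\<zero>\<^bsub>M\<^esub> \<in> N" "\<And>x y. x \<in> N \<Longrightarrow> y \<in> N \<Longrightarrow> x \<oplus>\<^bsub>M\<^esub> y \<in> N" "\<And>x. x \<in> N \<Longrightarrow> \<ominus>\<^bsub>M\<^esub> x \<in> N"
    using subgroup.subset[OF s] subgroup.one_closed[OF s] subgroup.m_closed[OF s] subgroup.m_inv_closed[OF s]
    by (auto simp: a_inv_def)
  show "\<And>a x. a \<in> carrier R \<Longrightarrow> x \<in> N \<Longrightarrow> a \<odot>\<^bsub>M\<^esub> x \<in> N"
    using submodule.smult_closed[OF assms] .
qed

text \<open>For \<open>act_unital\<close> it suffices that each single element is fixed by some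
  element of the algebra.\<close>

lemma right_moduleI:
  assumes "nonunital_ring A" "abelian_group M"
    "\<And>a m. a \<in> carrier A \<Longrightarrow> m \<in> carrier M \<Longrightarrow> a \<odot>\<^bsub>M\<^esub> m \<in> carrier M"
    "\<And>a b m. a \<in> carrier A \<Longrightarrow> b \<in> carrier A \<Longrightarrow> m \<in> carrier M \<Longrightarrow> (a \<oplus>\<^bsub>A\<^esub> b) \<odot>\<^bsub>M\<^esub> m = a \<odot>\<^bsub>M\<^esub> m \<oplus>\<^bsub>M\<^esub> b \<odot>\<^bsub>M\<^esub> m"
    "\<And>a m n. a \<in> carrier A \<Longrightarrow> m \<in> carrier M \<Longrightarrow> n \<in> carrier M \<Longrightarrow> a \<odot>\<^bsub>M\<^esub> (m \<oplus>\<^bsub>M\<^esub> n) = a \<odot>\<^bsub>M\<^esub> m \<oplus>\<^bsub>M\<^esub> a \<odot>\<^bsub>M\<^esub> n"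
    "\<And>a b m. a \<in> carrier A \<Longrightarrow> b \<in> carrier A \<Longrightarrow> m \<in> carrier M \<Longrightarrow> (a \<otimes>\<^bsub>A\<^esub> b) \<odot>\<^bsub>M\<^esub> m = b \<odot>\<^bsub>M\<^esub> (a \<odot>\<^bsub>M\<^esub> m)"
    "\<And>m. m \<in> carrier M \<Longrightarrow> \<exists>a\<in>carrier A. a \<odot>\<^bsub>M\<^esub> m = m"
  shows "right_module A M"
proof (intro right_module.intro right_module_axioms.intro assms(1,2))
  interpret abelian_group M by fact
  let ?S = "{a \<odot>\<^bsub>M\<^esub> m | a m. a \<in> carrier A \<and> m \<in> carrier M}"
  show "carrier M = generate (add_monoid M) ?S"
  proof
    show "carrier M \<subseteq> generate (add_monoid M) ?S"
    proof
      fix m assume m: "m \<in> carrier M"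
      then obtain a where "a \<in> carrier A" "a \<odot>\<^bsub>M\<^esub> m = m" using assms(7) by blast
      then have "m \<in> ?S" using m by force
      then show "m \<in> generate (add_monoid M) ?S" by (rule generate.incl)
    qed
    show "generate (add_monoid M) ?S \<subseteq> carrier M"
      using add.generate_incl[of ?S] assms(3) by auto
  qed
qed (use assms in auto)

text \<open>The substitute for the unit that the infinite quiver denies.\<close>

definition vunit :: "pt set \<Rightarrow> 'k::field pathcomb" where
  "vunit V = (\<Sum>w\<in>V. sg [w] 1)"

lemma path_mult_vunit_single:
  assumes "finite V" "p \<noteq> []"
  shows "path_mult (sg p c) (vunit V) = (if last p \<in> V then sg p c else 0)"
  using assms(1) unfolding vunit_def
proof (induction V rule: finite_induct)
  case (insert w V)
  then show ?case using assms(2) by (auto simp: path_mult_add_right path_mult_single)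
qed simp

lemma vunit_combs: "V \<subseteq> {z. tvertex z} \<Longrightarrow> vunit V \<in> combs"
  unfolding vunit_def by (rule combs_sum) auto

lemma last_tvertex: "is_path p \<Longrightarrow> tvertex (last p)"
  by (auto simp: is_path_def)

lemma hd_tvertex: "is_path p \<Longrightarrow> tvertex (hd p)"
  by (auto simp: is_path_def)

text \<open>The statement covers all larger finite sets as well, so that the units of two elements
  can be merged by taking a union.\<close>

lemma path_mult_vunit:
  assumes "f \<in> combs"
  obtains V where "finite V" "V \<subseteq> {z. tvertex z}" "\<And>W. finite W \<Longrightarrow> V \<subseteq> W \<Longrightarrow> path_mult f (vunit W) = f"
proof -
  have "\<exists>V. finite V \<and> V \<subseteq> {z. tvertex z} \<and> (\<forall>W. finite W \<longrightarrow> V \<subseteq> W \<longrightarrow> path_mult f (vunit W) = f)"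
    using assms
  proof (induction rule: combs_induct)
    case (single p c)
    then show ?case
      by (intro exI[of _ "{last p}"]) (auto simp: path_mult_vunit_single is_path_nonempty last_tvertex)
  next
    case (add f g)
    then obtain V V' where "finite V" "V \<subseteq> {z. tvertex z}" "\<forall>W. finite W \<longrightarrow> V \<subseteq> W \<longrightarrow> path_mult f (vunit W) = f"
      "finite V'" "V' \<subseteq> {z. tvertex z}" "\<forall>W. finite W \<longrightarrow> V' \<subseteq> W \<longrightarrow> path_mult g (vunit W) = g" by metis
    then show ?case by (intro exI[of _ "V \<union> V'"]) (auto simp: path_mult_add_left)
  qed auto
  then show thesis using that by blast
qed

section \<open>Modules as right actions of combinations of paths\<close>

locale pmod = pideal I for I :: "'k::field pathcomb set" +
  fixes M :: "('k pathcomb set, 'm) module"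
  assumes right_module_M: "right_module A M"
begin

sublocale RM: right_module A M by (rule right_module_M)

definition act :: "'m \<Rightarrow> 'k pathcomb \<Rightarrow> 'm" where
  "act m f = cl I f \<odot>\<^bsub>M\<^esub> m"

lemma act_carrier [simp]: "m \<in> carrier M \<Longrightarrow> f \<in> combs \<Longrightarrow> act m f \<in> carrier M"
  by (simp add: act_def RM.act_closed)

lemma act_add: "m \<in> carrier M \<Longrightarrow> f \<in> combs \<Longrightarrow> g \<in> combs \<Longrightarrow> act m (f + g) = act m f \<oplus>\<^bsub>M\<^esub> act m g"
  using RM.act_l_distr[of "cl I f" "cl I g" m] by (simp add: act_def)

lemma act_add_left: "m \<in> carrier M \<Longrightarrow> n \<in> carrier M \<Longrightarrow> f \<in> combs \<Longrightarrow> act (m \<oplus>\<^bsub>M\<^esub> n) f = act m f \<oplus>\<^bsub>M\<^esub> act n f"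
  by (simp add: act_def RM.act_r_distr)

lemma act_act: "m \<in> carrier M \<Longrightarrow> f \<in> combs \<Longrightarrow> g \<in> combs \<Longrightarrow> act (act m f) g = act m (path_mult f g)"
  using RM.act_assoc[of "cl I f" "cl I g" m] by (simp add: act_def)

lemma act_zero [simp]: "m \<in> carrier M \<Longrightarrow> act m 0 = \<zero>\<^bsub>M\<^esub>"
  using act_add[of m 0 0] RM.M.add.r_cancel_one[of "act m 0" "act m 0"] by simp

lemma zero_act [simp]: "f \<in> combs \<Longrightarrow> act \<zero>\<^bsub>M\<^esub> f = \<zero>\<^bsub>M\<^esub>"
  using act_add_left[of "\<zero>\<^bsub>M\<^esub>" "\<zero>\<^bsub>M\<^esub>" f] RM.M.add.r_cancel_one[of "act \<zero>\<^bsub>M\<^esub> f" "act \<zero>\<^bsub>M\<^esub> f"] by simp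

lemma act_uminus: "m \<in> carrier M \<Longrightarrow> f \<in> combs \<Longrightarrow> act m (- f) = \<ominus>\<^bsub>M\<^esub> act m f"
  using act_add[of m "- f" f] by (intro RM.M.minus_equality[symmetric]) auto

lemma act_uminus_left: "m \<in> carrier M \<Longrightarrow> f \<in> combs \<Longrightarrow> act (\<ominus>\<^bsub>M\<^esub> m) f = \<ominus>\<^bsub>M\<^esub> act m f"
  using act_add_left[of "\<ominus>\<^bsub>M\<^esub> m" m f] by (intro RM.M.minus_equality[symmetric]) (auto simp: RM.M.l_neg)

lemma act_diff: "m \<in> carrier M \<Longrightarrow> f \<in> combs \<Longrightarrow> g \<in> combs \<Longrightarrow> act m (f - g) = act m f \<ominus>\<^bsub>M\<^esub> act m g"
  using act_add[of m f "- g"] by (simp add: act_uminus a_minus_def)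

lemma act_cong: "f - g \<in> I \<Longrightarrow> act m f = act m g"
  by (simp add: act_def cl_eq_iff[symmetric])

lemma submodule_iff_act:
  "submodule N A M \<longleftrightarrow> N \<subseteq> carrier M \<and> \<zero>\<^bsub>M\<^esub> \<in> N \<and> (\<forall>x\<in>N. \<forall>y\<in>N. x \<oplus>\<^bsub>M\<^esub> y \<in> N) \<and> (\<forall>x\<in>N. \<ominus>\<^bsub>M\<^esub> x \<in> N) \<and>
     (\<forall>x\<in>N. \<forall>f\<in>combs. act x f \<in> N)"
proof
  assume "submodule N A M"
  then show "N \<subseteq> carrier M \<and> \<zero>\<^bsub>M\<^esub> \<in> N \<and> (\<forall>x\<in>N. \<forall>y\<in>N. x \<oplus>\<^bsub>M\<^esub> y \<in> N) \<and> (\<forall>x\<in>N. \<ominus>\<^bsub>M\<^esub> x \<in> N) \<and>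
     (\<forall>x\<in>N. \<forall>f\<in>combs. act x f \<in> N)"
    using submoduleD[of N A M] by (auto simp: act_def)
next
  assume "N \<subseteq> carrier M \<and> \<zero>\<^bsub>M\<^esub> \<in> N \<and> (\<forall>x\<in>N. \<forall>y\<in>N. x \<oplus>\<^bsub>M\<^esub> y \<in> N) \<and> (\<forall>x\<in>N. \<ominus>\<^bsub>M\<^esub> x \<in> N) \<and>
     (\<forall>x\<in>N. \<forall>f\<in>combs. act x f \<in> N)"
  then show "submodule N A M"
    by (intro submoduleI') (auto simp: act_def RM.M.abelian_group_axioms elim!: carrier_A_E)
qed

lemma submodule_act: "submodule N A M \<Longrightarrow> x \<in> N \<Longrightarrow> f \<in> combs \<Longrightarrow> act x f \<in> N"
  by (simp add: submodule_iff_act)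

lemma submodule_minus: "submodule N A M \<Longrightarrow> x \<in> N \<Longrightarrow> y \<in> N \<Longrightarrow> x \<ominus>\<^bsub>M\<^esub> y \<in> N"
  by (simp add: submodule_iff_act a_minus_def)

text \<open>A module is only known to be generated by products; a product inherits the unit of its
  algebra factor. Admitting every larger \<open>W\<close> lets the induction pass through
  sums.\<close>

lemma local_unit:
  assumes "m \<in> carrier M"
  obtains V where "finite V" "V \<subseteq> {z. tvertex z}"
    "\<And>W. finite W \<Longrightarrow> V \<subseteq> W \<Longrightarrow> W \<subseteq> {z. tvertex z} \<Longrightarrow> act m (vunit W) = m"
proof -
  let ?P = "\<lambda>m. m \<in> carrier M \<and> (\<exists>V. finite V \<and> V \<subseteq> {z. tvertex z} \<and>
    (\<forall>W. finite W \<longrightarrow> V \<subseteq> W \<longrightarrow> W \<subseteq> {z. tvertex z} \<longrightarrow> act m (vunit W) = m))"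
  have base_ok: "?P h" if h: "h \<in> {a \<odot>\<^bsub>M\<^esub> m | a m. a \<in> carrier A \<and> m \<in> carrier M}" for h
  proof -
    obtain f n where h: "f \<in> combs" "n \<in> carrier M" "h = act n f" using h by (auto simp: act_def elim!: carrier_A_E)
    obtain V where V: "finite V" "V \<subseteq> {z. tvertex z}" "\<And>W. finite W \<Longrightarrow> V \<subseteq> W \<Longrightarrow> path_mult f (vunit W) = f"
      using path_mult_vunit[OF h(1)] by blast
    have "act h (vunit W) = h" if "finite W" "V \<subseteq> W" "W \<subseteq> {z. tvertex z}" for W
      using h V(3)[OF that(1,2)] that(3) by (simp add: act_act vunit_combs)
    then show ?thesis using h V(1,2) by (intro conjI exI[of _ V]) auto
  qed
  have uminus: "?P (\<ominus>\<^bsub>M\<^esub> h)" if h: "?P h" for h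
  proof -
    obtain V where V: "finite V" "V \<subseteq> {z. tvertex z}"
      "\<forall>W. finite W \<longrightarrow> V \<subseteq> W \<longrightarrow> W \<subseteq> {z. tvertex z} \<longrightarrow> act h (vunit W) = h" using h by blast
    have "act (\<ominus>\<^bsub>M\<^esub> h) (vunit W) = \<ominus>\<^bsub>M\<^esub> h" if "finite W" "V \<subseteq> W" "W \<subseteq> {z. tvertex z}" for W
      using h V(3) that by (simp add: act_uminus_left vunit_combs)
    then show ?thesis using h V(1,2) by (intro conjI exI[of _ V]) auto
  qed
  have "m \<in> generate (add_monoid M) {a \<odot>\<^bsub>M\<^esub> m | a m. a \<in> carrier A \<and> m \<in> carrier M}"
    using assms RM.act_unital by simp
  then have "?P m"
  proof (induction rule: generate.induct)
    case one
    show ?case by (intro conjI exI[of _ "{}"]) (auto simp: vunit_combs)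
  next
    case (incl h)
    show ?case by (rule base_ok[OF incl])
  next
    case (inv h)
    show ?case using uminus[OF base_ok[OF inv]] by (simp add: a_inv_def)
  next
    case (eng h k)
    from eng(3) obtain V where V: "finite V" "V \<subseteq> {z. tvertex z}"
      "\<forall>W. finite W \<longrightarrow> V \<subseteq> W \<longrightarrow> W \<subseteq> {z. tvertex z} \<longrightarrow> act h (vunit W) = h" by blast
    from eng(4) obtain V' where V': "finite V'" "V' \<subseteq> {z. tvertex z}"
      "\<forall>W. finite W \<longrightarrow> V' \<subseteq> W \<longrightarrow> W \<subseteq> {z. tvertex z} \<longrightarrow> act k (vunit W) = k" by blast
    have "act (h \<oplus>\<^bsub>M\<^esub> k) (vunit W) = h \<oplus>\<^bsub>M\<^esub> k" if "finite W" "V \<union> V' \<subseteq> W" "W \<subseteq> {z. tvertex z}" for W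
      using V(3) V'(3) eng(3,4) that by (simp add: act_add_left vunit_combs)
    then show ?case
      using V(1,2) V'(1,2) eng(3,4) by (intro conjI exI[of _ "V \<union> V'"]) auto
  qed
  then show thesis using that by blast
qed

lemma unit_ex: "m \<in> carrier M \<Longrightarrow> \<exists>f\<in>combs. act m f = m"
  using local_unit[of m] vunit_combs by (metis order_refl)

lemma right_module_restrict:
  assumes "submodule N A M"
  shows "right_module A (restrict_module M N)"
proof (rule right_moduleI[OF nonunital_ring_A])
  note N = submoduleD[OF assms]
  note D = subsetD[OF N(1)]
  show "abelian_group (restrict_module M N)"
  proof (rule abelian_groupI)
    fix x assume x: "x \<in> carrier (restrict_module M N)"
    then show "\<exists>y\<in>carrier (restrict_module M N). y \<oplus>\<^bsub>restrict_module M N\<^esub> x = \<zero>\<^bsub>restrict_module M N\<^esub>"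
      using N D RM.M.l_neg by (intro bexI[of _ "\<ominus>\<^bsub>M\<^esub> x"]) (auto simp: restrict_module_def)
  qed (use N D in \<open>auto simp: restrict_module_def RM.M.a_ac\<close>)
  show "\<exists>a\<in>carrier A. a \<odot>\<^bsub>restrict_module M N\<^esub> m = m" if "m \<in> carrier (restrict_module M N)" for m
  proof -
    have "m \<in> carrier M" using that N(1) by (auto simp: restrict_module_def)
    then obtain f where "f \<in> combs" "act m f = m" using unit_ex by blast
    then show ?thesis by (intro bexI[of _ "cl I f"]) (auto simp: act_def restrict_module_def)
  qed
qed (use submoduleD[OF assms] RM.act_l_distr RM.act_r_distr RM.act_assoc in \<open>auto simp: restrict_module_def dest!: subsetD[OF submoduleD(1)[OF assms]]\<close>)

lemma pmod_restrict: "submodule N A M \<Longrightarrow> pmod I (restrict_module M N)"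
  by (intro pmod.intro pmod_axioms.intro right_module_restrict pideal_axioms)

section \<open>Quotient modules\<close>

definition coset :: "'m set \<Rightarrow> 'm \<Rightarrow> 'm set" where
  "coset N m = N +>\<^bsub>M\<^esub> m"

lemma abelian_subgroup_submodule: "submodule N A M \<Longrightarrow> abelian_subgroup N M"
  by (intro abelian_subgroupI3 additive_subgroup.intro RM.M.abelian_group_axioms) (simp add: submodule_def)

context
  fixes N assumes N: "submodule N A M"
begin

interpretation AS: abelian_subgroup N M by (rule abelian_subgroup_submodule[OF N])

lemma mem_coset_iff: "x \<in> carrier M \<Longrightarrow> y \<in> carrier M \<Longrightarrow> y \<in> coset N x \<longleftrightarrow> y \<ominus>\<^bsub>M\<^esub> x \<in> N"
  unfolding coset_def using AS.a_rcos_module[of x y] by (simp add: a_minus_def)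

lemma coset_carrier: "x \<in> carrier M \<Longrightarrow> y \<in> coset N x \<Longrightarrow> y \<in> carrier M"
  unfolding coset_def using AS.a_elemrcos_carrier by blast

lemma coset_self: "x \<in> carrier M \<Longrightarrow> x \<in> coset N x"
  unfolding coset_def using AS.a_rcos_self by simp

lemma coset_eq_iff:
  assumes "x \<in> carrier M" "y \<in> carrier M"
  shows "coset N y = coset N x \<longleftrightarrow> y \<ominus>\<^bsub>M\<^esub> x \<in> N"
proof
  assume "y \<ominus>\<^bsub>M\<^esub> x \<in> N"
  then have "y \<in> coset N x" using assms mem_coset_iff by blast
  then show "coset N y = coset N x" 
    using RM.M.a_repr_independence[of y N x] assms N by (simp add: coset_def submodule_def)
qed (use assms coset_self mem_coset_iff in blast)

lemma quotient_carrier: "carrier (quotient_module M N) = coset N ` carrier M"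
  by (auto simp: quotient_module_def A_RCOSETS_def' coset_def)

lemma quotient_add: "x \<in> carrier M \<Longrightarrow> y \<in> carrier M \<Longrightarrow>
    coset N x \<oplus>\<^bsub>quotient_module M N\<^esub> coset N y = coset N (x \<oplus>\<^bsub>M\<^esub> y)"
  using AS.a_rcos_sum[of x y] by (simp add: quotient_module_def coset_def)

lemma coset_zero: "coset N \<zero>\<^bsub>M\<^esub> = N"
  unfolding coset_def by (rule RM.M.a_coset_add_zero) (use submoduleD(1)[OF N] in auto)

lemma quotient_zero: "\<zero>\<^bsub>quotient_module M N\<^esub> = coset N \<zero>\<^bsub>M\<^esub>"
  unfolding coset_zero by (simp add: quotient_module_def)

lemma quotient_smult:
  assumes "x \<in> carrier M" "f \<in> combs"
  shows "cl I f \<odot>\<^bsub>quotient_module M N\<^esub> coset N x = coset N (act x f)"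
proof -
  have e: "coset N (act y f) = coset N (act x f)" if "y \<in> coset N x" for y
  proof -
    have y: "y \<in> carrier M" "y \<ominus>\<^bsub>M\<^esub> x \<in> N" using that assms(1) coset_carrier mem_coset_iff by blast+
    have "act y f \<ominus>\<^bsub>M\<^esub> act x f = act (y \<ominus>\<^bsub>M\<^esub> x) f"
      using y assms by (simp add: a_minus_def act_add_left act_uminus_left)
    then show ?thesis using y assms submodule_act[OF N y(2)] by (simp add: coset_eq_iff)
  qed
  have "(\<Union>y\<in>coset N x. coset N (act y f)) = coset N (act x f)"
    by (rule UN_constant_eq[OF coset_self[OF assms(1)]]) (intro ballI e)
  then show ?thesis by (simp add: quotient_module_def act_def coset_def)
qed

lemma quotient_carrierE:
  assumes "X \<in> carrier (quotient_module M N)"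
  obtains x where "x \<in> carrier M" "X = coset N x"
  using assms by (auto simp: quotient_carrier)

lemma coset_in_quotient: "x \<in> carrier M \<Longrightarrow> coset N x \<in> carrier (quotient_module M N)"
  by (simp add: quotient_carrier)

lemma right_module_quotient: "right_module A (quotient_module M N)"
proof (rule right_moduleI[OF nonunital_ring_A])
  show "abelian_group (quotient_module M N)"
  proof (rule abelian_groupI)
    fix X Y Z assume "X \<in> carrier (quotient_module M N)" "Y \<in> carrier (quotient_module M N)" "Z \<in> carrier (quotient_module M N)"
    then obtain x y z where e: "x \<in> carrier M" "X = coset N x" "y \<in> carrier M" "Y = coset N y" "z \<in> carrier M" "Z = coset N z"
      by (metis quotient_carrierE)
    show "X \<oplus>\<^bsub>quotient_module M N\<^esub> Y \<in> carrier (quotient_module M N)"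
      "X \<oplus>\<^bsub>quotient_module M N\<^esub> Y \<oplus>\<^bsub>quotient_module M N\<^esub> Z = X \<oplus>\<^bsub>quotient_module M N\<^esub> (Y \<oplus>\<^bsub>quotient_module M N\<^esub> Z)"
      "X \<oplus>\<^bsub>quotient_module M N\<^esub> Y = Y \<oplus>\<^bsub>quotient_module M N\<^esub> X"
      "\<zero>\<^bsub>quotient_module M N\<^esub> \<oplus>\<^bsub>quotient_module M N\<^esub> X = X"
      using e by (simp_all add: coset_in_quotient quotient_add quotient_zero RM.M.a_ac)
    show "\<exists>Y\<in>carrier (quotient_module M N). Y \<oplus>\<^bsub>quotient_module M N\<^esub> X = \<zero>\<^bsub>quotient_module M N\<^esub>"
      using e by (intro bexI[of _ "coset N (\<ominus>\<^bsub>M\<^esub> x)"]) (simp_all add: quotient_add quotient_zero coset_in_quotient RM.M.l_neg)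
  qed (simp add: quotient_zero coset_in_quotient)
next
  fix X assume X: "X \<in> carrier (quotient_module M N)"
  obtain x where x: "x \<in> carrier M" "X = coset N x" using quotient_carrierE[OF X] .
  then obtain f where f: "f \<in> combs" "act x f = x" using unit_ex by blast
  then show "\<exists>a\<in>carrier A. a \<odot>\<^bsub>quotient_module M N\<^esub> X = X"
    using x by (intro bexI[of _ "cl I f"]) (simp_all add: quotient_smult)
  fix Y assume "Y \<in> carrier (quotient_module M N)"
  then obtain y where y: "y \<in> carrier M" "Y = coset N y" by (rule quotient_carrierE)
  fix a assume "a \<in> carrier A"
  then obtain g where g: "g \<in> combs" "a = cl I g" by (rule carrier_A_E)
  show "a \<odot>\<^bsub>quotient_module M N\<^esub> X \<in> carrier (quotient_module M N)"
    "a \<odot>\<^bsub>quotient_module M N\<^esub> (X \<oplus>\<^bsub>quotient_module M N\<^esub> Y) =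
       a \<odot>\<^bsub>quotient_module M N\<^esub> X \<oplus>\<^bsub>quotient_module M N\<^esub> a \<odot>\<^bsub>quotient_module M N\<^esub> Y"
    using x y g by (simp_all add: quotient_smult quotient_add coset_in_quotient act_add_left)
  fix b assume "b \<in> carrier A"
  then obtain h where h: "h \<in> combs" "b = cl I h" by (rule carrier_A_E)
  show "(a \<oplus>\<^bsub>A\<^esub> b) \<odot>\<^bsub>quotient_module M N\<^esub> X = a \<odot>\<^bsub>quotient_module M N\<^esub> X \<oplus>\<^bsub>quotient_module M N\<^esub> b \<odot>\<^bsub>quotient_module M N\<^esub> X"
    "(a \<otimes>\<^bsub>A\<^esub> b) \<odot>\<^bsub>quotient_module M N\<^esub> X = b \<odot>\<^bsub>quotient_module M N\<^esub> (a \<odot>\<^bsub>quotient_module M N\<^esub> X)"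
    using x g h by (simp_all add: quotient_smult quotient_add act_add act_act)
qed

lemma pmod_quotient: "pmod I (quotient_module M N)"
  by (intro pmod.intro pmod_axioms.intro right_module_quotient pideal_axioms)

text \<open>First isomorphism theorem, with the kernel expressed through differences; the map on
  cosets evaluates \<open>h\<close> at a chosen representative.\<close>

lemma quotient_iso:
  assumes "\<And>x. x \<in> carrier M \<Longrightarrow> h x \<in> carrier P"
    and add: "\<And>x y. x \<in> carrier M \<Longrightarrow> y \<in> carrier M \<Longrightarrow> h (x \<oplus>\<^bsub>M\<^esub> y) = h x \<oplus>\<^bsub>P\<^esub> h y"
    and act: "\<And>x f. x \<in> carrier M \<Longrightarrow> f \<in> combs \<Longrightarrow> h (act x f) = cl I f \<odot>\<^bsub>P\<^esub> h x"
    and inj: "\<And>x y. x \<in> carrier M \<Longrightarrow> y \<in> carrier M \<Longrightarrow> h x = h y \<longleftrightarrow> x \<ominus>\<^bsub>M\<^esub> y \<in> N"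
    and surj: "\<And>p. p \<in> carrier P \<Longrightarrow> \<exists>x\<in>carrier M. h x = p"
  shows "module_iso A (quotient_module M N) P"
proof -
  define k where "k X = h (SOME x. x \<in> X)" for X
  have k: "k (coset N x) = h x" if x: "x \<in> carrier M" for x
  proof -
    have s: "(SOME y. y \<in> coset N x) \<in> coset N x" using coset_self[OF x] by (rule someI)
    then show ?thesis unfolding k_def using inj mem_coset_iff coset_carrier x by blast
  qed
  have "k \<in> module_hom A (quotient_module M N) P"
    unfolding module_hom_def
  proof (intro CollectI conjI ballI funcsetI)
    fix X assume "X \<in> carrier (quotient_module M N)"
    then obtain x where x: "x \<in> carrier M" "X = coset N x" by (rule quotient_carrierE)
    then show "k X \<in> carrier P" by (simp add: k assms(1))
    fix Y assume "Y \<in> carrier (quotient_module M N)"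
    then obtain y where y: "y \<in> carrier M" "Y = coset N y" by (rule quotient_carrierE)
    show "k (X \<oplus>\<^bsub>quotient_module M N\<^esub> Y) = k X \<oplus>\<^bsub>P\<^esub> k Y" using x y by (simp add: quotient_add k add)
  next
    fix a X assume "X \<in> carrier (quotient_module M N)" "a \<in> carrier A"
    then obtain x g where x: "x \<in> carrier M" "X = coset N x" "g \<in> combs" "a = cl I g"
      by (metis quotient_carrierE carrier_A_E)
    then show "k (a \<odot>\<^bsub>quotient_module M N\<^esub> X) = a \<odot>\<^bsub>P\<^esub> k X" by (simp add: quotient_smult k act)
  qed
  moreover have "bij_betw k (carrier (quotient_module M N)) (carrier P)"
    unfolding bij_betw_def
  proof
    show "inj_on k (carrier (quotient_module M N))"
    proof (rule inj_onI)
      fix X Y assume "X \<in> carrier (quotient_module M N)" "Y \<in> carrier (quotient_module M N)" and e: "k X = k Y"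
      then obtain x y where xy: "x \<in> carrier M" "X = coset N x" "y \<in> carrier M" "Y = coset N y"
        by (auto simp: quotient_carrier)
      then show "X = Y" using e by (simp only: k inj coset_eq_iff)
    qed
    show "k ` carrier (quotient_module M N) = carrier P"
      using assms(1) surj by (force simp: quotient_carrier k image_iff)
  qed
  ultimately show ?thesis unfolding module_iso_def by blast
qed

end

lemma submodule_restrict:
  assumes "submodule G A M" "submodule F A M" "F \<subseteq> G"
  shows "submodule F A (restrict_module M G)"
proof -
  interpret R: pmod I "restrict_module M G" by (rule pmod_restrict[OF assms(1)])
  have inv: "\<ominus>\<^bsub>restrict_module M G\<^esub> x = \<ominus>\<^bsub>M\<^esub> x" if "x \<in> F" for x
    by (rule R.RM.M.minus_equality) (use that assms submoduleD[OF assms(2)] in \<open>auto simp: restrict_module_def intro!: RM.M.l_neg\<close>)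
  have "R.act x f = act x f" for x f unfolding R.act_def act_def by (simp add: restrict_module_def)
  then show ?thesis
    using assms unfolding R.submodule_iff_act submodule_iff_act by (auto simp: inv) (auto simp: restrict_module_def)
qed

end

section \<open>Cyclic modules on a rhombus\<close>

lemma lookup_path_mult_1:
  assumes "f \<in> combs" "g \<in> combs"
  shows "Poly_Mapping.lookup (path_mult f g) [a] = Poly_Mapping.lookup f [a] * Poly_Mapping.lookup g [a]"
  using assms(1)
proof (induction rule: combs_induct)
  case (single p c)
  show ?case using assms(2)
  proof (induction rule: combs_induct)
    case (single q d)
    obtain x xs y ys where "p = x # xs" "q = y # ys"
      using is_path_nonempty[OF single] is_path_nonempty[OF \<open>is_path p\<close>] by (metis list.exhaust)
    then show ?case
      by (cases xs) (auto simp: path_mult_single lookup_single when_def)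
  qed (auto simp: path_mult_add_right lookup_add algebra_simps)
qed (auto simp: path_mult_add_left lookup_add algebra_simps)

lemma lookup_path_mult_2:
  assumes "f \<in> combs" "g \<in> combs"
  shows "Poly_Mapping.lookup (path_mult f g) [a, b] = Poly_Mapping.lookup f [a] * Poly_Mapping.lookup g [a, b]
    + Poly_Mapping.lookup f [a, b] * Poly_Mapping.lookup g [b]"
  using assms(1)
proof (induction rule: combs_induct)
  case (single p c)
  show ?case using assms(2)
  proof (induction rule: combs_induct)
    case (single q d)
    obtain x xs y ys where "p = x # xs" "q = y # ys"
      using is_path_nonempty[OF single] is_path_nonempty[OF \<open>is_path p\<close>] by (metis list.exhaust)
    then show ?case
      by (cases xs; cases "tl xs") (auto simp: path_mult_single lookup_single when_def)
  qed (auto simp: path_mult_add_right lookup_add algebra_simps)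
qed (auto simp: path_mult_add_left lookup_add algebra_simps)

lemma lookup_path_mult_3:
  assumes "f \<in> combs" "g \<in> combs"
  shows "Poly_Mapping.lookup (path_mult f g) [a, b, c] = Poly_Mapping.lookup f [a] * Poly_Mapping.lookup g [a, b, c]
    + Poly_Mapping.lookup f [a, b] * Poly_Mapping.lookup g [b, c] + Poly_Mapping.lookup f [a, b, c] * Poly_Mapping.lookup g [c]"
  using assms(1)
proof (induction rule: combs_induct)
  case (single p c')
  show ?case using assms(2)
  proof (induction rule: combs_induct)
    case (single q d)
    obtain x xs y ys where "p = x # xs" "q = y # ys"
      using is_path_nonempty[OF single] is_path_nonempty[OF \<open>is_path p\<close>] by (metis list.exhaust)
    then show ?case
      by (cases xs; cases "tl xs"; cases "tl (tl xs)") (auto simp: path_mult_single lookup_single when_def)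
  qed (auto simp: path_mult_add_right lookup_add algebra_simps)
qed (auto simp: path_mult_add_left lookup_add algebra_simps)

text \<open>Modulo the paths that leave the rhombus \<open>w, u, t, v\<close>, a combination of paths from \<open>w\<close> has
  this form.\<close>

definition nform :: "pt \<Rightarrow> pt \<Rightarrow> pt \<Rightarrow> pt \<Rightarrow> 'k::field pathcomb \<Rightarrow> 'k pathcomb" where
  "nform w u v t f = sg [w] (Poly_Mapping.lookup f [w]) + sg [w, u] (Poly_Mapping.lookup f [w, u])
    + sg [w, v] (Poly_Mapping.lookup f [w, v])
    + sg [w, u, t] (Poly_Mapping.lookup f [w, u, t] + Poly_Mapping.lookup f [w, v, t])"

lemma nform_add: "nform w u v t (f + g) = nform w u v t f + nform w u v t g"
  by (simp add: nform_def lookup_add single_add algebra_simps)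

lemma nform_zero [simp]: "nform w u v t 0 = 0"
  by (simp add: nform_def)

context pmod
begin

lemma uminus_zero [simp]: "\<ominus>\<^bsub>M\<^esub> \<zero>\<^bsub>M\<^esub> = \<zero>\<^bsub>M\<^esub>"
  using RM.M.minus_equality[of "\<zero>\<^bsub>M\<^esub>" "\<zero>\<^bsub>M\<^esub>"] by simp

lemma zero_submodule: "submodule {\<zero>\<^bsub>M\<^esub>} A M"
  by (simp add: submodule_iff_act)

lemma minus_eq_zeroD:
  assumes "x \<in> carrier M" "y \<in> carrier M" "x \<ominus>\<^bsub>M\<^esub> y = \<zero>\<^bsub>M\<^esub>"
  shows "x = y"
  using RM.M.minus_equality[of x "\<ominus>\<^bsub>M\<^esub> y"] assms by (simp add: a_minus_def)

text \<open>Makes the subquotient \<open>(F + m A) / F\<close> a quotient of the rhombus module with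
  top at \<open>w\<close> and socle at \<open>t\<close>: modulo \<open>F\<close>, only the paths
  inside the rhombus survive. That the path across the rhombus stays outside \<open>F\<close> is
  kept as a separate hypothesis, since its proof rests on the trace.\<close>

definition generator :: "'m set \<Rightarrow> 'm \<Rightarrow> pt \<Rightarrow> pt \<Rightarrow> pt \<Rightarrow> pt \<Rightarrow> bool" where
  "generator F m w u v t \<longleftrightarrow> m \<in> carrier M \<and> act m (sg [w] 1) = m \<and> rhombus w u t v \<and>
     act m (sg [w, u, t] 1) = act m (sg [w, v, t] 1) \<and>
     (\<forall>p. is_path p \<longrightarrow> hd p = w \<longrightarrow> p \<notin> {[w], [w, u], [w, v], [w, u, t], [w, v, t]} \<longrightarrow> act m (sg p 1) \<in> F)"

lemma generator_mono: "generator F m w u v t \<Longrightarrow> F \<subseteq> F' \<Longrightarrow> generator F' m w u v t"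
  unfolding generator_def by blast

lemma generator_paths:
  assumes "generator F m w u v t"
  shows "is_path [w]" "is_path [w, u]" "is_path [w, v]" "is_path [w, u, t]" "is_path [w, v, t]"
    "is_path [u, t]" "is_path [v, t]" "is_path [t]" "is_path [u]" "is_path [v]"
    "w \<noteq> u" "w \<noteq> v" "w \<noteq> t" "u \<noteq> v" "u \<noteq> t" "v \<noteq> t"
proof -
  have r: "rhombus w u t v" using assms by (simp add: generator_def)
  show "is_path [w]" "is_path [w, u]" "is_path [w, v]" "is_path [w, u, t]" "is_path [w, v, t]"
    "is_path [u, t]" "is_path [v, t]" "is_path [t]" "is_path [u]" "is_path [v]"
    using rhombus_tedge[OF r] tedge_tvertex by (auto simp: is_path_Cons)
  show "w \<noteq> u" "w \<noteq> v" "w \<noteq> t" "u \<noteq> v" "u \<noteq> t" "v \<noteq> t"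
    using rhombus_distinct[OF r] by auto
qed

lemma nform_combs: "generator F m w u v t \<Longrightarrow> nform w u v t f \<in> combs"
  using generator_paths[of F m w u v t] by (auto simp: nform_def)

text \<open>Scalars of the field act through multiples of the trivial path at the end
  vertex.\<close>

lemma act_sg_scale: "m \<in> carrier M \<Longrightarrow> is_path p \<Longrightarrow> act m (sg p c) = act (act m (sg p 1)) (sg [last p] c)"
  by (simp add: act_act path_mult_single last_tvertex)

lemma generator_opposite:
  assumes "generator F m w u v t"
  shows "act m (sg [w, v, t] c) = act m (sg [w, u, t] c)"
  using assms generator_paths[OF assms] act_sg_scale[of m "[w, v, t]" c] act_sg_scale[of m "[w, u, t]" c]
  by (simp add: generator_def)

lemma generator_reduce:
  assumes "submodule F A M" "generator F m w u v t" "f \<in> combs"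
  shows "act m f \<ominus>\<^bsub>M\<^esub> act m (nform w u v t f) \<in> F"
  using assms(3)
proof (induction rule: combs_induct)
  case zero
  show ?case using assms(1,2) by (simp add: generator_def submodule_iff_act a_minus_def)
next
  case (single p c)
  note m = assms(2)[unfolded generator_def]
  note P = generator_paths[OF assms(2)]
  have F0: "\<zero>\<^bsub>M\<^esub> \<in> F" using assms(1) by (simp add: submodule_iff_act)
  consider "hd p \<noteq> w" | "p \<in> {[w], [w, u], [w, v], [w, u, t]}" | "p = [w, v, t]"
    | "hd p = w" "p \<notin> {[w], [w, u], [w, v], [w, u, t], [w, v, t]}" by blast
  then show ?case
  proof cases
    case 1
    have "act m (sg p c) = act (act m (sg [w] 1)) (sg p c)" using m by simp
    also have "\<dots> = act m (path_mult (sg [w] 1) (sg p c))" by (rule act_act) (use m P single in auto)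
    also have "path_mult (sg [w] 1) (sg p c) = 0" using 1 by (simp add: path_mult_single)
    finally have "act m (sg p c) = \<zero>\<^bsub>M\<^esub>" using m by simp
    moreover have "nform w u v t (sg p c) = 0" using 1 by (auto simp: nform_def lookup_single when_def)
    ultimately show ?thesis using m F0 by (simp add: a_minus_def)
  next
    case 2
    then have "nform w u v t (sg p c) = sg p c" using P by (auto simp: nform_def lookup_single when_def)
    then show ?thesis using m F0 single by (simp add: a_minus_def RM.M.r_neg)
  next
    case 3
    then have "nform w u v t (sg p c) = sg [w, u, t] c" using P by (auto simp: nform_def lookup_single when_def)
    then show ?thesis using m F0 single P 3 generator_opposite[OF assms(2)] by (simp add: a_minus_def RM.M.r_neg)
  next
    case 4
    then have "nform w u v t (sg p c) = 0" by (auto simp: nform_def lookup_single when_def)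
    moreover have "act m (sg p c) \<in> F"
      by (subst act_sg_scale[OF conjunct1[OF m] single], rule submodule_act[OF assms(1)]) (use m 4 single in \<open>auto simp: last_tvertex\<close>)
    ultimately show ?thesis using m F0 submodule_minus[OF assms(1)] by simp
  qed
next
  case (add f g)
  have m: "m \<in> carrier M" using assms(2) by (simp add: generator_def)
  note c = nform_combs[OF assms(2)]
  have "act m (f + g) \<ominus>\<^bsub>M\<^esub> act m (nform w u v t (f + g)) =
    (act m f \<ominus>\<^bsub>M\<^esub> act m (nform w u v t f)) \<oplus>\<^bsub>M\<^esub> (act m g \<ominus>\<^bsub>M\<^esub> act m (nform w u v t g))"
    using m add(1,2) c[of f] c[of g]
    by (simp add: nform_add act_add a_minus_def RM.M.minus_add RM.M.a_ac)
  then show ?case using add(3,4) assms(1) by (simp add: submodule_iff_act)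
qed

text \<open>Multiplying the normal form by \<open>[w, u, t]\<close>, \<open>[u, t]\<close>,
  \<open>[v, t]\<close> and \<open>[t]\<close> moves one coefficient at a time onto the path across
  the rhombus, which is not in \<open>F\<close>.\<close>

lemma generator_independent:
  assumes "submodule F A M" "generator F m w u v t" "f \<in> combs" "act m f \<in> F" "act m (sg [w, u, t] 1) \<notin> F"
  shows "Poly_Mapping.lookup f [w] = 0 \<and> Poly_Mapping.lookup f [w, u] = 0 \<and> Poly_Mapping.lookup f [w, v] = 0 \<and>
    Poly_Mapping.lookup f [w, u, t] + Poly_Mapping.lookup f [w, v, t] = 0"
proof -
  note P = generator_paths[OF assms(2)]
  have m: "m \<in> carrier M" using assms(2) by (simp add: generator_def)
  note c = nform_combs[OF assms(2)]
  let ?g = "nform w u v t f"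
  have "act m f \<ominus>\<^bsub>M\<^esub> (act m f \<ominus>\<^bsub>M\<^esub> act m ?g) \<in> F"
    using generator_reduce[OF assms(1-3)] assms(1,4) submodule_minus by blast
  moreover have "act m f \<ominus>\<^bsub>M\<^esub> (act m f \<ominus>\<^bsub>M\<^esub> act m ?g) = act m ?g"
    using m assms(3) c[of f] by (simp add: a_minus_def RM.M.minus_add RM.M.r_neg1 RM.M.r_neg flip: RM.M.a_assoc)
  ultimately have g: "act m ?g \<in> F" by simp
  have q: "act m (path_mult ?g q) \<in> F" if "q \<in> combs" for q
    using submodule_act[OF assms(1) g that] m that c[of f] by (simp add: act_act)
  have z: "d = 0" if "act m (sg [w, u, t] d) \<in> F" for d
  proof (rule ccontr)
    assume "d \<noteq> 0"
    then have "act (act m (sg [w, u, t] d)) (sg [t] (1 / d)) = act m (sg [w, u, t] 1)"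
      using m P by (simp add: act_act path_mult_single)
    then show False using submodule_act[OF assms(1) that, of "sg [t] (1 / d)"] P assms(5) by simp
  qed
  have "act m (sg [w, u, t] (Poly_Mapping.lookup f [w])) \<in> F" "act m (sg [w, u, t] (Poly_Mapping.lookup f [w, u])) \<in> F"
    "act m (sg [w, v, t] (Poly_Mapping.lookup f [w, v])) \<in> F"
    "act m (sg [w, u, t] (Poly_Mapping.lookup f [w, u, t] + Poly_Mapping.lookup f [w, v, t])) \<in> F"
    using q[of "sg [w, u, t] 1"] q[of "sg [u, t] 1"] q[of "sg [v, t] 1"] q[of "sg [t] 1"] P
    by (simp_all add: nform_def path_mult_add_left path_mult_single)
  then show ?thesis using z generator_opposite[OF assms(2)] by simp
qed

end

lemma simple_module_simps [simp]: "carrier (simple_module w) = UNIV" "add (simple_module w) = (+)"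
  "zero (simple_module w) = 0"
  by (simp_all add: simple_module_def)

text \<open>What makes the action on \<open>simple_module\<close> independent of the chosen
  representative. The bound 2 counts vertices, so it concerns trivial paths and arrows.\<close>

locale graded_pideal = pideal +
  assumes low_degree: "f \<in> I \<Longrightarrow> length p \<le> 2 \<Longrightarrow> Poly_Mapping.lookup f p = 0"
begin

lemma simple_smult: "cl I f \<odot>\<^bsub>simple_module w\<^esub> c = c * Poly_Mapping.lookup f [w]"
proof -
  have "(SOME g. g \<in> cl I f) \<in> cl I f" using cl_self by (rule someI)
  then have "Poly_Mapping.lookup ((SOME g. g \<in> cl I f) - f) [w] = 0" using low_degree by (simp add: mem_cl_iff)
  then show ?thesis by (simp add: simple_module_def lookup_minus)
qed

end

section \<open>Coordinates on a cyclic module over a rhombus\<close>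

locale cyclic_rhombus = pmod I M + graded_pideal I for I :: "'k::field pathcomb set" and M :: "('k pathcomb set, 'm) module" +
  fixes m w u v t
  assumes gen: "generator {\<zero>\<^bsub>M\<^esub>} m w u v t"
    and cyclic: "carrier M = act m ` combs"
    and nonzero: "act m (sg [w, u, t] 1) \<noteq> \<zero>\<^bsub>M\<^esub>"
begin

lemma m [simp]: "m \<in> carrier M" using gen by (simp add: generator_def)

definition rep :: "'m \<Rightarrow> 'k pathcomb" where
  "rep x = (SOME f. f \<in> combs \<and> x = act m f)"

text \<open>The four coordinates belong to the top, the two middle vertices and the socle. Although
  \<open>rep\<close> is an arbitrary choice, \<open>generator_independent\<close> makes them well
  defined, see \<open>co_act\<close>.\<close>

definition "co0 x = Poly_Mapping.lookup (rep x) [w]"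
definition "co1 x = Poly_Mapping.lookup (rep x) [w, u]"
definition "co2 x = Poly_Mapping.lookup (rep x) [w, v]"
definition "co3 x = Poly_Mapping.lookup (rep x) [w, u, t] + Poly_Mapping.lookup (rep x) [w, v, t]"

lemmas co_defs = co0_def co1_def co2_def co3_def

lemma rep: "x \<in> carrier M \<Longrightarrow> rep x \<in> combs \<and> x = act m (rep x)"
  unfolding rep_def by (rule someI_ex) (auto simp: cyclic)

lemma co_act:
  assumes "f \<in> combs"
  shows "co0 (act m f) = Poly_Mapping.lookup f [w]" "co1 (act m f) = Poly_Mapping.lookup f [w, u]"
    "co2 (act m f) = Poly_Mapping.lookup f [w, v]"
    "co3 (act m f) = Poly_Mapping.lookup f [w, u, t] + Poly_Mapping.lookup f [w, v, t]"
proof -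
  have r: "rep (act m f) \<in> combs" "act m (rep (act m f)) = act m f" using rep[of "act m f"] assms by auto
  then have "act m (rep (act m f) - f) \<in> {\<zero>\<^bsub>M\<^esub>}"
    using assms by (simp add: act_diff a_minus_def RM.M.r_neg)
  from generator_independent[OF zero_submodule gen _ this] nonzero r(1) assms
  have "Poly_Mapping.lookup (rep (act m f) - f) [w] = 0 \<and> Poly_Mapping.lookup (rep (act m f) - f) [w, u] = 0 \<and>
    Poly_Mapping.lookup (rep (act m f) - f) [w, v] = 0 \<and>
    Poly_Mapping.lookup (rep (act m f) - f) [w, u, t] + Poly_Mapping.lookup (rep (act m f) - f) [w, v, t] = 0" by simp
  then show "co0 (act m f) = Poly_Mapping.lookup f [w]" "co1 (act m f) = Poly_Mapping.lookup f [w, u]"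
    "co2 (act m f) = Poly_Mapping.lookup f [w, v]"
    "co3 (act m f) = Poly_Mapping.lookup f [w, u, t] + Poly_Mapping.lookup f [w, v, t]"
    by (simp_all add: co_defs lookup_minus algebra_simps)
qed

lemma co_add:
  assumes "x \<in> carrier M" "y \<in> carrier M"
  shows "co0 (x \<oplus>\<^bsub>M\<^esub> y) = co0 x + co0 y" "co1 (x \<oplus>\<^bsub>M\<^esub> y) = co1 x + co1 y"
    "co2 (x \<oplus>\<^bsub>M\<^esub> y) = co2 x + co2 y" "co3 (x \<oplus>\<^bsub>M\<^esub> y) = co3 x + co3 y"
proof -
  obtain f g where "f \<in> combs" "x = act m f" "g \<in> combs" "y = act m g" using assms cyclic by auto
  then show "co0 (x \<oplus>\<^bsub>M\<^esub> y) = co0 x + co0 y" "co1 (x \<oplus>\<^bsub>M\<^esub> y) = co1 x + co1 y"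
    "co2 (x \<oplus>\<^bsub>M\<^esub> y) = co2 x + co2 y" "co3 (x \<oplus>\<^bsub>M\<^esub> y) = co3 x + co3 y"
    by (simp_all add: co_act lookup_add flip: act_add)
qed

lemma co_mult:
  assumes "x \<in> carrier M" "g \<in> combs"
  shows "co0 (act x g) = co0 x * Poly_Mapping.lookup g [w]"
    "co1 (act x g) = co0 x * Poly_Mapping.lookup g [w, u] + co1 x * Poly_Mapping.lookup g [u]"
    "co2 (act x g) = co0 x * Poly_Mapping.lookup g [w, v] + co2 x * Poly_Mapping.lookup g [v]"
    "co3 (act x g) = co0 x * (Poly_Mapping.lookup g [w, u, t] + Poly_Mapping.lookup g [w, v, t])
       + co1 x * Poly_Mapping.lookup g [u, t] + co2 x * Poly_Mapping.lookup g [v, t] + co3 x * Poly_Mapping.lookup g [t]"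
proof -
  obtain f where f: "f \<in> combs" "x = act m f" using assms cyclic by auto
  show "co0 (act x g) = co0 x * Poly_Mapping.lookup g [w]"
    "co1 (act x g) = co0 x * Poly_Mapping.lookup g [w, u] + co1 x * Poly_Mapping.lookup g [u]"
    "co2 (act x g) = co0 x * Poly_Mapping.lookup g [w, v] + co2 x * Poly_Mapping.lookup g [v]"
    "co3 (act x g) = co0 x * (Poly_Mapping.lookup g [w, u, t] + Poly_Mapping.lookup g [w, v, t])
       + co1 x * Poly_Mapping.lookup g [u, t] + co2 x * Poly_Mapping.lookup g [v, t] + co3 x * Poly_Mapping.lookup g [t]"
    using f assms(2) by (simp_all add: act_act co_act lookup_path_mult_1 lookup_path_mult_2 lookup_path_mult_3 algebra_simps)
qed

lemma co_zero: "co0 \<zero>\<^bsub>M\<^esub> = 0" "co1 \<zero>\<^bsub>M\<^esub> = 0" "co2 \<zero>\<^bsub>M\<^esub> = 0" "co3 \<zero>\<^bsub>M\<^esub> = 0"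
  using co_act[of 0] by simp_all

lemma co_uminus:
  assumes "x \<in> carrier M"
  shows "co0 (\<ominus>\<^bsub>M\<^esub> x) = - co0 x" "co1 (\<ominus>\<^bsub>M\<^esub> x) = - co1 x"
    "co2 (\<ominus>\<^bsub>M\<^esub> x) = - co2 x" "co3 (\<ominus>\<^bsub>M\<^esub> x) = - co3 x"
  using co_add[of "\<ominus>\<^bsub>M\<^esub> x" x] co_zero assms by (simp_all add: RM.M.l_neg eq_neg_iff_add_eq_0)

lemma co_eq_zero:
  assumes "x \<in> carrier M" "co0 x = 0" "co1 x = 0" "co2 x = 0" "co3 x = 0"
  shows "x = \<zero>\<^bsub>M\<^esub>"
proof -
  obtain f where f: "f \<in> combs" "x = act m f" using assms cyclic by auto
  then have "nform w u v t f = 0" using assms(2-5) by (simp add: nform_def co_act)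
  then show ?thesis using generator_reduce[OF zero_submodule gen f(1)] f by (simp add: a_minus_def)
qed

lemma co_eqI:
  assumes "x \<in> carrier M" "y \<in> carrier M" "co0 x = co0 y" "co1 x = co1 y" "co2 x = co2 y" "co3 x = co3 y"
  shows "x = y"
proof -
  have "x \<ominus>\<^bsub>M\<^esub> y = \<zero>\<^bsub>M\<^esub>"
    by (rule co_eq_zero) (use assms in \<open>auto simp: a_minus_def co_add co_uminus\<close>)
  then show ?thesis using assms minus_eq_zeroD by blast
qed

lemmas P = generator_paths[OF gen]

lemma co_ex: "\<exists>x\<in>carrier M. co0 x = a \<and> co1 x = b \<and> co2 x = c \<and> co3 x = d"
proof -
  let ?f = "sg [w] a + sg [w, u] b + sg [w, v] c + sg [w, u, t] d"
  have f: "?f \<in> combs" using P by simp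
  show ?thesis
    by (rule bexI[of _ "act m ?f"]) (use f P in \<open>simp_all add: co_act lookup_add lookup_single when_def\<close>)
qed

definition "Rad = {x \<in> carrier M. co0 x = 0}"
definition "Soc = {x \<in> carrier M. co0 x = 0 \<and> co1 x = 0 \<and> co2 x = 0}"

lemma Rad_iff: "x \<in> Rad \<longleftrightarrow> x \<in> carrier M \<and> co0 x = 0"
  and Soc_iff: "x \<in> Soc \<longleftrightarrow> x \<in> carrier M \<and> co0 x = 0 \<and> co1 x = 0 \<and> co2 x = 0"
  by (auto simp: Rad_def Soc_def)

lemma submodule_Rad: "submodule Rad A M" and submodule_Soc: "submodule Soc A M"
  by (auto simp: submodule_iff_act Rad_def Soc_def co_add co_uminus co_zero co_mult)

text \<open>Acting with a multiple of the trivial path at \<open>w\<close> strips \<open>x\<close>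
  of everything except its top coordinate and so returns the generator \<open>m\<close>.\<close>

lemma submodule_full:
  assumes "submodule N A M" "x \<in> N" "co0 x \<noteq> 0"
  shows "N = carrier M"
proof -
  have N: "N \<subseteq> carrier M" using assms(1) by (simp add: submodule_iff_act)
  have mw: "act m (sg [w] 1) = m" using gen by (simp add: generator_def)
  have "co0 m = 1" "co1 m = 0" "co2 m = 0" "co3 m = 0"
    using co_act[of "sg [w] 1", unfolded mw] P by (simp_all add: lookup_single when_def)
  moreover have "x \<in> carrier M" using assms N by blast
  ultimately have "act x (sg [w] (1 / co0 x)) = m"
    using assms(3) P by (intro co_eqI) (simp_all add: co_mult lookup_single when_def)
  then have "m \<in> N" using submodule_act[OF assms(1,2), of "sg [w] (1 / co0 x)"] P by simp
  then show ?thesis using submodule_act[OF assms(1)] N cyclic by auto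
qed

text \<open>The path to \<open>t\<close> from the vertex of the first nonzero coordinate of
  \<open>x\<close>, suitably scaled, carries \<open>x\<close> to any prescribed element of
  \<open>Soc\<close>. Hence \<open>Soc\<close> is the only simple submodule.\<close>

lemma Soc_subset:
  assumes "submodule N A M" "N \<noteq> {\<zero>\<^bsub>M\<^esub>}"
  shows "Soc \<subseteq> N"
proof
  fix y assume y: "y \<in> Soc"
  have N: "N \<subseteq> carrier M" "\<zero>\<^bsub>M\<^esub> \<in> N" using assms(1) by (auto simp: submodule_iff_act)
  then obtain x where x: "x \<in> N" "x \<noteq> \<zero>\<^bsub>M\<^esub>" using assms(2) by blast
  have xM: "x \<in> carrier M" using x N by blast
  have *: "y \<in> N" if "p \<in> combs" "co3 (act x p) = co3 y" "co0 (act x p) = 0" "co1 (act x p) = 0" "co2 (act x p) = 0" for p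
  proof -
    have "act x p = y" by (rule co_eqI) (use that y xM in \<open>auto simp: Soc_def\<close>)
    then show ?thesis using submodule_act[OF assms(1) x(1) that(1)] by simp
  qed
  consider "co0 x \<noteq> 0" | "co0 x = 0" "co1 x \<noteq> 0" | "co0 x = 0" "co2 x \<noteq> 0" | "co0 x = 0" "co1 x = 0" "co2 x = 0" "co3 x \<noteq> 0"
    using co_eq_zero[OF xM] x(2) by blast
  then show "y \<in> N"
  proof cases
    case 1 show ?thesis
      by (rule *[of "sg [w, u, t] (co3 y / co0 x)"]) (use 1 P xM in \<open>auto simp: co_mult lookup_single when_def\<close>)
  next
    case 2 show ?thesis
      by (rule *[of "sg [u, t] (co3 y / co1 x)"]) (use 2 P xM in \<open>auto simp: co_mult lookup_single when_def\<close>)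
  next
    case 3 show ?thesis
      by (rule *[of "sg [v, t] (co3 y / co2 x)"]) (use 3 P xM in \<open>auto simp: co_mult lookup_single when_def\<close>)
  next
    case 4 show ?thesis
      by (rule *[of "sg [t] (co3 y / co3 x)"]) (use 4 P xM in \<open>auto simp: co_mult lookup_single when_def\<close>)
  qed
qed

lemma Rad_neq: "Rad \<noteq> carrier M"
  using co_ex[of 1 0 0 0] by (metis (mono_tags, lifting) Rad_def mem_Collect_eq zero_neq_one)

lemma maximal_iff: "maximal_submodule A M N \<longleftrightarrow> N = Rad"
proof -
  have sub: "N \<subseteq> Rad" if "submodule N A M" "N \<noteq> carrier M" for N
    using submodule_full[OF that(1)] that submoduleD(1)[OF that(1)] by (auto simp: Rad_def)
  show ?thesis
    using sub submodule_Rad Rad_neq unfolding maximal_submodule_def by blast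
qed

lemma module_rad_eq: "module_rad A M = Rad"
  unfolding module_rad_def maximal_iff by (auto simp: Rad_def)

lemma simple_iff: "simple_submodule A M N \<longleftrightarrow> N = Soc"
proof -
  have "Soc \<noteq> {\<zero>\<^bsub>M\<^esub>}"
  proof -
    obtain x where "x \<in> Soc" "co3 x = 1" using co_ex[of 0 0 0 1] by (auto simp: Soc_def)
    then show ?thesis using co_zero(4) by auto
  qed
  then show ?thesis using Soc_subset submodule_Soc unfolding simple_submodule_def by blast
qed

lemma module_soc_eq: "module_soc A M = Soc"
  unfolding module_soc_def simple_iff generated_submodule_def using submodule_Soc by auto

lemma top_iso: "module_iso A (quotient_module M Rad) (simple_module w)"
proof (rule quotient_iso[OF submodule_Rad, of co0])
  fix p :: 'k
  show "\<exists>x\<in>carrier M. co0 x = p" using co_ex[of p] by blast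
qed (auto simp: co_add co_mult simple_smult Rad_def a_minus_def co_uminus)

lemma soc_iso: "module_iso A (restrict_module M Soc) (simple_module t)"
proof -
  have s: "Soc \<subseteq> carrier M" by (auto simp: Soc_def)
  have "co3 \<in> module_hom A (restrict_module M Soc) (simple_module t)"
    using s by (auto simp: module_hom_def restrict_module_def co_add simple_smult co_mult Soc_def act_def[symmetric] elim!: carrier_A_E)
  moreover have "bij_betw co3 (carrier (restrict_module M Soc)) (carrier (simple_module t))"
    unfolding bij_betw_def
  proof
    show "inj_on co3 (carrier (restrict_module M Soc))"
      by (rule inj_onI) (auto simp: restrict_module_def Soc_def intro!: co_eqI)
    show "co3 ` carrier (restrict_module M Soc) = carrier (simple_module t)"
    proof -
      have "c \<in> co3 ` Soc" for c
      proof -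
        obtain x where "x \<in> Soc" "co3 x = c" using co_ex[of 0 0 0 c] by (auto simp: Soc_def)
        then show ?thesis by blast
      qed
      then show ?thesis by (auto simp: restrict_module_def)
    qed
  qed
  ultimately show ?thesis unfolding module_iso_def by blast
qed

lemma middle_iso: "module_iso A (quotient_module (restrict_module M Rad) Soc) (module_dsum (simple_module u) (simple_module v))"
proof -
  have sr: "Soc \<subseteq> Rad" by (auto simp: Rad_def Soc_def)
  interpret R: pmod I "restrict_module M Rad" by (rule pmod_restrict[OF submodule_Rad])
  have act: "R.act x f = act x f" for x f unfolding R.act_def act_def by (simp add: restrict_module_def)
  have simps: "carrier (restrict_module M Rad) = Rad" "add (restrict_module M Rad) = add M"
    by (simp_all add: restrict_module_def)
  have um: "\<ominus>\<^bsub>restrict_module M Rad\<^esub> x = \<ominus>\<^bsub>M\<^esub> x" if "x \<in> Rad" for x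
    by (rule R.RM.M.minus_equality)
      (use that submoduleD[OF submodule_Rad] in \<open>auto simp: restrict_module_def Rad_def intro!: RM.M.l_neg\<close>)
  show ?thesis
  proof (rule R.quotient_iso[OF submodule_restrict[OF submodule_Rad submodule_Soc sr], of "\<lambda>x. (co1 x, co2 x)"])
    fix p :: "'k \<times> 'k"
    show "\<exists>x\<in>carrier (restrict_module M Rad). (co1 x, co2 x) = p"
    proof -
      obtain x where "x \<in> Rad" "co1 x = fst p" "co2 x = snd p" using co_ex[of 0 "fst p" "snd p" 0] by (auto simp: Rad_def)
      then show ?thesis by (intro bexI[of _ x]) (simp_all add: simps)
    qed
  qed (auto simp: simps act um module_dsum_def co_add co_mult simple_smult Rad_iff Soc_iff a_minus_def co_uminus)
qed

lemma rhombus_module_axioms: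
  "right_module A M \<and> (\<exists>z u y v. rhombus z u y v \<and> module_soc A M \<subseteq> module_rad A M \<and>
     module_iso A (quotient_module M (module_rad A M)) (simple_module y) \<and>
     module_iso A (restrict_module M (module_soc A M)) (simple_module z) \<and>
     module_iso A (quotient_module (restrict_module M (module_rad A M)) (module_soc A M))
       (module_dsum (simple_module u) (simple_module v)))"
proof -
  have "rhombus w u t v" using gen by (simp add: generator_def)
  \<comment> \<open>In \<open>rhombus_module\<close> the socle vertex is listed first, so the
    rhombus is read from \<open>t\<close>.\<close>
  then have "rhombus t u w v" by (blast intro: rhombus_rotate rhombus_flip)
  moreover have "Soc \<subseteq> Rad" by (auto simp: Rad_def Soc_def)
  ultimately show ?thesis
    using right_module_M top_iso soc_iso middle_iso unfolding module_rad_eq module_soc_eq by blast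
qed

end

section \<open>Adjoining a generator to a submodule\<close>

context pmod
begin

definition extend :: "'m set \<Rightarrow> 'm \<Rightarrow> 'm set" where
  "extend F m = {x \<oplus>\<^bsub>M\<^esub> act m f | x f. x \<in> F \<and> f \<in> combs}"

lemma extend_submodule:
  assumes "submodule F A M" "m \<in> carrier M"
  shows "submodule (extend F m) A M"
proof -
  note F = submoduleD(1-4)[OF assms(1)] submodule_act[OF assms(1)] subsetD[OF submoduleD(1)[OF assms(1)]]
  show ?thesis
    unfolding submodule_iff_act
  proof (intro conjI ballI)
    show "extend F m \<subseteq> carrier M" using F assms(2) by (auto simp: extend_def)
    show "\<zero>\<^bsub>M\<^esub> \<in> extend F m"
      unfolding extend_def using F assms(2) by (intro CollectI exI[of _ "\<zero>\<^bsub>M\<^esub>"] exI[of _ 0]) auto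
  next
    fix x y assume "x \<in> extend F m" "y \<in> extend F m"
    then obtain x' f y' g where e: "x = x' \<oplus>\<^bsub>M\<^esub> act m f" "y = y' \<oplus>\<^bsub>M\<^esub> act m g" "x' \<in> F" "y' \<in> F" "f \<in> combs" "g \<in> combs"
      by (auto simp: extend_def)
    then have "x \<oplus>\<^bsub>M\<^esub> y = (x' \<oplus>\<^bsub>M\<^esub> y') \<oplus>\<^bsub>M\<^esub> act m (f + g)"
      using F assms(2) by (simp add: act_add RM.M.a_ac)
    then show "x \<oplus>\<^bsub>M\<^esub> y \<in> extend F m" unfolding extend_def using e F(3) combs_add by blast
  next
    fix x assume "x \<in> extend F m"
    then obtain x' f where e: "x = x' \<oplus>\<^bsub>M\<^esub> act m f" "x' \<in> F" "f \<in> combs" by (auto simp: extend_def)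
    then have "\<ominus>\<^bsub>M\<^esub> x = (\<ominus>\<^bsub>M\<^esub> x') \<oplus>\<^bsub>M\<^esub> act m (- f)"
      using F assms(2) by (simp add: act_uminus RM.M.minus_add)
    then show "\<ominus>\<^bsub>M\<^esub> x \<in> extend F m" unfolding extend_def using e F(4) combs_uminus by blast
    fix g assume g: "g \<in> (combs :: 'k pathcomb set)"
    have "act x g = act x' g \<oplus>\<^bsub>M\<^esub> act m (path_mult f g)"
      using e F assms(2) g by (simp add: act_add_left act_act)
    then show "act x g \<in> extend F m" unfolding extend_def using e(2,3) F(5) g combs_mult by blast
  qed
qed

lemma extend_base: "submodule F A M \<Longrightarrow> m \<in> carrier M \<Longrightarrow> F \<subseteq> extend F m"
  unfolding extend_def using submoduleD(1)[of F A M] by (force intro: exI[of _ 0])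

lemma extend_act: "submodule F A M \<Longrightarrow> m \<in> carrier M \<Longrightarrow> f \<in> combs \<Longrightarrow> act m f \<in> extend F m"
  unfolding extend_def using submoduleD(2)[of F A M] by (force intro!: exI[of _ "\<zero>\<^bsub>M\<^esub>"])

end

text \<open>Modulo \<open>F\<close>, the coset of \<open>m\<close> is a generator over the zero
  submodule, which is what the coordinates of \<open>cyclic_rhombus\<close> require.\<close>

lemma (in graded_pideal) rhombus_quotient:
  assumes "pmod I M" "submodule F A M" "pmod.generator I M F m w u v t" "pmod.act I M m (sg [w, u, t] 1) \<notin> F"
  shows "cyclic_rhombus I (quotient_module (restrict_module M (pmod.extend I M F m)) F)
     (pmod.coset (restrict_module M (pmod.extend I M F m)) F m) w u v t"
proof -
  interpret pmod I M by fact
  have m: "m \<in> carrier M" using assms(3) by (simp add: generator_def)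
  let ?G = "extend F m"
  have G: "submodule ?G A M" using extend_submodule[OF assms(2) m] .
  have FG: "F \<subseteq> ?G" using extend_base[OF assms(2) m] .
  have sub: "submodule F A (restrict_module M ?G)" using submodule_restrict[OF G assms(2) FG] .
  interpret R: pmod I "restrict_module M ?G" by (rule pmod_restrict[OF G])
  interpret Q: pmod I "quotient_module (restrict_module M ?G) F" by (rule R.pmod_quotient[OF sub])
  have ract: "R.act x f = act x f" for x f unfolding R.act_def act_def by (simp add: restrict_module_def)
  have simps: "carrier (restrict_module M ?G) = ?G" "zero (restrict_module M ?G) = zero M" "add (restrict_module M ?G) = add M"
    by (simp_all add: restrict_module_def)
  have qact: "Q.act (R.coset F x) f = R.coset F (act x f)" if "x \<in> ?G" "f \<in> combs" for x f
    using R.quotient_smult[OF sub, of x f] that by (simp add: Q.act_def ract simps)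
  have mG: "act m f \<in> ?G" if "f \<in> combs" for f using extend_act[OF assms(2) m that] .
  note P = generator_paths[OF assms(3)]
  have "act m (sg [w] 1) = m" using assms(3) by (simp add: generator_def)
  then have m': "m \<in> ?G" using mG[of "sg [w] 1"] P by simp
  have zero: "R.coset F x = \<zero>\<^bsub>quotient_module (restrict_module M ?G) F\<^esub> \<longleftrightarrow> x \<in> F" if "x \<in> ?G" for x
  proof -
    have "x \<ominus>\<^bsub>restrict_module M ?G\<^esub> \<zero>\<^bsub>M\<^esub> = x"
      using R.uminus_zero R.RM.M.r_zero[of x] that by (simp add: a_minus_def simps)
    then show ?thesis
      using R.coset_eq_iff[OF sub, of "\<zero>\<^bsub>M\<^esub>" x] that submoduleD(2)[OF G] R.quotient_zero[OF sub] by (simp add: simps)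
  qed
  show ?thesis
  proof (intro cyclic_rhombus.intro cyclic_rhombus_axioms.intro Q.pmod_axioms graded_pideal_axioms)
    show "Q.generator {\<zero>\<^bsub>quotient_module (restrict_module M ?G) F\<^esub>} (R.coset F m) w u v t"
      unfolding Q.generator_def
      using assms(3)[unfolded generator_def] P
      by (auto simp: qact m' R.quotient_carrier[OF sub] simps zero mG)
    show "carrier (quotient_module (restrict_module M ?G) F) = Q.act (R.coset F m) ` combs"
    proof
      show "carrier (quotient_module (restrict_module M ?G) F) \<subseteq> Q.act (R.coset F m) ` combs"
      proof
        fix X assume "X \<in> carrier (quotient_module (restrict_module M ?G) F)"
        then obtain y where y: "y \<in> ?G" "X = R.coset F y"
          by (auto simp: R.quotient_carrier[OF sub] simps)
        from y(1) obtain x f where "x \<in> F" "f \<in> combs" "y = x \<oplus>\<^bsub>M\<^esub> act m f"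
          unfolding extend_def by blast
        with y(2) have x: "x \<in> F" "f \<in> combs" "X = R.coset F (x \<oplus>\<^bsub>M\<^esub> act m f)" by simp_all
        have xG: "x \<in> ?G" using x FG by blast
        have "X = R.coset F x \<oplus>\<^bsub>quotient_module (restrict_module M ?G) F\<^esub> R.coset F (act m f)"
          using R.quotient_add[OF sub, of x "act m f"] x xG mG by (simp add: simps)
        also have "R.coset F x = \<zero>\<^bsub>quotient_module (restrict_module M ?G) F\<^esub>" using zero[OF xG] x by simp
        also have "\<zero>\<^bsub>quotient_module (restrict_module M ?G) F\<^esub> \<oplus>\<^bsub>quotient_module (restrict_module M ?G) F\<^esub> R.coset F (act m f) = Q.act (R.coset F m) f"
          using x mG m' by (simp add: qact R.quotient_carrier[OF sub] simps)
        finally show "X \<in> Q.act (R.coset F m) ` combs" using x by blast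
      qed
    qed (use mG in \<open>auto simp: qact m' R.quotient_carrier[OF sub] simps\<close>)
    show "Q.act (R.coset F m) (sg [w, u, t] 1) \<noteq> \<zero>\<^bsub>quotient_module (restrict_module M ?G) F\<^esub>"
      using assms(4) P by (simp add: qact m' zero mG)
  qed
qed

section \<open>The Rauzy ideal\<close>

lemma two_sided_idealI:
  assumes "J \<subseteq> combs" "0 \<in> J" "\<And>f g. f \<in> J \<Longrightarrow> g \<in> J \<Longrightarrow> f + g \<in> J" "\<And>f. f \<in> J \<Longrightarrow> - f \<in> J"
    "\<And>f g. f \<in> J \<Longrightarrow> g \<in> combs \<Longrightarrow> path_mult f g \<in> J" "\<And>f g. f \<in> J \<Longrightarrow> g \<in> combs \<Longrightarrow> path_mult g f \<in> J"
  shows "two_sided_ideal J (path_algebra :: 'k::field pathcomb ring)"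
proof -
  interpret G: abelian_group "path_algebra :: 'k pathcomb ring" by (rule abelian_group_path_algebra)
  have "\<ominus>\<^bsub>path_algebra\<^esub> f = - f" if "f \<in> J" for f
    by (rule G.minus_equality) (use assms(1) that in auto)
  then have i: "inv\<^bsub>add_monoid path_algebra\<^esub> f = - f" if "f \<in> J" for f
    using that by (simp add: a_inv_def)
  have "subgroup J (add_monoid path_algebra)"
  proof (intro subgroup.intro)
    fix x assume "x \<in> J"
    then show "inv\<^bsub>add_monoid path_algebra\<^esub> x \<in> J" using assms(4) by (simp only: i)
  qed (use assms in auto)
  then show ?thesis using assms(5,6) by (auto simp: two_sided_ideal_def additive_subgroup_def)
qed

lemma two_sided_ideal_combs: "two_sided_ideal combs path_algebra"
  by (rule two_sided_idealI) auto

lemma generated_ideal_two_sided: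
  assumes "S \<subseteq> combs"
  shows "two_sided_ideal (generated_ideal path_algebra S) path_algebra"
proof (rule two_sided_idealI)
  show "generated_ideal path_algebra S \<subseteq> combs"
    using two_sided_ideal_combs assms unfolding generated_ideal_def by blast
qed (auto simp: generated_ideal_def intro: pideal.I_zero[OF pideal.intro] pideal.I_add[OF pideal.intro]
    pideal.I_uminus[OF pideal.intro] pideal.I_mult[OF pideal.intro])

lemma scale_loop_diff:
  "scale c (loop_diff a z) = (if tedge z (z + pe a) then sg [z, z + pe a, z] c else 0) -
     (if tedge z (z - pe a) then sg [z, z - pe a, z] c else 0)"
  by (rule poly_mapping_eqI) (auto simp: scale_def loop_diff_def loop_def lookup_minus lookup_single when_def map.rep_eq)

lemma is_path_3: "is_path [u, v, w] \<longleftrightarrow> tedge u v \<and> tedge v w"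
  using tedge_tvertex by (auto simp: is_path_Cons)

lemma relationsE:
  assumes "r \<in> relations s"
  obtains u v w where "r = sg [u, v, w] 1" "tedge u v" "tedge v w" "u \<noteq> w" "\<not> (\<exists>t. rhombus u v w t)"
    | z u y v where "r = sg [z, u, y] 1 - sg [z, v, y] 1" "rhombus z u y v"
    | a b z where "r = scale (of_int (s a z)) (loop_diff a z) - scale (of_int (s b z)) (loop_diff b z)" "tvertex z"
  using assms unfolding relations_def by blast

lemma relations_combs: "relations s \<subseteq> combs"
proof
  fix r :: "'k::field pathcomb" assume "r \<in> relations s"
  then consider u v w where "r = sg [u, v, w] 1" "tedge u v" "tedge v w"
    | z u y v where "r = sg [z, u, y] 1 - sg [z, v, y] 1" "rhombus z u y v"
    | a c z where "r = scale (of_int (s a z)) (loop_diff a z) - scale (of_int (s c z)) (loop_diff c z)"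
    unfolding relations_def by blast
  then show "r \<in> combs"
  proof cases
    case 1 then show ?thesis by (simp add: is_path_3)
  next
    case 2 then show ?thesis using rhombus_tedge[OF 2(2)] by (simp add: is_path_3)
  next
    case 3
    have "is_path [z, w, z]" if "tedge z w" for w using that tedge_commute by (simp add: is_path_3)
    then show ?thesis unfolding 3 scale_loop_diff by simp
  qed
qed

lemma rauzy_ideal_two_sided: "two_sided_ideal (rauzy_ideal s) path_algebra"
  unfolding rauzy_ideal_def by (rule generated_ideal_two_sided[OF relations_combs])

lemma relations_rauzy_ideal: "relations s \<subseteq> rauzy_ideal s"
  unfolding rauzy_ideal_def generated_ideal_def by blast

lemma rauzy_ideal_minimal: "two_sided_ideal J path_algebra \<Longrightarrow> relations s \<subseteq> J \<Longrightarrow> rauzy_ideal s \<subseteq> J"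
  unfolding rauzy_ideal_def generated_ideal_def by blast

lemma lookup_combs_Nil: "f \<in> combs \<Longrightarrow> Poly_Mapping.lookup f [] = 0"
  using is_path_nonempty[of "[]"] not_in_keys_iff_lookup_eq_zero[of "[]" f] by (auto simp: combs_def)

text \<open>The relations are homogeneous of degree two, and a coefficient of a product at a trivial
  path or an arrow involves only such coefficients of the factors. The combinations without them
  therefore form a two-sided ideal containing the relations.\<close>

lemma rauzy_ideal_low_degree:
  fixes f :: "'a::field pathcomb"
  assumes "f \<in> rauzy_ideal s" "length p \<le> 2"
  shows "Poly_Mapping.lookup f p = 0"
proof -
  let ?J = "{f \<in> (combs :: 'a pathcomb set). \<forall>a b. Poly_Mapping.lookup f [a] = 0 \<and> Poly_Mapping.lookup f [a, b] = 0}"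
  have "two_sided_ideal ?J path_algebra"
    by (rule two_sided_idealI) (auto simp: lookup_add lookup_path_mult_1 lookup_path_mult_2)
  moreover have "relations s \<subseteq> ?J"
  proof
    fix r :: "'a pathcomb" assume r: "r \<in> relations s"
    have l: "Poly_Mapping.lookup (if P then sg p c else 0) q = (if P \<and> p = q then c else 0)" for P p q and c :: 'a
      by (simp add: lookup_single when_def)
    have "Poly_Mapping.lookup r [a] = 0 \<and> Poly_Mapping.lookup r [a, b] = 0" for a b
      by (rule relationsE[OF r]) (simp_all add: lookup_minus lookup_single when_def scale_loop_diff l)
    then show "r \<in> ?J" using r relations_combs by blast
  qed
  ultimately have f: "f \<in> ?J" using rauzy_ideal_minimal assms(1) by blast
  have "p = [] \<or> (\<exists>a. p = [a]) \<or> (\<exists>a b. p = [a, b])"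
    using assms(2) by (cases p; cases "tl p"; cases "tl (tl p)") auto
  then show ?thesis using f lookup_combs_Nil by auto
qed

lemma graded_pideal_rauzy: "graded_pideal (rauzy_ideal s)"
  by (intro graded_pideal.intro graded_pideal_axioms.intro pideal.intro rauzy_ideal_two_sided rauzy_ideal_low_degree)

section \<open>The trace vanishes on the ideal\<close>

definition trace :: "(3 \<Rightarrow> pt \<Rightarrow> int) \<Rightarrow> pt list \<Rightarrow> 'k::field" where
  "trace s p = (if length p = 5 \<and> p ! 4 = p ! 0 then of_int (trace4 s (p ! 0) (p ! 1) (p ! 2) (p ! 3)) else 0)"

definition tr :: "(3 \<Rightarrow> pt \<Rightarrow> int) \<Rightarrow> 'k::field pathcomb \<Rightarrow> 'k" where
  "tr s = lin_ext (trace s)"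

text \<open>Only contexts \<open>p\<close>, \<open>q\<close> contributing two further steps matter:
  both after, one on each side, or both before. Rotation brings the path of length two to the front.
  The point is that \<open>t\<close> and \<open>e\<close> do not depend on the middle vertex
  \<open>u\<close>, so a linear relation among such paths can be tested on \<open>trace4\<close>
  alone.\<close>

lemma trace_sandwich:
  assumes "sign_choice s" "is_path p" "is_path q"
  shows "\<exists>t (e :: 'k::field). (e = 0 \<or> tedge y t \<and> tedge t x) \<and> (\<forall>u. tedge x u \<longrightarrow> tedge u y \<longrightarrow>
     tr s (path_mult (path_mult (sg p c) (sg [x, u, y] 1)) (sg q d)) = e * of_int (trace4 s x u y t))"
proof -
  have 0: "tr s (path_mult (path_mult (sg p c) (sg [x, u, y] 1)) (sg q d)) =
      (if last p = x \<and> y = hd q then c * d * trace s (p @ [u, y] @ tl q) else 0)" for u :: pt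
    by (auto simp: path_mult_single tr_def)
  let ?trivial = "\<forall>u. (if last p = x \<and> y = hd q then c * d * trace s (p @ [u, y] @ tl q) else 0) = (0 :: 'k)"
  consider ?trivial
    | r v where "p = [x]" "q = [y, v, r]" "r = x"
    | v where "p = [v, x]" "q = [y, v]"
    | r v where "p = [r, v, x]" "q = [y]" "r = y"
  proof (cases "last p = x \<and> y = hd q \<and> length p + length (tl q) = 3")
    case False
    then have ?trivial by (auto simp: trace_def)
    then show thesis using that(1) by blast
  next
    case True
    obtain p0 p' where p: "p = p0 # p'" using is_path_nonempty[OF assms(2)] by (cases p) auto
    obtain q0 q' where q: "q = q0 # q'" using is_path_nonempty[OF assms(3)] by (cases q) auto
    have len: "length p' + length q' = 2" "q0 = y" "last p = x" using True p q by auto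
    show thesis
    proof (cases p')
      case Nil
      then obtain v r where "q' = [v, r]" using len by (cases q'; cases "tl q'"; cases "tl (tl q')") auto
      then show thesis using that(1,2) Nil p q len by (cases "r = x") (auto simp: trace_def nth_append)
    next
      case (Cons p1 p'')
      show thesis
      proof (cases p'')
        case Nil
        then obtain v where v: "q' = [v]" using len Cons by (cases q'; cases "tl q'") auto
        have [simp]: "p1 = x" using Cons Nil p len by simp
        show thesis
        proof (cases "v = p0")
          case True then show thesis using that(3) Cons Nil p q len v by auto
        next
          case False
          then have ?trivial using Cons Nil p q len v by (auto simp: trace_def)
          then show thesis using that(1) by blast
        qed
      next
        case (Cons p2 p''')
        then have [simp]: "p''' = []" "q' = []" "p2 = x" using len \<open>p' = p1 # p''\<close> p by auto
        show thesis
        proof (cases "p0 = y")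
          case True then show thesis using that(4) Cons \<open>p' = p1 # p''\<close> p q len by auto
        next
          case False
          then have ?trivial using Cons \<open>p' = p1 # p''\<close> p q len by (auto simp: trace_def)
          then show thesis using that(1) by blast
        qed
      qed
    qed
  qed
  then show ?thesis
  proof cases
    case 1
    then show ?thesis unfolding 0 by (intro exI[of _ x] exI[of _ 0]) simp
  next
    case (2 r v)
    then have "tedge y v" "tedge v x" using assms(3) by (auto simp: is_path_Cons)
    then show ?thesis unfolding 0 using 2 by (intro exI[of _ v] exI[of _ "c * d"]) (auto simp: trace_def)
  next
    case (3 v)
    then have e: "tedge y v" "tedge v x" using assms(2,3) by (auto simp: is_path_Cons)
    have "trace4 s v x u y = - trace4 s x u y v" if "tedge x u" "tedge u y" for u
      using trace4_rotate[OF assms(1) e(2) that e(1)] by simp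
    then show ?thesis unfolding 0 using 3 e by (intro exI[of _ v] exI[of _ "- c * d"]) (auto simp: trace_def)
  next
    case (4 r v)
    then have e: "tedge y v" "tedge v x" using assms(2) by (auto simp: is_path_Cons)
    have "trace4 s y v x u = trace4 s x u y v" if "tedge x u" "tedge u y" for u
      using trace4_rotate[OF assms(1) e(2) that e(1)] trace4_rotate[OF assms(1) e(1,2) that] by simp
    then show ?thesis unfolding 0 using 4 e by (intro exI[of _ v] exI[of _ "c * d"]) (auto simp: trace_def)
  qed
qed

lemma tr_add: "tr s (f + g) = tr s f + tr s g" and tr_zero [simp]: "tr s 0 = 0" and tr_uminus: "tr s (- f) = - tr s f"
  and tr_diff: "tr s (f - g) = tr s f - tr s g"
  by (simp_all add: tr_def lin_ext_add lin_ext_uminus lin_ext_diff)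

lemma tr_scale: "is_path m \<Longrightarrow> tr s (path_mult (path_mult g (sg m c)) h) = c * tr s (path_mult (path_mult g (sg m 1)) h)"
  if "g \<in> combs" "h \<in> combs"
  using that(1)
proof (induction rule: combs_induct)
  case (single p a)
  show ?case using that(2)
  proof (induction rule: combs_induct)
    case (single q b)
    show ?case by (auto simp: path_mult_single tr_def algebra_simps)
  qed (simp_all add: path_mult_add_right tr_add distrib_left)
qed (simp_all add: path_mult_add_left tr_add distrib_left)

lemma tr_relation:
  assumes "sign_choice s" "r \<in> relations s" "is_path p" "is_path q"
  shows "tr s (path_mult (path_mult (sg p c) r) (sg q d)) = 0"
proof -
  from assms(2) consider u v w where "r = sg [u, v, w] 1" "tedge u v" "tedge v w" "u \<noteq> w" "\<not> (\<exists>t. rhombus u v w t)"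
    | z u y v where "r = sg [z, u, y] 1 - sg [z, v, y] 1" "rhombus z u y v"
    | a b z where "r = scale (of_int (s a z)) (loop_diff a z) - scale (of_int (s b z)) (loop_diff b z)" "tvertex z"
    unfolding relations_def by blast
  then show ?thesis
  proof cases
    case 1
    obtain t e where "tr s (path_mult (path_mult (sg p c) (sg [u, v, w] 1)) (sg q d)) = e * of_int (trace4 s u v w t)"
      using trace_sandwich[OF assms(1,3,4), of w u c d] 1 by blast
    then show ?thesis using trace4_nonrhombus[OF 1(4,5)] 1 by simp
  next
    case 2
    obtain t e where "\<forall>u. tedge z u \<longrightarrow> tedge u y \<longrightarrow>
       tr s (path_mult (path_mult (sg p c) (sg [z, u, y] 1)) (sg q d)) = e * of_int (trace4 s z u y t)"
      using trace_sandwich[OF assms(1,3,4), of y z c d] by blast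
    then show ?thesis using trace4_rhombus[OF assms(1) 2(2), of t] rhombus_tedge[OF 2(2)] 2(1)
      by (simp add: path_mult_diff_left path_mult_diff_right tr_diff)
  next
    case 3
    obtain t e where t: "e = 0 \<or> tedge z t \<and> tedge t z" "\<forall>u. tedge z u \<longrightarrow> tedge u z \<longrightarrow>
       tr s (path_mult (path_mult (sg p c) (sg [z, u, z] 1)) (sg q d)) = e * of_int (trace4 s z u z t)"
      using trace_sandwich[OF assms(1,3,4), of z z c d] by blast
    have v: "tr s (path_mult (path_mult (sg p c) (if tedge z u then sg [z, u, z] k else 0)) (sg q d)) =
      k * (e * of_int (of_bool (tedge z u) * trace4 s z u z t))" for u k
    proof (cases "tedge z u")
      case True
      then have "is_path [z, u, z]" using tedge_commute by (simp add: is_path_3)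
      then show ?thesis using t(2) True tedge_commute[OF True] assms(3,4)
        tr_scale[of "sg p c" "sg q d" "[z, u, z]" s k] by simp
    qed simp
    have w: "tr s (path_mult (path_mult (sg p c) (scale (of_int (s a z)) (loop_diff a z))) (sg q d)) =
       e * of_int (s a z * (of_bool (tedge z (z + pe a)) * trace4 s z (z + pe a) z t - of_bool (tedge z (z - pe a)) * trace4 s z (z - pe a) z t))" for a
      unfolding scale_loop_diff path_mult_diff_left path_mult_diff_right tr_diff v
      by (simp add: algebra_simps)
    show ?thesis
    proof (cases "e = 0")
      case True then show ?thesis unfolding 3(1) path_mult_diff_left path_mult_diff_right tr_diff w by simp
    next
      case False
      then have "tedge z t" using t(1) by blast
      then show ?thesis
        unfolding 3(1) path_mult_diff_left path_mult_diff_right tr_diff w trace4_loops[OF assms(1) \<open>tedge z t\<close>] by simp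
    qed
  qed
qed

lemma vunit_path_mult_single:
  assumes "finite V" "p \<noteq> []"
  shows "path_mult (vunit V) (sg p c) = (if hd p \<in> V then sg p c else 0)"
  using assms(1) unfolding vunit_def
proof (induction V rule: finite_induct)
  case (insert w V)
  then show ?case using assms(2) by (cases p) (auto simp: path_mult_add_left path_mult_single)
qed simp

lemma left_unit_ex:
  assumes "f \<in> combs"
  shows "\<exists>g\<in>combs. path_mult g f = f"
proof -
  have "\<exists>V. finite V \<and> V \<subseteq> {z. tvertex z} \<and> (\<forall>W. finite W \<longrightarrow> V \<subseteq> W \<longrightarrow> path_mult (vunit W) f = f)"
    using assms
  proof (induction rule: combs_induct)
    case (single p c)
    then show ?case
      by (intro exI[of _ "{hd p}"]) (auto simp: vunit_path_mult_single is_path_nonempty hd_tvertex)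
  next
    case (add f g)
    then obtain V V' where "finite V" "V \<subseteq> {z. tvertex z}" "\<forall>W. finite W \<longrightarrow> V \<subseteq> W \<longrightarrow> path_mult (vunit W) f = f"
      "finite V'" "V' \<subseteq> {z. tvertex z}" "\<forall>W. finite W \<longrightarrow> V' \<subseteq> W \<longrightarrow> path_mult (vunit W) g = g" by metis
    then show ?case by (intro exI[of _ "V \<union> V'"]) (auto simp: path_mult_add_right)
  qed auto
  then show ?thesis using vunit_combs by blast
qed

text \<open>The combinations whose trace vanishes in every two-sided context form an ideal that
  contains the relations. Local units on both sides then recover the trace of \<open>f\<close>
  itself.\<close>

lemma tr_rauzy_ideal:
  fixes f :: "'a::field pathcomb"
  assumes "sign_choice s" "f \<in> rauzy_ideal s"
  shows "tr s f = 0"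
proof -
  let ?J = "{f \<in> (combs :: 'a pathcomb set). \<forall>g\<in>combs. \<forall>h\<in>combs. tr s (path_mult (path_mult g f) h) = 0}"
  have "two_sided_ideal ?J path_algebra"
  proof (rule two_sided_idealI)
    fix f k :: "'a pathcomb" assume f: "f \<in> ?J" and k: "k \<in> combs"
    have "path_mult (path_mult g (path_mult f k)) h = path_mult (path_mult g f) (path_mult k h)"
      "path_mult (path_mult g (path_mult k f)) h = path_mult (path_mult (path_mult g k) f) h"
      if "g \<in> combs" "h \<in> combs" for g h using f k that by (simp_all add: path_mult_assoc)
    then show "path_mult f k \<in> ?J" "path_mult k f \<in> ?J" using f k by simp_all
  qed (auto simp: path_mult_add_left path_mult_add_right path_mult_uminus_left path_mult_uminus_right tr_add tr_uminus)
  moreover have "relations s \<subseteq> ?J"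
  proof
    fix r :: "'a pathcomb" assume r: "r \<in> relations s"
    have "tr s (path_mult (path_mult g r) h) = 0" if "g \<in> combs" "h \<in> combs" for g h
      using that(1)
    proof (induction rule: combs_induct)
      case (single p a)
      show ?case using that(2)
        by (induction rule: combs_induct) (use tr_relation[OF assms(1) r single] in \<open>simp_all add: path_mult_add_right tr_add\<close>)
    qed (simp_all add: path_mult_add_left tr_add)
    then show "r \<in> ?J" using r relations_combs by blast
  qed
  ultimately have "f \<in> ?J" using rauzy_ideal_minimal assms(2) by blast
  then have fc: "f \<in> combs" and f: "\<And>g h. g \<in> combs \<Longrightarrow> h \<in> combs \<Longrightarrow> tr s (path_mult (path_mult g f) h) = 0" by auto
  obtain V where V: "finite V" "V \<subseteq> {z. tvertex z}" "\<And>W. finite W \<Longrightarrow> V \<subseteq> W \<Longrightarrow> path_mult f (vunit W) = f"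
    using path_mult_vunit[OF fc] by blast
  obtain g where g: "g \<in> combs" "path_mult g f = f" using left_unit_ex[OF fc] by blast
  then show ?thesis using f[OF g(1) vunit_combs[OF V(2)]] V(3)[OF V(1) order_refl] g(2) by simp
qed

section \<open>Vanishing and equality of paths up to sign\<close>

context pideal
begin

definition nul :: "pt list \<Rightarrow> bool" where
  "nul p \<longleftrightarrow> sg p 1 \<in> I"

text \<open>Equality up to sign: submodules are closed under negation, so the signs produced by the
  third relation need not be followed.\<close>

definition eqp :: "pt list \<Rightarrow> pt list \<Rightarrow> bool" where
  "eqp p q \<longleftrightarrow> sg p 1 - sg q 1 \<in> I \<or> sg p 1 + sg q 1 \<in> I"

lemma eqp_sym: "eqp p q \<Longrightarrow> eqp q p"
  using I_uminus[of "sg p 1 - sg q 1"] by (auto simp: eqp_def add.commute)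

lemma eqp_trans: "eqp p q \<Longrightarrow> eqp q r \<Longrightarrow> eqp p r"
  using I_add[of "sg p 1 - sg q 1" "sg q 1 - sg r 1"] I_add[of "sg p 1 - sg q 1" "sg q 1 + sg r 1"]
    I_diff[of "sg p 1 + sg q 1" "sg q 1 - sg r 1"] I_diff[of "sg p 1 + sg q 1" "sg q 1 + sg r 1"]
  by (auto simp: eqp_def algebra_simps)

lemma eqp_nul: "eqp p q \<Longrightarrow> nul q \<Longrightarrow> nul p"
  using I_add[of "sg p 1 - sg q 1" "sg q 1"] I_diff[of "sg p 1 + sg q 1" "sg q 1"]
  by (auto simp: eqp_def nul_def)

lemma nul_append: "nul p \<Longrightarrow> is_path (last p # b) \<Longrightarrow> nul (p @ b)"
  using I_mult(1)[of "sg p 1" "sg (last p # b) 1"] by (simp add: nul_def path_mult_single)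

lemma nul_prepend: "nul p \<Longrightarrow> p \<noteq> [] \<Longrightarrow> is_path (a @ [hd p]) \<Longrightarrow> nul (a @ p)"
  using I_mult(2)[of "sg p 1" "sg (a @ [hd p]) 1"] by (simp add: nul_def path_mult_single)

lemma eqp_append: "eqp p q \<Longrightarrow> last p = last q \<Longrightarrow> is_path (last q # b) \<Longrightarrow> eqp (p @ b) (q @ b)"
  using I_mult(1)[of "sg p 1 - sg q 1" "sg (last q # b) 1"] I_mult(1)[of "sg p 1 + sg q 1" "sg (last q # b) 1"]
  by (auto simp: eqp_def path_mult_single path_mult_diff_left path_mult_add_left)

lemma eqp_prepend: "eqp p q \<Longrightarrow> p \<noteq> [] \<Longrightarrow> q \<noteq> [] \<Longrightarrow> hd p = hd q \<Longrightarrow> is_path (a @ [hd q]) \<Longrightarrow> eqp (a @ p) (a @ q)"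
  using I_mult(2)[of "sg p 1 - sg q 1" "sg (a @ [hd q]) 1"] I_mult(2)[of "sg p 1 + sg q 1" "sg (a @ [hd q]) 1"]
  by (cases p; cases q) (auto simp: eqp_def path_mult_single path_mult_diff_right path_mult_add_right)

lemma I_sign_cases:
  assumes "f - g \<in> I" "f = h \<or> f = - h" "g = k \<or> g = - k"
  shows "h - k \<in> I \<or> h + k \<in> I"
  using assms I_uminus[of "f - g"] by (elim disjE) (simp_all add: algebra_simps)

end

section \<open>Paths starting at a 6-vertex\<close>

locale star =
  fixes s :: "3 \<Rightarrow> pt \<Rightarrow> int" and z :: pt and I :: "'k::field pathcomb set"
  assumes sc: "sign_choice s" and six: "n_vertex 6 z" and I_eq: "I = rauzy_ideal s"
begin

sublocale graded_pideal I unfolding I_eq by (rule graded_pideal_rauzy)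

text \<open>The neighbours of \<open>z\<close>, and in \<open>Y\<close> the far corners of the six
  rhombi at \<open>z\<close>, both indexed by integers that count modulo 6.\<close>

definition X :: "int \<Rightarrow> pt" where "X i = z + dir i"
definition Y :: "int \<Rightarrow> pt" where "Y i = z + dir i + dir (i + 1)"

lemma X_eq_iff: "X (i + a) = X (i + b) \<longleftrightarrow> 6 dvd a - b"
  by (simp add: X_def dir_inj_iff mod_eq_dvd_iff)

lemma X_eq_iff': "X i = X j \<longleftrightarrow> i mod 6 = j mod 6"
  by (simp add: X_def dir_inj_iff)

lemma dir_offset_eq_iff: "dir (i + a) = dir (i + b) \<longleftrightarrow> 6 dvd a - b"
  by (simp add: dir_inj_iff mod_eq_dvd_iff)

lemma X_periodic: "X (i + 6) = X i" "X (i + 5 + 1) = X i"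
  using X_eq_iff[of i 6 0] by (simp_all add: add.assoc)

lemma rh_z_iff: "rh z (X (i + a)) (X (i + b)) \<longleftrightarrow> 6 dvd b - a - 1 \<or> 6 dvd a - b - 1"
  by (simp add: X_def rh_dir[OF six] mod_eq_dvd_iff algebra_simps)

lemma tedge_z_iff: "tedge z u \<longleftrightarrow> (\<exists>i. u = X i)"
  using neighbours_dir[OF six] by (simp add: X_def)

lemma tedge_zX [simp]: "tedge z (X i)" "tedge (X i) z"
  using tedge_z_iff tedge_commute by blast+

lemma rhombus_star: "rhombus z (X i) (Y i) (X (i + 1))"
proof -
  have "rh z (X (i + 0)) (X (i + 1))" unfolding rh_z_iff by simp
  then obtain y where r: "rhombus z (X i) y (X (i + 1))" by (auto simp: rh_def)
  have "y = Y i" using rhombus_opposite[OF r] by (simp add: X_def Y_def algebra_simps)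
  then show ?thesis using r by simp
qed

lemma rhombus_star': "rhombus z (X i) (Y (i - 1)) (X (i - 1))"
  using rhombus_flip[OF rhombus_star[of "i - 1"]] by simp

lemma tedge_XY [simp]: "tedge (X i) (Y i)" "tedge (Y i) (X i)" "tedge (X (i + 1)) (Y i)" "tedge (Y i) (X (i + 1))"
  "tedge (X i) (Y (i - 1))" "tedge (Y (i - 1)) (X i)" "tedge (X (i - 1)) (Y (i - 1))"  "tedge (Y (i - 1)) (X (i - 1))"
  using rhombus_tedge[OF rhombus_star[of i]] rhombus_tedge[OF rhombus_star'[of i]] by blast+

lemma tvertex_star [simp]: "tvertex z" "tvertex (X i)" "tvertex (Y i)"
  using tedge_tvertex[OF tedge_zX(1)[of i]] tedge_tvertex(1)[OF tedge_XY(2)[of i]] by auto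

lemma dir_inner: "dir i \<bullet> dir j = cos (of_int (i - j) * (pi / 3))"
proof -
  have "dir i \<bullet> dir j = cos ((pi / 6 + of_int i * (pi / 3)) - (pi / 6 + of_int j * (pi / 3)))"
    unfolding dir_polar inner_vec_def cos_diff by (simp add: sum_2)
  then show ?thesis by (simp add: algebra_simps diff_divide_distrib)
qed

text \<open>Squared distances from \<open>z\<close> separate the points: 1 for each
  \<open>X j\<close> and 3 for each \<open>Y i\<close>.\<close>

lemma star_distinct [simp]: "Y i \<noteq> X j" "X j \<noteq> Y i" "Y i \<noteq> z" "z \<noteq> Y i" "X i \<noteq> z" "z \<noteq> X i"
proof -
  have n: "dir j \<bullet> dir j = 1" "(dir i + dir (i + 1)) \<bullet> (dir i + dir (i + 1)) = 3"
    by (simp_all add: inner_add_left inner_add_right dir_inner cos_60)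
  then show "Y i \<noteq> X j" "X j \<noteq> Y i" by (auto simp: X_def Y_def add.assoc)
  show "Y i \<noteq> z" "z \<noteq> Y i" using n(2) by (auto simp: Y_def add.assoc)
  show "X i \<noteq> z" "z \<noteq> X i" using tedge_neq[OF tedge_zX(1)[of i]] by auto
qed

lemma Y_X: "Y i = X i + dir (i + 1)" "Y i = X (i + 1) + dir i" "Y (i - 1) = X i + dir (i - 1)" "z = X i - dir i"
  by (simp_all add: X_def Y_def)

lemma Y_neighbours_distinct [simp]: "Y i \<noteq> Y (i - 1)" "Y (i - 1) \<noteq> Y i" "Y (i + 1) \<noteq> Y i" "Y i \<noteq> Y (i + 1)"
proof -
  have *: "Y i \<noteq> Y (i - 1)" for i
    using dir_offset_eq_iff[of i 1 "-1"] unfolding Y_X(1)[of i] Y_X(3) by simp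
  show "Y i \<noteq> Y (i - 1)" "Y (i - 1) \<noteq> Y i" "Y (i + 1) \<noteq> Y i" "Y i \<noteq> Y (i + 1)"
    using *[of i] *[of "i + 1"] by auto
qed

lemma relation_bad:
  assumes "tedge u v" "tedge v w" "u \<noteq> w" "\<not> rh v u w"
  shows "nul [u, v, w]"
proof -
  have "\<not> (\<exists>t. rhombus u v w t)" using assms(4) rhombus_rh(2) by blast
  then have "sg [u, v, w] 1 \<in> relations s" using assms(1-3) unfolding relations_def by blast
  then have "sg [u, v, w] 1 \<in> I" using relations_rauzy_ideal[of s] unfolding I_eq by blast
  then show ?thesis by (simp add: nul_def)
qed

lemma relation_rhombus_I:
  assumes "rhombus u v w t"
  shows "sg [u, v, w] 1 - sg [u, t, w] 1 \<in> I"
proof -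
  have "sg [u, v, w] 1 - sg [u, t, w] 1 \<in> relations s" using assms unfolding relations_def by blast
  then show ?thesis using relations_rauzy_ideal unfolding I_eq by blast
qed

lemma relation_rhombus: "rhombus u v w t \<Longrightarrow> eqp [u, v, w] [u, t, w]"
  using relation_rhombus_I by (simp add: eqp_def)

lemma rhombus_at_z:
  assumes "rhombus z (X i) w t"
  shows "w = Y i \<and> t = X (i + 1) \<or> w = Y (i - 1) \<and> t = X (i - 1)"
proof -
  obtain j where j: "t = X j" using rhombus_tedge(8)[OF assms] tedge_z_iff by blast
  have "rh z (X i) (X j)" using assms j unfolding rh_def by blast
  then have "j mod 6 = (i + 1) mod 6 \<or> i mod 6 = (j + 1) mod 6" by (simp add: X_def rh_dir[OF six])
  then have "X j = X (i + 1) \<or> X j = X (i - 1)"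
    unfolding X_eq_iff' mod_eq_dvd_iff by (auto simp: dvd_diff_commute algebra_simps)
  then show ?thesis
    using rhombus_opposite[OF assms] j by (auto simp: X_def Y_def algebra_simps)
qed

text \<open>A rhombus with sides from \<open>X i\<close> to \<open>z\<close> and to \<open>w\<close>
  is also a rhombus at \<open>z\<close>, and only two of those contain the edge to
  \<open>X i\<close>.\<close>

lemma arrow_end_zero:
  assumes "tedge (X i) w" "w \<noteq> z" "w \<noteq> Y i" "w \<noteq> Y (i - 1)"
  shows "nul [z, X i, w]"
proof (rule relation_bad)
  show "\<not> rh (X i) z w"
  proof
    assume "rh (X i) z w"
    then obtain t where "rhombus (X i) z t w" unfolding rh_def by blast
    then have "rhombus z (X i) w t" by (rule rhombus_reverse)
    then show False using rhombus_at_z assms by blast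
  qed
qed (use assms in auto)

lemma straight_zero:
  assumes "\<not> 6 dvd b - a" "\<not> 6 dvd b - a - 1" "\<not> 6 dvd a - b - 1"
  shows "nul [X (i + a), z, X (i + b)]"
  using assms by (intro relation_bad) (auto simp: rh_z_iff X_eq_iff dvd_diff_commute)

lemma loop_diff_dir: "loop_diff (axis_of j) p = (if even j then - (loop p (p + dir j) - loop p (p - dir j))
    else loop p (p + dir j) - loop p (p - dir j))"
  by (simp add: loop_diff_def dir_def dsign_def)

text \<open>The third relation for directions instead of axes; the signs of \<open>s\<close> and of
  \<open>dir\<close> are discarded together, which leaves the disjunction.\<close>

lemma relation_loops:
  assumes "tvertex p"
  shows "(loop p (p + dir j) - loop p (p - dir j)) - (loop p (p + dir k) - loop p (p - dir k)) \<in> I \<or>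
    (loop p (p + dir j) - loop p (p - dir j)) + (loop p (p + dir k) - loop p (p - dir k)) \<in> I"
proof -
  let ?L = "\<lambda>j. loop p (p + dir j) - loop p (p - dir j) :: 'k pathcomb"
  have "scale (of_int (s (axis_of j) p)) (loop_diff (axis_of j) p) - scale (of_int (s (axis_of k) p)) (loop_diff (axis_of k) p) \<in> relations s"
    using assms unfolding relations_def by blast
  then have r: "scale (of_int (s (axis_of j) p)) (loop_diff (axis_of j) p) - scale (of_int (s (axis_of k) p)) (loop_diff (axis_of k) p) \<in> I"
    using relations_rauzy_ideal I_eq by blast
  have c: "scale (of_int (s (axis_of j) p)) (loop_diff (axis_of j) p) = ?L j \<or> scale (of_int (s (axis_of j) p)) (loop_diff (axis_of j) p) = - ?L j" for j
  proof -
    have "s (axis_of j) p \<in> {1, - 1}" using sc assms unfolding sign_choice_def by blast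
    moreover have "scale 1 f = f" "scale (- 1) f = - f" for f :: "'k pathcomb"
      by (auto intro!: poly_mapping_eqI simp: scale_def map.rep_eq when_def)
    ultimately show ?thesis unfolding loop_diff_dir by auto
  qed
  show ?thesis by (rule I_sign_cases[OF r c c])
qed

text \<open>Seen from \<open>X i\<close>, the excluded directions \<open>i + 3\<close>,
  \<open>i + 1\<close> and \<open>i - 1\<close> lead to \<open>z\<close>, \<open>Y i\<close> and
  \<open>Y (i - 1)\<close>, the only continuations not killed by
  \<open>arrow_end_zero\<close>.\<close>

lemma arrow_loop:
  assumes "u = X i + dir k" "\<not> 6 dvd k - i - 3" "\<not> 6 dvd k - i - 1" "\<not> 6 dvd k - i + 1"
  shows "path_mult (sg [z, X i] 1) (loop (X i) u) \<in> I"
proof (cases "tedge (X i) u")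
  case True
  have "z = X i + dir (i + 3)" by (simp add: X_def dir_plus_3)
  moreover have "X i + dir k \<noteq> X i + dir (i + 3)" "X i + dir k \<noteq> X i + dir (i + 1)" "X i + dir k \<noteq> X i + dir (i - 1)"
    using assms(2-4) dir_offset_eq_iff[of 0 k "i + 3"] dir_offset_eq_iff[of 0 k "i + 1"] dir_offset_eq_iff[of 0 k "i - 1"]
    by (simp_all add: algebra_simps)
  moreover from this have "u \<noteq> Y (i - 1)" unfolding assms(1) Y_X(3) by blast
  ultimately have "u \<noteq> z" "u \<noteq> Y i" "u \<noteq> Y (i - 1)"
    unfolding assms(1) Y_X(1) by metis+
  then have "nul [z, X i, u]" using True by (intro arrow_end_zero)
  then have "nul [z, X i, u, X i]"
    using nul_append[of "[z, X i, u]" "[X i]"] True tedge_tvertex tedge_commute by (simp add: is_path_Cons)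
  then show ?thesis using True by (simp add: loop_def path_mult_single nul_def)
qed (simp add: loop_def I_zero)

lemma arrow_loop_zero: "path_mult (sg [z, X i] 1) (loop (X i) (X i + dir i)) \<in> I"
  "path_mult (sg [z, X i] 1) (loop (X i) (X i - dir (i + 1))) \<in> I"
  "path_mult (sg [z, X i] 1) (loop (X i) (X i - dir (i - 1))) \<in> I"
proof -
  have "dir (i + 4) = - dir (i + 1)" "dir (i + 2) = - dir (i - 1)"
    using dir_plus_3[of "i + 1"] dir_plus_3[of "i - 1"] by (simp_all add: algebra_simps)
  then show "path_mult (sg [z, X i] 1) (loop (X i) (X i + dir i)) \<in> I"
    "path_mult (sg [z, X i] 1) (loop (X i) (X i - dir (i + 1))) \<in> I"
    "path_mult (sg [z, X i] 1) (loop (X i) (X i - dir (i - 1))) \<in> I"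
    using arrow_loop[of "X i + dir i" i i] arrow_loop[of "X i - dir (i + 1)" i "i + 4"] arrow_loop[of "X i - dir (i - 1)" i "i + 2"]
    by simp_all
qed

lemma arrow_loop_eqp:
  assumes "tedge (X i) u" "tedge (X i) w"
    and "path_mult (sg [z, X i] 1) (loop (X i) u) - path_mult (sg [z, X i] 1) (loop (X i) w) \<in> I \<or>
      path_mult (sg [z, X i] 1) (loop (X i) u) + path_mult (sg [z, X i] 1) (loop (X i) w) \<in> I"
  shows "eqp [z, X i, u, X i] [z, X i, w, X i]"
  using assms by (simp add: loop_def path_mult_single eqp_def)

text \<open>The third relation at \<open>X i\<close> for the axis through \<open>z\<close> and the
  axis through a far corner involves four loops. After multiplication by the arrow from
  \<open>z\<close>, the loops at the two opposite ends vanish, and those through \<open>z\<close>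
  and the far corner agree up to sign.\<close>

lemma loop_turn: "eqp [z, X i, z, X i] [z, X i, Y i, X i]" "eqp [z, X i, z, X i] [z, X i, Y (i - 1), X i]"
proof -
  let ?P = "\<lambda>w. path_mult (sg [z, X i] 1) (loop (X i) w) :: 'k pathcomb"
  have c: "sg [z, X i] 1 \<in> combs" by (simp add: is_path_Cons)
  have *: "?P z - ?P u \<in> I \<or> ?P z + ?P u \<in> I"
    if "?P (X i - dir k) \<in> I" "u = X i + dir k" for k u
  proof -
    have z: "?P (X i - dir i) = ?P z" by (simp flip: Y_X(4))
    from relation_loops[of "X i" i k]
    have "(?P (X i + dir i) - ?P z) - (?P u - ?P (X i - dir k)) \<in> I \<or> (?P (X i + dir i) - ?P z) + (?P u - ?P (X i - dir k)) \<in> I"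
      using I_mult(2)[OF _ c] unfolding z[symmetric] that(2)
      by (metis path_mult_add_right path_mult_diff_right tvertex_star(2))
    then show ?thesis
    proof
      assume "(?P (X i + dir i) - ?P z) - (?P u - ?P (X i - dir k)) \<in> I"
      then have "(?P (X i + dir i) + ?P (X i - dir k)) - ((?P (X i + dir i) - ?P z) - (?P u - ?P (X i - dir k))) \<in> I"
        using arrow_loop_zero(1) that(1) I_add I_diff by blast
      then show ?thesis by (simp add: algebra_simps)
    next
      assume "(?P (X i + dir i) - ?P z) + (?P u - ?P (X i - dir k)) \<in> I"
      then have "(?P (X i + dir i) - ?P (X i - dir k)) - ((?P (X i + dir i) - ?P z) + (?P u - ?P (X i - dir k))) \<in> I"
        using arrow_loop_zero(1) that(1) I_diff by blast
      then show ?thesis by (simp add: algebra_simps)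
    qed
  qed
  show "eqp [z, X i, z, X i] [z, X i, Y i, X i]"
    by (rule arrow_loop_eqp) (use *[OF arrow_loop_zero(2) Y_X(1)] in auto)
  show "eqp [z, X i, z, X i] [z, X i, Y (i - 1), X i]"
    by (rule arrow_loop_eqp) (use *[OF arrow_loop_zero(3) Y_X(3)] in auto)
qed

lemma path_star [simp]: "is_path [z, X i]" "is_path [X i, z]" "is_path [X i, Y i]" "is_path [X i, Y (i - 1)]"
  "is_path [Y i, X i]" "is_path [Y i, X (i + 1)]" "is_path [Y (i - 1), X i]" "is_path [Y (i - 1), X (i - 1)]"
  "is_path [X (i + 1), Y i]"
  by (simp_all add: is_path_Cons)

lemma corner_swap_eqp: "eqp [z, X i, Y i] [z, X (i + 1), Y i]" "eqp [z, X i, Y (i - 1)] [z, X (i - 1), Y (i - 1)]"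
  using relation_rhombus[OF rhombus_star] relation_rhombus[OF rhombus_star'] by blast+

lemma turn_at_z: "eqp [X i, z, X (i + 1)] [X i, Y i, X (i + 1)]" "eqp [X (i + 1), z, X i] [X (i + 1), Y i, X i]"
  using relation_rhombus[OF rhombus_reverse[OF rhombus_star[of i]]]
    relation_rhombus[OF rhombus_reverse[OF rhombus_flip[OF rhombus_star[of i]]]] relation_rhombus
  by (blast intro: rhombus_rotate rhombus_flip rhombus_star)+

lemma star_rhombusE:
  assumes "rhombus z x w y"
  obtains i where "x = X i" "w = Y i" "y = X (i + 1)" | i where "x = X i" "w = Y (i - 1)" "y = X (i - 1)"
  using assms rhombus_tedge(1)[OF assms] tedge_z_iff rhombus_at_z by metis

lemma rhombus_two_sides:
  assumes "rhombus z x w y" "rhombus z x w' y'" "w \<noteq> w'"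
  shows "y + y' = x + z"
proof -
  obtain i where i: "x = X i" using rhombus_tedge(1)[OF assms(1)] tedge_z_iff by blast
  have "y = X (i + 1) \<and> y' = X (i - 1) \<or> y = X (i - 1) \<and> y' = X (i + 1)"
    using assms rhombus_at_z i by blast
  then show ?thesis using dir_sum[of i] i by (auto simp: X_def algebra_simps)
qed

text \<open>If \<open>x, w, a\<close> turns inside a rhombus with fourth corner \<open>t\<close>,
  the path may be rerouted as \<open>z, x, t, a\<close>. It can survive only if \<open>t\<close> is
  the far corner of the other rhombus at the edge from \<open>z\<close> to \<open>x\<close>, and
  then \<open>a\<close> is the reflection of \<open>z\<close> in \<open>x\<close>.\<close>

lemma rhombus_end_side:
  assumes r: "rhombus z x w y" and a: "tedge w a" "a \<noteq> x" "a \<noteq> y"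
  shows "nul [z, x, w, a] \<or> a = x + x - z"
proof (cases "rh w x a")
  case False
  then have "nul [x, w, a]" using a rhombus_tedge(2)[OF r] by (intro relation_bad) auto
  then show ?thesis using nul_prepend[of "[x, w, a]" "[z]"] rhombus_tedge(1)[OF r] tedge_tvertex by (simp add: is_path_Cons)
next
  case True
  then obtain t where "rhombus w x t a" unfolding rh_def by blast
  then have q: "rhombus x w a t" by (rule rhombus_reverse)
  have wa: "w = x + y - z" "a = w + t - x" using rhombus_opposite[OF r] rhombus_opposite[OF q] by simp_all
  have tz: "t \<noteq> z" using wa a(3) by auto
  have p: "is_path [z, x]" "is_path [t, a]"
    using rhombus_tedge(1)[OF r] rhombus_tedge(7)[OF q] tedge_tvertex by (auto simp: is_path_Cons)
  have e: "eqp [z, x, w, a] [z, x, t, a]"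
    using eqp_prepend[OF relation_rhombus[OF q], of "[z]"] p by simp
  show ?thesis
  proof (cases "rh x z t")
    case False
    then have "nul [z, x, t]" using rhombus_tedge(1)[OF r] rhombus_tedge(8)[OF q] tz by (intro relation_bad) auto
    then show ?thesis using nul_append[of "[z, x, t]" "[a]"] p eqp_nul[OF e] by simp
  next
    case True
    then obtain y' where "rhombus x z y' t" unfolding rh_def by blast
    then have r': "rhombus z x t y'" by (rule rhombus_reverse)
    have "y + y' = x + z" using rhombus_two_sides[OF r r'] rhombus_distinct(4)[OF q] by simp
    moreover have "a = x + (y + y') - z - z" unfolding wa rhombus_opposite[OF r'] by simp
    ultimately show ?thesis by simp
  qed
qed

text \<open>The path can also be routed through \<open>y\<close>. Surviving both ways would make
  \<open>a\<close> the reflection of \<open>z\<close> in \<open>x\<close> and in \<open>y\<close> at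
  once.\<close>

lemma rhombus_end_zero:
  assumes r: "rhombus z x w y" and a: "tedge w a" "a \<noteq> x" "a \<noteq> y"
  shows "nul [z, x, w, a]"
proof -
  have "eqp [z, x, w, a] [z, y, w, a]"
    using eqp_append[OF relation_rhombus[OF r], of "[a]"] a(1) tedge_tvertex by (simp add: is_path_Cons)
  moreover have "x + x - z \<noteq> y + y - z"
  proof
    assume "x + x - z = y + y - z"
    then have "2 *\<^sub>R x = 2 *\<^sub>R y" by (simp add: scaleR_2)
    then show False using rhombus_distinct(4)[OF r] by simp
  qed
  ultimately show ?thesis
    using rhombus_end_side[OF r a] rhombus_end_side[OF rhombus_flip[OF r] a(1,3,2)] eqp_nul by metis
qed

text \<open>The turn at \<open>z\<close> is moved to the common far corner, the first arrow is
  exchanged within that rhombus, and \<open>loop_turn\<close> moves the turn back: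
  \<open>z, X (i - 1), z, X i\<close> becomes \<open>z, X (i - 1), Y (i - 1), X i\<close>, then
  \<open>z, X i, Y (i - 1), X i\<close>, then \<open>z, X i, z, X i\<close>.\<close>

lemma socle_turn: "eqp [z, X (i - 1), z, X i] [z, X i, z, X i]" "eqp [z, X (i + 1), z, X i] [z, X i, z, X i]"
proof -
  have a: "eqp [z, X (i - 1), z, X i] [z, X (i - 1), Y (i - 1), X i]"
    using eqp_prepend[OF turn_at_z(1)[of "i - 1"], of "[z]"] by simp
  have b: "eqp [z, X (i - 1), Y (i - 1), X i] [z, X i, Y (i - 1), X i]"
    using eqp_append[OF eqp_sym[OF corner_swap_eqp(2)[of i]], of "[X i]"] by simp
  show "eqp [z, X (i - 1), z, X i] [z, X i, z, X i]"
    using eqp_trans[OF a eqp_trans[OF b eqp_sym[OF loop_turn(2)]]] .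
  have c: "eqp [z, X (i + 1), z, X i] [z, X (i + 1), Y i, X i]"
    using eqp_prepend[OF turn_at_z(2)[of i], of "[z]"] by simp
  have d: "eqp [z, X (i + 1), Y i, X i] [z, X i, Y i, X i]"
    using eqp_append[OF eqp_sym[OF corner_swap_eqp(1)[of i]], of "[X i]"] by simp
  show "eqp [z, X (i + 1), z, X i] [z, X i, z, X i]"
    using eqp_trans[OF c eqp_trans[OF d eqp_sym[OF loop_turn(1)]]] .
qed

text \<open>Only the two far corners next to \<open>x\<close> remain for \<open>w\<close>. If
  \<open>y\<close> is the neighbour of \<open>z\<close> on the side of \<open>w\<close> and
  \<open>y'\<close> the one on the other side of \<open>x\<close>, the path can be rewritten as
  \<open>z, y', z, y, w\<close>; its piece \<open>y', z, y\<close> spans 120 degrees and lies in no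
  single rhombus.\<close>

lemma degree3_zero:
  assumes "tedge z x" "tedge x w" "w \<noteq> z"
  shows "nul [z, x, z, x, w]"
proof -
  obtain i where i: "x = X i" using assms(1) tedge_z_iff by blast
  show ?thesis
  proof (cases "rh x z w")
    case False
    then have "nul [z, x, w]" using assms by (intro relation_bad) auto
    then show ?thesis using nul_prepend[of "[z, x, w]" "[z, x]"] i by (simp add: is_path_Cons)
  next
    case True
    then obtain y where "rhombus x z y w" unfolding rh_def by blast
    then have r: "rhombus z x w y" by (rule rhombus_reverse)
    have "\<exists>y'. nul [y', z, y] \<and> tedge z y' \<and> tedge y' z \<and> eqp [z, y', z, x] [z, x, z, x]"
      using rhombus_at_z[of i w y] r i straight_zero[of 1 "- 1" i] straight_zero[of "- 1" 1 i] socle_turn[of i]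
      by (auto intro: exI[of _ "X (i - 1)"] exI[of _ "X (i + 1)"])
    then obtain y' where y': "nul [y', z, y]" "tedge z y'" "tedge y' z" "eqp [z, y', z, x] [z, x, z, x]" by blast
    have p: "is_path [x, w]" "is_path [y, w]" "is_path [z, y', z]" "is_path [z, y']"
      using assms(2) rhombus_tedge(7)[OF r] y'(2,3) tedge_tvertex by (auto simp: is_path_Cons)
    have a: "eqp [z, x, z, x, w] [z, y', z, x, w]"
      using eqp_append[OF eqp_sym[OF y'(4)], of "[w]"] p by simp
    have b: "eqp [z, y', z, x, w] [z, y', z, y, w]"
      using eqp_prepend[OF relation_rhombus[OF r], of "[z, y']"] p by simp
    have "nul [z, y', z, y]" using nul_prepend[OF y'(1), of "[z]"] p by simp
    then have "nul [z, y', z, y, w]" using nul_append[of "[z, y', z, y]" "[w]"] p by simp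
    then show ?thesis using eqp_nul[OF eqp_trans[OF a b]] by simp
  qed
qed

text \<open>Going around the rhombus at \<open>Y i\<close> connects consecutive neighbours, so the
  six closed paths of this form agree up to sign.\<close>

lemma degree4_eqp: "eqp [z, X i, z, X i, z] [z, X (i + 1), z, X (i + 1), z]"
proof -
  have a: "eqp [z, X (i + 1), z, X (i + 1), z] [z, X i, z, X (i + 1), z]"
    using eqp_append[OF eqp_sym[OF socle_turn(1)[of "i + 1"]], of "[z]"] by simp
  have b: "eqp [z, X i, z, X (i + 1), z] [z, X i, Y i, X (i + 1), z]"
    using eqp_append[OF eqp_prepend[OF turn_at_z(1)[of i], of "[z]"], of "[z]"] by simp
  have "eqp [Y i, X (i + 1), z] [Y i, X i, z]"
    by (rule relation_rhombus) (use rhombus_star[of i] in \<open>blast intro: rhombus_rotate rhombus_flip\<close>)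
  then have c: "eqp [z, X i, Y i, X (i + 1), z] [z, X i, Y i, X i, z]"
    using eqp_prepend[of "[Y i, X (i + 1), z]" "[Y i, X i, z]" "[z, X i]"] by (simp add: is_path_Cons)
  have d: "eqp [z, X i, Y i, X i, z] [z, X i, z, X i, z]"
    using eqp_append[OF eqp_sym[OF loop_turn(1)[of i]], of "[z]"] by simp
  show ?thesis using eqp_sym[OF eqp_trans[OF a eqp_trans[OF b eqp_trans[OF c d]]]] .
qed

text \<open>Stated without indices so that the rhombi on either side of an edge at \<open>z\<close>
  are treated alike in \<open>generator_side\<close>.\<close>

lemma rhombus_turns:
  assumes "rhombus z x w y"
  shows "eqp [z, x, z, x] [z, x, w, x]" "eqp [z, y, z, x] [z, x, z, x]" "eqp [z, x, z, x, z] [z, y, z, y, z]"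
  using assms loop_turn socle_turn degree4_eqp eqp_sym[OF degree4_eqp[of "i - 1" for i]]
  by (cases rule: star_rhombusE; fastforce)+

text \<open>By \<open>degree4_eqp\<close> the index \<open>i\<close> may be replaced by
  \<open>i + 3\<close>. One of the two is neither equal nor adjacent to \<open>j\<close>, so the
  last two steps then vanish by the first relation.\<close>

lemma degree5_zero: "nul [z, X i, z, X i, z, X j]"
proof -
  have far: "nul [z, X (i + k), z, X (i + k), z, X j]" if "\<not> 6 dvd j - (i + k)" "\<not> 6 dvd j - (i + k) - 1" "\<not> 6 dvd (i + k) - j - 1" for k
    using straight_zero[of j "i + k" 0] that nul_prepend[of "[X (i + k), z, X j]" "[z, X (i + k), z]"] by (simp add: is_path_Cons)
  have e: "eqp [z, X i, z, X i, z, X j] [z, X (i + 3), z, X (i + 3), z, X j]"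
    using eqp_append[OF eqp_trans[OF degree4_eqp[of i] eqp_trans[OF degree4_eqp[of "i + 1"] degree4_eqp[of "i + 1 + 1"]]], of "[X j]"]
    by (simp add: add.assoc)
  show ?thesis
  proof (cases "\<not> 6 dvd j - i \<and> \<not> 6 dvd j - i - 1 \<and> \<not> 6 dvd i - j - 1")
    case True
    then show ?thesis using far[of 0] by simp
  next
    case False
    then obtain q where "j - i = 6 * q \<or> j - i - 1 = 6 * q \<or> i - j - 1 = 6 * q" by (auto elim!: dvdE)
    then have "\<not> 6 dvd j - (i + 3)" "\<not> 6 dvd j - (i + 3) - 1" "\<not> 6 dvd (i + 3) - j - 1" by presburger+
    then show ?thesis using far[of 3] eqp_nul[OF e] by blast
  qed
qed

lemma not_nul: "tr s (sg p 1 :: 'k pathcomb) \<noteq> 0 \<Longrightarrow> \<not> nul p"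
  using tr_rauzy_ideal[OF sc, of "sg p 1 :: 'k pathcomb"] by (auto simp: nul_def simp flip: I_eq)

text \<open>A value 1 or -1 stays nonzero in a field of any characteristic.\<close>

lemma pairing_unit:
  assumes "rh x u v"
  shows "pairing s x u v = 1 \<or> pairing s x u v = - 1"
proof -
  obtain y where r: "rhombus x u y v" using assms by (auto simp: rh_def)
  have "edge_sign s x u * edge_sign s x u = 1" "edge_sign s x v * edge_sign s x v = 1"
    using edge_sign_square[OF sc] rh_tedge[OF assms] by blast+
  then have "(edge_sign s x u = 1 \<or> edge_sign s x u = - 1) \<and> (edge_sign s x v = 1 \<or> edge_sign s x v = - 1)"
    by (simp add: square_eq_1_iff)
  then show ?thesis using assms rhombus_distinct(4)[OF r] by (auto simp: pairing_def)
qed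

lemma not_nul_loop:
  assumes "rh x u v"
  shows "\<not> nul [x, u, x, v, x]" "\<not> nul [u, x, v, x, u]"
proof -
  obtain y where r: "rhombus x u y v" using assms by (auto simp: rh_def)
  note p = pairing_unit[OF assms]
  show "\<not> nul [x, u, x, v, x]"
    by (rule not_nul) (use p in \<open>auto simp: tr_def trace_def trace4_def\<close>)
  have "trace4 s u x v x = - pairing s x u v" using rhombus_distinct(4)[OF r] by (simp add: trace4_def)
  then show "\<not> nul [u, x, v, x, u]"
    by (intro not_nul) (use p in \<open>auto simp: tr_def trace_def\<close>)
qed

lemma rh_star: "rh z (X i) (X (i + 1))" "rh z (X (i + 1)) (X i)" "rh (X i) z (Y i)"
  using rhombus_rh[OF rhombus_star[of i]] rh_commute by blast+

end

context pmod
begin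

text \<open>Tracks composition factors: modulo \<open>F\<close>, the submodule generated by
  \<open>m\<close> lives on the four corners, so a vertex outside the rhombus and absent from
  \<open>F\<close> remains absent. Applying its trivial path once leads into \<open>F\<close>, and a
  second time to zero.\<close>

lemma extend_kill:
  assumes "submodule F A M" "generator F m w u v t" "r \<notin> {w, u, v, t}" "tvertex r"
    "\<And>y. y \<in> F \<Longrightarrow> act y (sg [r] 1) = \<zero>\<^bsub>M\<^esub>" "x \<in> extend F m"
  shows "act x (sg [r] 1) = \<zero>\<^bsub>M\<^esub>"
proof -
  have m: "m \<in> carrier M" using assms(2) by (simp add: generator_def)
  have F: "F \<subseteq> carrier M" using assms(1) by (simp add: submodule_iff_act)
  have r: "sg [r] (1 :: 'k) \<in> combs" using assms(4) by simp
  obtain y f where x: "x = y \<oplus>\<^bsub>M\<^esub> act m f" "y \<in> F" "f \<in> combs" using assms(6) by (auto simp: extend_def)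
  let ?h = "path_mult f (sg [r] 1)"
  have l: "Poly_Mapping.lookup (sg [r] (1 :: 'k)) [a] = of_bool (a = r)" "Poly_Mapping.lookup (sg [r] (1 :: 'k)) [a, b] = 0"
    "Poly_Mapping.lookup (sg [r] (1 :: 'k)) [a, b, c] = 0" for a b c
    by (auto simp: lookup_single when_def)
  have "nform w u v t ?h = 0"
    using assms(3) x(3) r by (auto simp: nform_def lookup_path_mult_1 lookup_path_mult_2 lookup_path_mult_3 l)
  then have "act m ?h \<ominus>\<^bsub>M\<^esub> \<zero>\<^bsub>M\<^esub> \<in> F"
    using generator_reduce[OF assms(1,2), of ?h] x(3) r m by simp
  then have d: "act m ?h \<in> F" using m x(3) r by (simp add: a_minus_def)
  have "act (act m ?h) (sg [r] 1) = act m ?h"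
    using m x(3) r by (simp add: act_act path_mult_assoc path_mult_single)
  then have "act m ?h = \<zero>\<^bsub>M\<^esub>" using assms(5)[OF d] by simp
  then show ?thesis using x F m r assms(5)[OF x(2)] by (auto simp: act_add_left act_act)
qed

lemma restrict_restrict: "restrict_module (restrict_module M G) H = restrict_module M H"
  by (simp add: restrict_module_def)

end

lemma (in graded_pideal) rhombus_filtration_3:
  fixes M :: "('a pathcomb set, 'm) module"
  assumes "I = rauzy_ideal s" "pmod I M"
    and F0: "F0 = {\<zero>\<^bsub>M\<^esub>}" and F1: "F1 = pmod.extend I M F0 m1" and F2: "F2 = pmod.extend I M F1 m2" and F3: "F3 = pmod.extend I M F2 m3"
    and g: "pmod.generator I M F0 m1 w1 u1 b1 t1" "pmod.generator I M F1 m2 w2 u2 b2 t2" "pmod.generator I M F2 m3 w3 u3 b3 t3"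
    and n: "pmod.act I M m1 (sg [w1, u1, t1] 1) \<notin> F0" "pmod.act I M m2 (sg [w2, u2, t2] 1) \<notin> F1" "pmod.act I M m3 (sg [w3, u3, t3] 1) \<notin> F2"
  shows "rhombus_filtration s (restrict_module M F3) 3"
proof -
  interpret pmod I M by fact
  have m: "m1 \<in> carrier M" "m2 \<in> carrier M" "m3 \<in> carrier M" using g by (auto simp: generator_def)
  have s0: "submodule F0 A M" unfolding F0 by (rule zero_submodule)
  have s1: "submodule F1 A M" unfolding F1 by (rule extend_submodule[OF s0 m(1)])
  have s2: "submodule F2 A M" unfolding F2 by (rule extend_submodule[OF s1 m(2)])
  have s3: "submodule F3 A M" unfolding F3 by (rule extend_submodule[OF s2 m(3)])
  have i: "F0 \<subseteq> F1" "F1 \<subseteq> F2" "F2 \<subseteq> F3"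
    unfolding F1 F2 F3 using extend_base s0 s1 s2 m unfolding F1 F2 by blast+
  have rm: "rhombus_module s (quotient_module (restrict_module M (extend F m)) F)"
    if "submodule F A M" "generator F m w u v t" "act m (sg [w, u, t] 1) \<notin> F" for F m w u v t
    using cyclic_rhombus.rhombus_module_axioms[OF rhombus_quotient[OF assms(2) that]]
    unfolding rhombus_module_def Let_def rauzy_algebra_def assms(1)[symmetric] by blast
  have q: "rhombus_module s (quotient_module (restrict_module M F1) F0)" "rhombus_module s (quotient_module (restrict_module M F2) F1)"
    "rhombus_module s (quotient_module (restrict_module M F3) F2)"
    using rm[OF s0 g(1) n(1)] rm[OF s1 g(2) n(2)] rm[OF s2 g(3) n(3)] unfolding F1[symmetric] F2[symmetric] F3[symmetric] by blast+
  define F where "F j = (if j = 0 then F0 else if j = 1 then F1 else if j = 2 then F2 else F3)" for j :: nat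
  have F: "F 0 = F0" "F (Suc 0) = F1" "F 2 = F2" "F 3 = F3" "F (Suc 2) = F3" "F (Suc (Suc 0)) = F2" "F (Suc (Suc (Suc 0))) = F3"
    by (simp_all add: F_def)
  have sub: "submodule (F j) (rauzy_algebra s) (restrict_module M F3)" for j
    unfolding rauzy_algebra_def assms(1)[symmetric]
    using submodule_restrict[OF s3] s0 s1 s2 s3 i by (auto simp: F_def)
  have less3: "j = 0 \<or> j = Suc 0 \<or> j = 2" if "j < 3" for j :: nat using that by linarith
  show ?thesis
    unfolding rhombus_filtration_def restrict_restrict
  proof (intro exI[of _ F] conjI allI impI)
    show "F 0 = {\<zero>\<^bsub>restrict_module M F3\<^esub>}" by (simp add: F F0 restrict_module_def)
    show "F 3 = carrier (restrict_module M F3)" by (simp add: F restrict_module_def)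
    fix j :: nat assume "j < 3"
    then show "F j \<subseteq> F (Suc j)" using less3[of j] i by (auto simp: F)
    show "rhombus_module s (quotient_module (restrict_module M (F (Suc j))) (F j))"
      using less3[OF \<open>j < 3\<close>] q by (auto simp: F)
  qed (rule sub)
qed

text \<open>The map \<open>\<gamma>\<close> is either the projection to \<open>A\<close> or left multiplication by \<open>(b\<^sub>4', b\<^sub>5')\<close>,
  where the dash denotes the opposite arrow.\<close>

locale gmod = star s z I + pmod I M
  for s :: "3 \<Rightarrow> pt \<Rightarrow> int" and z :: pt and I :: "'k::field pathcomb set" and M :: "('k pathcomb set, 'm) module" +
  fixes \<gamma> :: "'k pathcomb \<Rightarrow> 'm"
  assumes \<gamma>_carrier [simp]: "f \<in> combs \<Longrightarrow> \<gamma> f \<in> carrier M"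
    and \<gamma>_add: "f \<in> combs \<Longrightarrow> g \<in> combs \<Longrightarrow> \<gamma> (f + g) = \<gamma> f \<oplus>\<^bsub>M\<^esub> \<gamma> g"
    and act_\<gamma>: "f \<in> combs \<Longrightarrow> g \<in> combs \<Longrightarrow> act (\<gamma> f) g = \<gamma> (path_mult f g)"
    and \<gamma>_I: "f \<in> I \<Longrightarrow> \<gamma> f = \<zero>\<^bsub>M\<^esub>"
begin

abbreviation gp :: "pt list \<Rightarrow> 'm" where "gp p \<equiv> \<gamma> (sg p 1)"

lemma \<gamma>_uminus: "f \<in> combs \<Longrightarrow> \<gamma> (- f) = \<ominus>\<^bsub>M\<^esub> \<gamma> f"
  using \<gamma>_add[of "- f" f] \<gamma>_I[OF I_zero] by (intro RM.M.minus_equality[symmetric]) auto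

lemma \<gamma>_diff: "f \<in> combs \<Longrightarrow> g \<in> combs \<Longrightarrow> \<gamma> (f - g) = \<gamma> f \<ominus>\<^bsub>M\<^esub> \<gamma> g"
  using \<gamma>_add[of f "- g"] by (simp add: \<gamma>_uminus a_minus_def)

lemma gp_nul: "submodule F A M \<Longrightarrow> nul p \<Longrightarrow> gp p \<in> F"
  by (simp add: nul_def \<gamma>_I submodule_iff_act)

lemma gp_eqp:
  assumes "submodule F A M" "eqp p q" "is_path p" "is_path q" "gp q \<in> F"
  shows "gp p \<in> F"
  using assms(2) unfolding eqp_def
proof
  assume "sg p 1 - sg q 1 \<in> I"
  then have "gp p \<ominus>\<^bsub>M\<^esub> gp q = \<zero>\<^bsub>M\<^esub>" using \<gamma>_I \<gamma>_diff assms(3,4) by (metis combs_single)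
  then have "gp p = gp q" using minus_eq_zeroD[of "gp p" "gp q"] assms(3,4) by simp
  then show ?thesis using assms(5) by simp
next
  assume "sg p 1 + sg q 1 \<in> I"
  then have "gp p \<oplus>\<^bsub>M\<^esub> gp q = \<zero>\<^bsub>M\<^esub>" using \<gamma>_I \<gamma>_add assms(3,4) by (metis combs_single)
  then have "\<ominus>\<^bsub>M\<^esub> gp q = gp p" using assms(3,4) by (intro RM.M.minus_equality) auto
  then show ?thesis using assms(1,5) by (metis submodule_iff_act)
qed

lemma gp_append: "is_path p \<Longrightarrow> is_path (last p # q) \<Longrightarrow> act (gp p) (sg (last p # q) 1) = gp (p @ q)"
  by (simp add: act_\<gamma> path_mult_single)

lemma gp_extend: "submodule F A M \<Longrightarrow> gp p \<in> F \<Longrightarrow> is_path p \<Longrightarrow> is_path (last p # q) \<Longrightarrow> gp (p @ q) \<in> F"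
  using gp_append[of p q] submodule_act[of F "gp p" "sg (last p # q) 1"] by simp

text \<open>Every path that leaves the rhombus has a shortest initial segment that does, and the
  submodule absorbs the rest. The segments that cross through \<open>v\<close> reduce to those
  through \<open>u\<close>.\<close>

lemma generatorI:
  assumes F: "submodule F A M" and p: "is_path p" "last p = w" and r: "rhombus w u t v"
    and 1: "\<And>a. tedge w a \<Longrightarrow> a \<noteq> u \<Longrightarrow> a \<noteq> v \<Longrightarrow> gp (p @ [a]) \<in> F"
    and 2: "\<And>a. tedge u a \<Longrightarrow> a \<noteq> t \<Longrightarrow> gp (p @ [u, a]) \<in> F"
    and 3: "\<And>a. tedge v a \<Longrightarrow> a \<noteq> t \<Longrightarrow> gp (p @ [v, a]) \<in> F"
    and 4: "\<And>a. tedge t a \<Longrightarrow> gp (p @ [u, t, a]) \<in> F"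
  shows "generator F (gp p) w u v t"
proof -
  have e: "tedge w u" "tedge u t" "tedge w v" "tedge v t" using rhombus_tedge[OF r] by blast+
  then have tv: "tvertex w" "tvertex u" "tvertex v" "tvertex t" using tedge_tvertex by blast+
  have a: "act (gp p) (sg (w # q) c) = \<gamma> (sg (p @ q) c)" if "is_path (w # q)" for q c
    using that p by (simp add: act_\<gamma> path_mult_single)
  have pp: "is_path (p @ q)" if "is_path (w # q)" for q using is_path_join[OF p(1) that] p(2) by simp
  have pn: "p \<noteq> []" using is_path_nonempty[OF p(1)] .
  have opp: "act (gp p) (sg [w, u, t] 1) = act (gp p) (sg [w, v, t] 1)"
    by (rule act_cong) (rule relation_rhombus_I[OF r])
  have ext: "gp (p @ q @ q') \<in> F" if "gp (p @ q) \<in> F" "is_path (w # q @ q')" "q \<noteq> []" for q q'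
  proof -
    have "is_path (w # q) \<and> is_path (last q # q')"
      using that(2,3) by (auto simp: is_path_def successively_append_iff successively_Cons)
    then show ?thesis using gp_extend[OF F that(1), of q'] pp that(3) by simp
  qed
  have 5: "gp (p @ [v, t, a]) \<in> F" if "tedge t a" for a
  proof -
    have pa: "is_path [w, u, t, a]" "is_path [w, v, t, a]" using e that tedge_tvertex by (auto simp: is_path_Cons)
    have bp: "butlast p @ [w] = p" using p pn by auto
    have "eqp [w, v, t] [w, u, t]" by (rule eqp_sym[OF relation_rhombus[OF r]])
    then have "eqp (butlast p @ [w, v, t]) (butlast p @ [w, u, t])"
      using p bp by (intro eqp_prepend) simp_all
    then have "eqp ((butlast p @ [w, v, t]) @ [a]) ((butlast p @ [w, u, t]) @ [a])"
      using pa by (intro eqp_append) (simp_all add: is_path_Cons)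
    moreover have "(butlast p @ [w, v, t]) @ [a] = p @ [v, t, a]" "(butlast p @ [w, u, t]) @ [a] = p @ [u, t, a]"
      using bp by (metis append.assoc append_Cons append_Nil)+
    ultimately have "eqp (p @ [v, t, a]) (p @ [u, t, a])" by (simp only:)
    then show ?thesis by (rule gp_eqp[OF F _ _ _ 4[OF that]]) (use pp pa in simp_all)
  qed
  have "act (gp p) (sg q 1) \<in> F" if q: "is_path q" "hd q = w" "q \<notin> {[w], [w, u], [w, v], [w, u, t], [w, v, t]}" for q
  proof -
    obtain q1 where q1: "q = w # q1" using q(2) is_path_nonempty[OF q(1)] by (cases q) auto
    obtain b q2 where q2: "q1 = b # q2" using q(3) q1 by (cases q1) auto
    have "gp (p @ q1) \<in> F"
    proof (cases "b = u \<or> b = v")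
      case False
      then show ?thesis using 1[of b] ext[of "[b]" q2] q(1) q1 q2 by (simp add: is_path_Cons)
    next
      case True
      obtain c q3 where q3: "q2 = c # q3" using True q(3) q1 q2 by (cases q2) auto
      show ?thesis
      proof (cases "c = t")
        case False
        then show ?thesis using True 2[of c] 3[of c] ext[of "[b, c]" q3] q(1) q1 q2 q3 by (auto simp: is_path_Cons)
      next
        case c: True
        obtain d q4 where q4: "q3 = d # q4" using True c q(3) q1 q2 q3 by (cases q3) auto
        then show ?thesis using True c 4[of d] 5[of d] ext[of "[b, t, d]" q4] q(1) q1 q2 q3 by (auto simp: is_path_Cons)
      qed
    qed
    then show ?thesis using a q(1) q1 by simp
  qed
  moreover have "act (gp p) (sg [w] 1) = gp p" using a[of "[]" 1] tv by simp
  ultimately show ?thesis unfolding generator_def using p r opp by simp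
qed

text \<open>The edge from \<open>z\<close> to \<open>x\<close> borders two rhombi. Once the path to
  the far corner \<open>w'\<close> of one of them lies in \<open>F\<close>, the arrow generates a
  rhombus module on the other.\<close>

lemma generator_side:
  assumes F: "submodule F A M" and r: "rhombus z x w y" and r': "rhombus z x w' y'" "w \<noteq> w'" and h: "gp [z, x, w'] \<in> F"
  shows "generator F (gp [z, x]) x z w y"
proof (rule generatorI[OF F])
  note T = rhombus_tedge[OF r] rhombus_tedge[OF r'(1)]
  then have V: "tvertex x" "tvertex y" "tvertex y'" "tvertex w" "tvertex w'" using tedge_tvertex by blast+
  show "rhombus x z y w" using rhombus_reverse[OF r] .
  show "is_path [z, x]" using T V by (simp add: is_path_Cons)
  have hX: "gp [z, x, w', b] \<in> F" if "tedge w' b" "tvertex b" for b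
    using gp_extend[OF F h, of "[b]"] that T V by (simp add: is_path_Cons)
  \<comment> \<open>The turn back at \<open>z\<close> agrees up to sign with the turn at
    \<open>w'\<close>, which is already absorbed.\<close>
  have turn: "gp [z, x, z, x] \<in> F"
    using gp_eqp[OF F rhombus_turns(1)[OF r'(1)]] hX[of x] T V by (simp add: is_path_Cons)
  have sides: "b = w \<and> a = y \<or> b = w' \<and> a = y'" if "rhombus z x b a" for a b
  proof -
    obtain i where i: "x = X i" using T(1) tedge_z_iff by blast
    show ?thesis using rhombus_at_z[of i] that r r' i by blast
  qed
  have bad: "nul [z, x, a]" if "tedge x a" "a \<noteq> z" "a \<noteq> w" "a \<noteq> w'" for a
  proof (rule relation_bad)
    show "\<not> rh x z a"
      using that sides rhombus_reverse unfolding rh_def by blast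
  qed (use that T in auto)
  show "gp ([z, x] @ [a]) \<in> F" if "tedge x a" "a \<noteq> z" "a \<noteq> w" for a
    using that h gp_nul[OF F bad[of a]] by (cases "a = w'") auto
  show "gp ([z, x] @ [z, a]) \<in> F" if a: "tedge z a" "a \<noteq> y" for a
  proof -
    consider "a = x" | "a = y'" | "\<not> rh z x a" "a \<noteq> x" using sides a unfolding rh_def by blast
    then show ?thesis
    proof cases
      case 1 then show ?thesis using turn by simp
    next
      case 2
      have "eqp [z, x, z, y'] [z, x, w', y']"
        using eqp_prepend[OF relation_rhombus[OF rhombus_reverse[OF r'(1)]], of "[z]"] T V by (simp add: is_path_Cons)
      then show ?thesis using gp_eqp[OF F _ _ _ hX[of y']] 2 T V by (simp add: is_path_Cons)
    next
      case 3
      then have "nul [x, z, a]" using a T by (intro relation_bad) auto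
      then have "nul [z, x, z, a]" using nul_prepend[of "[x, z, a]" "[z]"] T V by (simp add: is_path_Cons)
      then show ?thesis using gp_nul[OF F] by simp
    qed
  qed
  show "gp ([z, x] @ [w, a]) \<in> F" if a: "tedge w a" "a \<noteq> y" for a
  proof (cases "a = x")
    case True
    then show ?thesis using gp_eqp[OF F eqp_sym[OF rhombus_turns(1)[OF r]] _ _ turn] T V by (simp add: is_path_Cons)
  next
    case False
    then show ?thesis using gp_nul[OF F] rhombus_end_zero[OF r a(1)] a by simp
  qed
  show "gp ([z, x] @ [z, y, a]) \<in> F" if a: "tedge y a" for a
  proof -
    have pa: "is_path [y, a]" "tvertex a" using a tedge_tvertex by (auto simp: is_path_Cons)
    have e: "eqp [z, x, z, y, a] [z, y, z, y, a]"
      using eqp_append[OF rhombus_turns(2)[OF rhombus_flip[OF r]], of "[a]"] pa by simp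
    show ?thesis
    proof (cases "a = z")
      case True
      have "gp [z, x, z, x, z] \<in> F" using gp_extend[OF F turn, of "[z]"] T V by (simp add: is_path_Cons)
      then show ?thesis
        using gp_eqp[OF F eqp_trans[OF e]] eqp_sym[OF rhombus_turns(3)[OF r]] True T V by (simp add: is_path_Cons)
    next
      case False
      then show ?thesis using gp_nul[OF F eqp_nul[OF e degree3_zero[OF _ a]]] T by simp
    qed
  qed
qed simp

text \<open>The exits vanish in A itself: a turn at the far corner is equivalent to one at
  \<open>z\<close>, after which \<open>degree3_zero\<close> and \<open>degree5_zero\<close> apply.
  The path across is the one back to \<open>z\<close>.\<close>

lemma generator_corner:
  assumes F: "submodule F A M"
  shows "generator F (gp [z, X i, Y i]) (Y i) (X i) (X (i + 1)) z"
proof (rule generatorI[OF F])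
  show "rhombus (Y i) (X i) z (X (i + 1))" using rhombus_star by (blast intro: rhombus_rotate rhombus_flip)
  have a: "eqp [z, X i, Y i, X i] [z, X i, z, X i]" by (rule eqp_sym[OF loop_turn(1)])
  have "eqp [z, X i, Y i, X (i + 1)] [z, X (i + 1), Y i, X (i + 1)]"
    using eqp_append[OF corner_swap_eqp(1)[of i], of "[X (i + 1)]"] by simp
  then have b: "eqp [z, X i, Y i, X (i + 1)] [z, X (i + 1), z, X (i + 1)]"
    using eqp_trans[OF _ eqp_sym[OF loop_turn(2)[of "i + 1"]]] by simp
  show "gp ([z, X i, Y i] @ [a]) \<in> F" if "tedge (Y i) a" "a \<noteq> X i" "a \<noteq> X (i + 1)" for a
    using gp_nul[OF F] rhombus_end_zero[OF rhombus_star] that by simp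
  show "gp ([z, X i, Y i] @ [X i, w]) \<in> F" if w: "tedge (X i) w" "w \<noteq> z" for w
    using eqp_append[OF a, of "[w]"] w tedge_tvertex degree3_zero[OF tedge_zX(1) w] gp_nul[OF F] eqp_nul by (simp add: is_path_Cons)
  show "gp ([z, X i, Y i] @ [X (i + 1), w]) \<in> F" if w: "tedge (X (i + 1)) w" "w \<noteq> z" for w
    using eqp_append[OF b, of "[w]"] w tedge_tvertex degree3_zero[OF tedge_zX(1) w] gp_nul[OF F] eqp_nul by (simp add: is_path_Cons)
  show "gp ([z, X i, Y i] @ [X i, z, w]) \<in> F" if w: "tedge z w" for w
  proof -
    obtain j where j: "w = X j" using w tedge_z_iff by blast
    have "eqp ([z, X i, Y i, X i] @ [z, w]) ([z, X i, z, X i] @ [z, w])"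
      using eqp_append[OF a, of "[z, w]"] j by (simp add: is_path_Cons)
    then show ?thesis using gp_nul[OF F] eqp_nul degree5_zero j by simp
  qed
qed (simp_all add: is_path_Cons)

text \<open>The third relation at \<open>z\<close> links the two loops on one axis with the two
  loops on another, so three of them in \<open>F\<close> force the fourth.\<close>

lemma loop_member:
  assumes F: "submodule F A M" and h: "gp [z, X j, z] \<in> F" "gp [z, X k, z] \<in> F" "gp [z, X (k + 3), z] \<in> F"
  shows "gp [z, X (j + 3), z] \<in> F"
proof -
  have l: "loop z (z + dir j) = sg [z, X j, z] 1" "loop z (z - dir j) = sg [z, X (j + 3), z] 1" for j
  proof -
    have "z + dir j = X j" "z - dir j = X (j + 3)" by (simp_all add: X_def dir_plus_3)
    then show "loop z (z + dir j) = sg [z, X j, z] 1" "loop z (z - dir j) = sg [z, X (j + 3), z] 1"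
      by (simp_all only: loop_def tedge_zX if_True)
  qed
  have c: "sg [z, X j, z] (1 :: 'k) \<in> combs" for j by (simp add: is_path_Cons)
  note rel = relation_loops[OF tvertex_star(1), of j k, unfolded l]
  from rel show ?thesis
  proof
    let ?f = "sg [z, X j, z] 1 - sg [z, X (j + 3), z] 1 - (sg [z, X k, z] 1 - sg [z, X (k + 3), z] 1)"
    assume f: "?f \<in> I"
    have "gp [z, X (j + 3), z] = \<gamma> (sg [z, X j, z] 1 - (sg [z, X k, z] 1 - sg [z, X (k + 3), z] 1) - ?f)" by (simp add: algebra_simps)
    also have "\<dots> = (gp [z, X j, z] \<ominus>\<^bsub>M\<^esub> (gp [z, X k, z] \<ominus>\<^bsub>M\<^esub> gp [z, X (k + 3), z])) \<ominus>\<^bsub>M\<^esub> \<gamma> ?f"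
      using c I_combs[OF f] by (simp only: \<gamma>_diff combs_diff)
    also have "\<gamma> ?f = \<zero>\<^bsub>M\<^esub>" by (rule \<gamma>_I[OF f])
    finally show ?thesis using submodule_minus[OF F] h submoduleD(2)[OF F] by simp
  next
    let ?f = "sg [z, X j, z] 1 - sg [z, X (j + 3), z] 1 + (sg [z, X k, z] 1 - sg [z, X (k + 3), z] 1)"
    assume f: "?f \<in> I"
    have "gp [z, X (j + 3), z] = \<gamma> (sg [z, X j, z] 1 - (sg [z, X (k + 3), z] 1 - sg [z, X k, z] 1) - ?f)" by (simp add: algebra_simps)
    also have "\<dots> = (gp [z, X j, z] \<ominus>\<^bsub>M\<^esub> (gp [z, X (k + 3), z] \<ominus>\<^bsub>M\<^esub> gp [z, X k, z])) \<ominus>\<^bsub>M\<^esub> \<gamma> ?f"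
      using c I_combs[OF f] by (simp only: \<gamma>_diff combs_diff)
    also have "\<gamma> ?f = \<zero>\<^bsub>M\<^esub>" by (rule \<gamma>_I[OF f])
    finally show ?thesis using submodule_minus[OF F] h submoduleD(2)[OF F] by simp
  qed
qed

text \<open>Only the arrows to \<open>X (i + 3)\<close> and \<open>X (i + 4)\<close> are missing
  from \<open>F\<close>. The loops along them are opposite to loops along arrows in
  \<open>F\<close>, and \<open>X (i + 2)\<close>, \<open>X (i + 5)\<close> form an axis with both
  loops in \<open>F\<close>, so \<open>loop_member\<close> applies.\<close>

lemma generator_vertex:
  assumes F: "submodule F A M" and h: "gp [z, X i] \<in> F" "gp [z, X (i + 1)] \<in> F" "gp [z, X (i + 2)] \<in> F" "gp [z, X (i + 5)] \<in> F"
  shows "generator F (gp [z]) z (X (i + 3)) (X (i + 4)) (Y (i + 3))"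
proof (rule generatorI[OF F])
  have eq: "i + 2 + 1 = i + 3" "i + 3 - 1 = i + 2" "i + 3 + 1 = i + 4" "i + 4 + 1 = i + 5" "i + 4 - 1 = i + 3" "i + 5 - 1 = i + 4"
    "i + 2 + 3 = i + 5" "i + 1 + 3 = i + 4" by simp_all
  have hl: "gp [z, X j, w] \<in> F" if "gp [z, X j] \<in> F" "tedge (X j) w" for j w
    using gp_extend[OF F that(1), of "[w]"] that tedge_tvertex by (simp add: is_path_Cons)
  have l4: "gp [z, X (i + 3), z] \<in> F"
    using loop_member[OF F, of i "i + 2"] hl[OF h(1), of z] hl[OF h(3), of z] hl[OF h(4), of z] by (simp add: eq)
  have l5: "gp [z, X (i + 4), z] \<in> F"
    using loop_member[OF F, of "i + 1" "i + 2"] hl[OF h(2), of z] hl[OF h(3), of z] hl[OF h(4), of z] by (simp add: eq)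
  \<comment> \<open>The corners \<open>Y (i + 2)\<close> and \<open>Y (i + 4)\<close> beside the
    remaining rhombus are also reached through arrows that lie in \<open>F\<close>.\<close>
  have c3: "gp [z, X (i + 3), Y (i + 2)] \<in> F"
  proof (rule gp_eqp[OF F])
    show "eqp [z, X (i + 3), Y (i + 2)] [z, X (i + 2), Y (i + 2)]" using corner_swap_eqp(2)[of "i + 3"] by (simp add: eq)
    show "gp [z, X (i + 2), Y (i + 2)] \<in> F" using hl[OF h(3)] by simp
  qed (use path_star(4)[of "i + 3"] in \<open>simp_all add: is_path_Cons eq\<close>)
  have c5: "gp [z, X (i + 4), Y (i + 4)] \<in> F"
  proof (rule gp_eqp[OF F])
    show "eqp [z, X (i + 4), Y (i + 4)] [z, X (i + 5), Y (i + 4)]" using corner_swap_eqp(1)[of "i + 4"] by (simp add: eq)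
    show "gp [z, X (i + 5), Y (i + 4)] \<in> F" using hl[OF h(4), of "Y (i + 4)"] tedge_XY(5)[of "i + 5"] by (simp add: eq)
  qed (use path_star(4)[of "i + 5"] in \<open>simp_all add: is_path_Cons eq\<close>)
  show "rhombus z (X (i + 3)) (Y (i + 3)) (X (i + 4))" using rhombus_star[of "i + 3"] by (simp add: eq)
  show "gp ([z] @ [a]) \<in> F" if a: "tedge z a" "a \<noteq> X (i + 3)" "a \<noteq> X (i + 4)" for a
  proof -
    obtain j where j: "a = X j" using a tedge_z_iff by blast
    have "\<exists>k\<in>{0, 1, 2, 3, 4, 5}. 6 dvd j - i - k" by (simp; presburger)
    then obtain k where k: "k \<in> {0, 1, 2, 3, 4, 5}" "6 dvd j - i - k" by blast
    then have "X j = X (i + k)" by (simp add: X_eq_iff' mod_eq_dvd_iff algebra_simps)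
    then show ?thesis using k(1) a j h by auto
  qed
  show "gp ([z] @ [X (i + 3), a]) \<in> F" if a: "tedge (X (i + 3)) a" "a \<noteq> Y (i + 3)" for a
    using l4 c3 gp_nul[OF F arrow_end_zero[OF a(1)]] a(2) by (cases "a = z"; cases "a = Y (i + 2)") (auto simp: eq)
  show "gp ([z] @ [X (i + 4), a]) \<in> F" if a: "tedge (X (i + 4)) a" "a \<noteq> Y (i + 3)" for a
    using l5 c5 gp_nul[OF F arrow_end_zero[OF a(1)]] a(2) by (cases "a = z"; cases "a = Y (i + 4)") (auto simp: eq)
  show "gp ([z] @ [X (i + 3), Y (i + 3), a]) \<in> F" if a: "tedge (Y (i + 3)) a" for a
  proof -
    consider "a = X (i + 3)" | "a = X (i + 4)" | "a \<noteq> X (i + 3)" "a \<noteq> X (i + 4)" by blast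
    then show ?thesis
    proof cases
      case 1
      have "eqp [z, X (i + 3), Y (i + 3), X (i + 3)] [z, X (i + 3), Y (i + 2), X (i + 3)]"
        using eqp_trans[OF eqp_sym[OF loop_turn(1)] loop_turn(2)[of "i + 3"]] by (simp add: eq)
      moreover have "gp [z, X (i + 3), Y (i + 2), X (i + 3)] \<in> F"
        using gp_extend[OF F c3, of "[X (i + 3)]"] path_star(4,7)[of "i + 3"] by (simp add: is_path_Cons eq)
      ultimately show ?thesis using 1 gp_eqp[OF F] path_star(4,7)[of "i + 3"] by (simp add: is_path_Cons eq)
    next
      case 2
      have "eqp [z, X (i + 3), Y (i + 3), X (i + 4)] [z, X (i + 4), Y (i + 3), X (i + 4)]"
        using eqp_append[OF corner_swap_eqp(1)[of "i + 3"], of "[X (i + 4)]"] path_star(6)[of "i + 3"] by (simp add: eq)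
      also have "eqp [z, X (i + 4), Y (i + 3), X (i + 4)] [z, X (i + 4), Y (i + 4), X (i + 4)]"
        using eqp_trans[OF eqp_sym[OF loop_turn(2)] loop_turn(1)[of "i + 4"]] by (simp add: eq)
      note e = eqp_trans[OF calculation this]
      have "gp [z, X (i + 4), Y (i + 4), X (i + 4)] \<in> F"
        using gp_extend[OF F c5, of "[X (i + 4)]"] by (simp add: is_path_Cons)
      then show ?thesis using 2 gp_eqp[OF F e] path_star(6)[of "i + 3"] by (simp add: is_path_Cons eq)
    next
      case 3
      then show ?thesis using gp_nul[OF F rhombus_end_zero[OF rhombus_star[of "i + 3"] a]] by (simp add: eq)
    qed
  qed
qed simp_all

lemma not_in_killed:
  assumes "\<And>y. y \<in> F \<Longrightarrow> act y (sg [r] 1) = \<zero>\<^bsub>M\<^esub>" "is_path p" "last p = r" "gp p \<noteq> \<zero>\<^bsub>M\<^esub>"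
  shows "gp p \<notin> F"
proof
  assume "gp p \<in> F"
  then have "act (gp p) (sg [r] 1) = \<zero>\<^bsub>M\<^esub>" by (rule assms(1))
  moreover have "act (gp p) (sg [r] 1) = gp p" using gp_append[of p "[]"] assms(2,3) last_tvertex[of p] by simp
  ultimately show False using assms(4) by simp
qed

end

context pmod
begin

lemma extend_least: "submodule N A M \<Longrightarrow> F \<subseteq> N \<Longrightarrow> m \<in> N \<Longrightarrow> extend F m \<subseteq> N"
  unfolding extend_def submodule_iff_act by blast

lemma extend_zero: "m \<in> carrier M \<Longrightarrow> extend {\<zero>\<^bsub>M\<^esub>} m = act m ` combs"
  unfolding extend_def by force

end

section \<open>Direct sums and right ideals as modules\<close>

lemma pmod_dsum:
  assumes "pmod I M" "pmod I N"
  shows "pmod I (module_dsum M N)"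
proof -
  interpret M: pmod I M by fact
  interpret N: pmod I N by fact
  have simps: "carrier (module_dsum M N) = carrier M \<times> carrier N" "zero (module_dsum M N) = (\<zero>\<^bsub>M\<^esub>, \<zero>\<^bsub>N\<^esub>)"
    "(m, n) \<oplus>\<^bsub>module_dsum M N\<^esub> (m', n') = (m \<oplus>\<^bsub>M\<^esub> m', n \<oplus>\<^bsub>N\<^esub> n')"
    "a \<odot>\<^bsub>module_dsum M N\<^esub> (m, n) = (a \<odot>\<^bsub>M\<^esub> m, a \<odot>\<^bsub>N\<^esub> n)" for a m n m' n'
    by (simp_all add: module_dsum_def)
  have "right_module M.A (module_dsum M N)"
  proof (rule right_moduleI[OF M.nonunital_ring_A])
    show "abelian_group (module_dsum M N)"
    proof (rule abelian_groupI)
      fix p assume "p \<in> carrier (module_dsum M N)"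
      then show "\<exists>q\<in>carrier (module_dsum M N). q \<oplus>\<^bsub>module_dsum M N\<^esub> p = \<zero>\<^bsub>module_dsum M N\<^esub>"
        by (intro bexI[of _ "(\<ominus>\<^bsub>M\<^esub> fst p, \<ominus>\<^bsub>N\<^esub> snd p)"]) (auto simp: simps M.RM.M.l_neg N.RM.M.l_neg)
    qed (auto simp: simps M.RM.M.a_ac N.RM.M.a_ac)
    fix p assume "p \<in> carrier (module_dsum M N)"
    then obtain m n where p: "p = (m, n)" "m \<in> carrier M" "n \<in> carrier N" by (auto simp: simps)
    obtain V where V: "finite V" "V \<subseteq> {z. tvertex z}" "\<And>W. finite W \<Longrightarrow> V \<subseteq> W \<Longrightarrow> W \<subseteq> {z. tvertex z} \<Longrightarrow> M.act m (vunit W) = m"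
      using M.local_unit[OF p(2)] by blast
    obtain V' where V': "finite V'" "V' \<subseteq> {z. tvertex z}" "\<And>W. finite W \<Longrightarrow> V' \<subseteq> W \<Longrightarrow> W \<subseteq> {z. tvertex z} \<Longrightarrow> N.act n (vunit W) = n"
      using N.local_unit[OF p(3)] by blast
    \<comment> \<open>One unit has to serve both components, so a union of the two vertex sets is
      taken.\<close>
    have "M.act m (vunit (V \<union> V')) = m" "N.act n (vunit (V \<union> V')) = n"
      using V V' by auto
    then show "\<exists>a\<in>carrier M.A. a \<odot>\<^bsub>module_dsum M N\<^esub> p = p"
      using V(2) V'(2) p by (intro bexI[of _ "cl I (vunit (V \<union> V'))"]) (simp_all add: simps M.act_def N.act_def vunit_combs)
  qed (auto simp: simps M.RM.act_closed N.RM.act_closed M.RM.act_l_distr N.RM.act_l_distr M.RM.act_r_distr N.RM.act_r_distr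
      M.RM.act_assoc N.RM.act_assoc)
  then show ?thesis by (intro pmod.intro pmod_axioms.intro M.pideal_axioms)
qed

context pideal
begin

lemma regular_simps: "carrier (regular_module A) = carrier A" "zero (regular_module A) = cl I 0"
  "cl I f \<oplus>\<^bsub>regular_module A\<^esub> cl I g = cl I (f + g)"
  "f \<in> combs \<Longrightarrow> g \<in> combs \<Longrightarrow> cl I g \<odot>\<^bsub>regular_module A\<^esub> cl I f = cl I (path_mult f g)"
  by (simp_all add: regular_module_def zero_A)

lemma pmod_regular: "pmod I (regular_module A)"
proof -
  have "right_module A (regular_module A)"
  proof (rule right_moduleI[OF nonunital_ring_A])
    show "abelian_group (regular_module A)"
    proof (rule abelian_groupI)
      fix X Y Z assume "X \<in> carrier (regular_module A)" "Y \<in> carrier (regular_module A)" "Z \<in> carrier (regular_module A)"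
      then obtain f g h where e: "f \<in> combs" "X = cl I f" "g \<in> combs" "Y = cl I g" "h \<in> combs" "Z = cl I h"
        by (auto simp: regular_simps elim!: carrier_A_E)
      show "X \<oplus>\<^bsub>regular_module A\<^esub> Y \<in> carrier (regular_module A)"
        "X \<oplus>\<^bsub>regular_module A\<^esub> Y \<oplus>\<^bsub>regular_module A\<^esub> Z = X \<oplus>\<^bsub>regular_module A\<^esub> (Y \<oplus>\<^bsub>regular_module A\<^esub> Z)"
        "X \<oplus>\<^bsub>regular_module A\<^esub> Y = Y \<oplus>\<^bsub>regular_module A\<^esub> X"
        "\<zero>\<^bsub>regular_module A\<^esub> \<oplus>\<^bsub>regular_module A\<^esub> X = X"
        using e by (simp_all add: regular_simps algebra_simps)
      show "\<exists>Y\<in>carrier (regular_module A). Y \<oplus>\<^bsub>regular_module A\<^esub> X = \<zero>\<^bsub>regular_module A\<^esub>"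
        using e by (intro bexI[of _ "cl I (- f)"]) (simp_all add: regular_simps)
    qed (simp add: regular_simps)
  next
    fix X assume "X \<in> carrier (regular_module A)"
    then obtain f where f: "f \<in> combs" "X = cl I f" by (auto simp: regular_simps elim!: carrier_A_E)
    obtain V where V: "finite V" "V \<subseteq> {z. tvertex z}" "\<And>W. finite W \<Longrightarrow> V \<subseteq> W \<Longrightarrow> path_mult f (vunit W) = f"
      using path_mult_vunit[OF f(1)] by blast
    then show "\<exists>a\<in>carrier A. a \<odot>\<^bsub>regular_module A\<^esub> X = X"
      using f by (intro bexI[of _ "cl I (vunit V)"]) (simp_all add: regular_simps vunit_combs)
    fix Y assume "Y \<in> carrier (regular_module A)"
    then obtain g where g: "g \<in> combs" "Y = cl I g" by (auto simp: regular_simps elim!: carrier_A_E)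
    fix a assume "a \<in> carrier A"
    then obtain h where h: "h \<in> combs" "a = cl I h" by (rule carrier_A_E)
    show "a \<odot>\<^bsub>regular_module A\<^esub> X \<in> carrier (regular_module A)"
      "a \<odot>\<^bsub>regular_module A\<^esub> (X \<oplus>\<^bsub>regular_module A\<^esub> Y) = a \<odot>\<^bsub>regular_module A\<^esub> X \<oplus>\<^bsub>regular_module A\<^esub> a \<odot>\<^bsub>regular_module A\<^esub> Y"
      using f g h by (simp_all add: regular_simps path_mult_add_left)
    fix b assume "b \<in> carrier A"
    then obtain k where k: "k \<in> combs" "b = cl I k" by (rule carrier_A_E)
    show "(a \<oplus>\<^bsub>A\<^esub> b) \<odot>\<^bsub>regular_module A\<^esub> X = a \<odot>\<^bsub>regular_module A\<^esub> X \<oplus>\<^bsub>regular_module A\<^esub> b \<odot>\<^bsub>regular_module A\<^esub> X"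
      "(a \<otimes>\<^bsub>A\<^esub> b) \<odot>\<^bsub>regular_module A\<^esub> X = b \<odot>\<^bsub>regular_module A\<^esub> (a \<odot>\<^bsub>regular_module A\<^esub> X)"
      using f h k by (simp_all add: regular_simps path_mult_add_right path_mult_assoc)
  qed
  then show ?thesis by (intro pmod.intro pmod_axioms.intro pideal_axioms)
qed

definition pri :: "'k pathcomb \<Rightarrow> 'k pathcomb set set" where
  "pri f = (\<lambda>g. cl I (path_mult f g)) ` combs"

lemma principal_right_ideal_eq:
  assumes "f \<in> combs"
  shows "principal_right_ideal A (cl I f) = pri f"
  using assms by (auto simp: principal_right_ideal_def pri_def carrier_A image_image intro!: image_cong)

lemma pri_submodule:
  assumes "f \<in> combs"
  shows "submodule (pri f) A (regular_module A)"
proof -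
  interpret REG: pmod I "regular_module A" by (rule pmod_regular)
  have f: "cl I f \<in> carrier (regular_module A)" using assms by (simp add: regular_simps)
  have "pri f = REG.extend {\<zero>\<^bsub>regular_module A\<^esub>} (cl I f)"
    unfolding REG.extend_zero[OF f] pri_def REG.act_def using assms by (intro image_cong) (simp_all add: regular_simps)
  then show ?thesis using REG.extend_submodule[OF REG.zero_submodule f] by simp
qed

end

context gmod
begin

lemma extend_gp:
  assumes "submodule F A M" "is_path p"
  shows "submodule (extend F (gp p)) A M" "F \<subseteq> extend F (gp p)" "gp p \<in> extend F (gp p)"
proof -
  have c: "gp p \<in> carrier M" using assms(2) by simp
  show "submodule (extend F (gp p)) A M" "F \<subseteq> extend F (gp p)"
    using extend_submodule[OF assms(1) c] extend_base[OF assms(1) c] .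
  show "gp p \<in> extend F (gp p)"
    using extend_act[OF assms(1) c, of "sg [last p] 1"] gp_append[of p "[]"] assms(2) last_tvertex[of p] by simp
qed

text \<open>The neighbouring arrow in \<open>F\<close> reaches the far corner that it shares with
  \<open>X i\<close>, so the rhombus on the other side of \<open>X i\<close> is left. The mirror
  image is \<open>generator_B'\<close>.\<close>

lemma generator_A':
  assumes F: "submodule F A M" and h: "gp [z, X (i + 1)] \<in> F"
  shows "generator F (gp [z, X i]) (X i) z (Y (i - 1)) (X (i - 1))"
proof (rule generator_side[OF F rhombus_star' rhombus_star])
  have "gp [z, X (i + 1), Y i] \<in> F" using gp_extend[OF F h, of "[Y i]"] by simp
  then show "gp [z, X i, Y i] \<in> F" by (rule gp_eqp[OF F corner_swap_eqp(1), rotated 2]) (simp_all add: is_path_Cons)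
qed simp

lemma generator_B':
  assumes F: "submodule F A M" and h: "gp [z, X i] \<in> F"
  shows "generator F (gp [z, X (i + 1)]) (X (i + 1)) z (Y (i + 1)) (X (i + 2))"
proof -
  have "gp [z, X i, Y i] \<in> F" using gp_extend[OF F h, of "[Y i]"] by simp
  then have "gp [z, X (i + 1), Y i] \<in> F" by (rule gp_eqp[OF F eqp_sym[OF corner_swap_eqp(1)], rotated 2]) (simp_all add: is_path_Cons)
  then show ?thesis
    using generator_side[OF F rhombus_star[of "i + 1"] rhombus_star'[of "i + 1"]] by (simp add: add.assoc)
qed

end

text \<open>Where the path across the rhombus survives, membership in \<open>G\<close> makes all
  four coefficients of \<open>f\<close> vanish; the reduction to normal form in the other module
  then puts \<open>m f\<close> into \<open>F\<close>.\<close>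

lemma generator_transfer:
  assumes "pmod I M" "pmod I N"
    and "submodule F (path_algebra Quot I) M" "pmod.generator I M F m w u v t"
    and "submodule G (path_algebra Quot I) N" "pmod.generator I N G n w u v t"
    and "f \<in> combs" "pmod.act I N n f \<in> G" "pmod.act I N n (sg [w, u, t] 1) \<notin> G"
  shows "pmod.act I M m f \<in> F"
proof -
  interpret M: pmod I M by fact
  interpret N: pmod I N by fact
  have m: "m \<in> carrier M" using assms(4) by (simp add: M.generator_def)
  have "nform w u v t f = 0"
    using N.generator_independent[OF assms(5-9)] by (simp add: nform_def)
  then have "M.act m f \<ominus>\<^bsub>M\<^esub> \<zero>\<^bsub>M\<^esub> \<in> F"
    using M.generator_reduce[OF assms(3,4,7)] m by simp
  then show ?thesis using m assms(7) by (simp add: a_minus_def)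
qed

section \<open>The exact sequence and its filtrations\<close>

context star
begin

lemma path_class_eq: "path_class s p = cl I (sg p 1)"
  by (simp add: path_class_def cl_def I_eq)

lemma algebra_eq: "rauzy_algebra s = A"
  by (simp add: rauzy_algebra_def I_eq)

lemma eA_eq: "tvertex x \<Longrightarrow> eA s x = restrict_module (regular_module A) (pri (sg [x] 1))"
  by (simp add: eA_def right_ideal_module_def algebra_eq path_class_eq principal_right_ideal_eq)

lemma arrows_sum_eq: "tedge z x \<Longrightarrow> tedge z y \<Longrightarrow>
    arrows_sum s z x y = restrict_module (regular_module A) (pri (sg [z, x] 1) <+>\<^bsub>A\<^esub> pri (sg [z, y] 1))"
  using tedge_tvertex by (simp add: arrows_sum_def right_ideal_module_def algebra_eq path_class_eq principal_right_ideal_eq is_path_Cons)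

lemma gmod_regular: "gmod s z I (regular_module A) (cl I)"
proof -
  interpret REG: pmod I "regular_module A" by (rule pmod_regular)
  show ?thesis
    by unfold_locales (simp_all add: regular_simps REG.act_def cl_eq_iff)
qed

lemma pmod_eA: "tvertex x \<Longrightarrow> pmod I (eA s x)"
  unfolding eA_eq by (rule pmod.pmod_restrict[OF pmod_regular pri_submodule]) simp

definition ladj :: "pt \<Rightarrow> pt \<Rightarrow> 'k pathcomb \<Rightarrow> 'k pathcomb set \<times> 'k pathcomb set" where
  "ladj x y f = (cl I (path_mult (sg [x, z] 1) f), cl I (path_mult (sg [y, z] 1) f))"

lemma gmod_dsum:
  assumes "tedge x z" "tedge y z"
  shows "gmod s z I (module_dsum (eA s x) (eA s y)) (ladj x y)"
proof -
  have p: "is_path [x, z]" "is_path [y, z]" "tvertex x" "tvertex y" using assms tedge_tvertex by (auto simp: is_path_Cons)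
  interpret D: pmod I "module_dsum (eA s x) (eA s y)" by (intro pmod_dsum pmod_eA p)
  have mem: "cl I (path_mult (sg [u, z] 1) f) \<in> pri (sg [u] 1)" if "is_path [u, z]" "f \<in> combs" for u f
  proof -
    have "path_mult (sg [u, z] 1) f = path_mult (sg [u] 1) (path_mult (sg [u, z] 1) f)"
      using that by (simp add: path_mult_single is_path_Cons flip: path_mult_assoc)
    then show ?thesis unfolding pri_def using that by (metis combs_mult combs_single image_eqI)
  qed
  have simps: "carrier (eA s u) = pri (sg [u] 1)" "add (eA s u) = add (regular_module A)" "zero (eA s u) = cl I 0"
    "smult (eA s u) = smult (regular_module A)" if "tvertex u" for u
    using that by (simp_all add: eA_eq restrict_module_def regular_simps)
  show ?thesis
  proof unfold_locales
    fix f g :: "'k pathcomb" assume f: "f \<in> combs"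
    show "ladj x y f \<in> carrier (module_dsum (eA s x) (eA s y))"
      using mem p f by (simp add: ladj_def module_dsum_def simps)
    assume g: "g \<in> combs"
    show "ladj x y (f + g) = ladj x y f \<oplus>\<^bsub>module_dsum (eA s x) (eA s y)\<^esub> ladj x y g"
      using p f g by (simp add: ladj_def module_dsum_def simps regular_simps path_mult_add_right)
    show "D.act (ladj x y f) g = ladj x y (path_mult f g)"
      unfolding D.act_def using p f g by (simp add: ladj_def module_dsum_def simps regular_simps path_mult_assoc)
  next
    fix f assume "f \<in> I"
    then show "ladj x y f = \<zero>\<^bsub>module_dsum (eA s x) (eA s y)\<^esub>"
      using p I_mult(2) by (simp add: ladj_def module_dsum_def simps cl_eq_iff)
  qed
qed

lemma ladj_zero_iff:
  assumes "tedge x z" "tedge y z"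
  shows "ladj x y (sg (z # p) 1) = \<zero>\<^bsub>module_dsum (eA s x) (eA s y)\<^esub> \<longleftrightarrow> nul (x # z # p) \<and> nul (y # z # p)"
  using tedge_tvertex[OF assms(1)] tedge_tvertex[OF assms(2)]
  by (simp add: ladj_def module_dsum_def eA_eq restrict_module_def regular_simps path_mult_single cl_eq_iff nul_def)

text \<open>The indices \<open>i\<close>, ..., \<open>i + 5\<close> stand for the arrows b_1, ...,
  b_6.\<close>

lemma sequence:
  fixes i :: int
  defines "K \<equiv> arrows_sum s z (X i) (X (i + 1)) :: ('k pathcomb set, 'k pathcomb set) module"
    and "C \<equiv> arrow_pair_module s z (X (i + 3)) (X (i + 4)) :: ('k pathcomb set, 'k pathcomb set \<times> 'k pathcomb set) module"
  shows "(\<exists>g. short_exact (rauzy_algebra s) K (eA s z) C (\<lambda>m. m) g) \<and> rhombus_filtration s K 3 \<and> rhombus_filtration s C 3"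
proof -
  let ?x = "X (i + 3)" and ?y = "X (i + 4)"
  let ?D = "module_dsum (eA s ?x) (eA s ?y) :: ('k pathcomb set, 'k pathcomb set \<times> 'k pathcomb set) module"
  interpret R: gmod s z I "regular_module A" "cl I" by (rule gmod_regular)
  interpret D: gmod s z I ?D "ladj ?x ?y" by (rule gmod_dsum) simp_all
  have eq: "i + 2 + 1 = i + 3" "i + 5 - 1 = i + 4" "i + 1 + 1 = i + 2" "i + 3 + 1 = i + 4" by simp_all
  have Xne: "X (i + a) = X (i + b) \<longleftrightarrow> 6 dvd a - b" for a b by (rule X_eq_iff)
  have Xne0: "X i = X (i + b) \<longleftrightarrow> 6 dvd b" "X (i + b) = X i \<longleftrightarrow> 6 dvd b" for b
    using X_eq_iff[of i 0 b] X_eq_iff[of i b 0] by auto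
  have Xm: "X (i - 1) = X (i + 5)" using X_eq_iff[of i "-1" 5] by simp
  have Yne: "Y (i + 3) \<noteq> Y (i + 2)" "Y (i + 3) \<noteq> Y (i + 4)"
    using Y_neighbours_distinct(3)[of "i + 2"] Y_neighbours_distinct(4)[of "i + 3"] by (simp_all add: eq)
  have act_gp: "R.act (R.gp p) (sg q c) = cl I (sg (p @ tl q) c)" if "is_path p" "is_path q" "last p = hd q" for p q c
    using that by (simp add: R.act_\<gamma> path_mult_single)
  have Dact_gp: "D.act (D.gp p) (sg q c) = ladj ?x ?y (sg (p @ tl q) c)" if "is_path p" "is_path q" "last p = hd q" for p q c
    using that by (simp add: D.act_\<gamma> path_mult_single)
  have zero_R: "\<zero>\<^bsub>regular_module A\<^esub> = cl I 0" by (simp add: regular_simps)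
  have R_zero: "R.gp p = \<zero>\<^bsub>regular_module A\<^esub> \<longleftrightarrow> nul p" for p
    by (simp add: zero_R cl_eq_iff nul_def)
  have paths: "is_path [z, X j, Y j]" "is_path [z, X j, z]" "is_path [z, X j, z, X k]" "is_path [z, X j]" "is_path [X j, z, X k]" for j k
    by (simp_all add: is_path_Cons)
  \<comment> \<open>Each of these becomes, after at most one more arrow and up to sign, a closed
    path of nonzero trace.\<close>
  have corner0: "\<not> nul [z, X i, z, X (i - 1)]" "\<not> nul [z, X (i + 1), z, X (i + 2)]" "\<not> nul [z, X i, Y i, X i, z]"
  proof -
    show "\<not> nul [z, X i, z, X (i - 1)]"
      using not_nul_loop(1)[OF rh_star(2)[of "i - 1"]] nul_append[of "[z, X i, z, X (i - 1)]" "[z]"] by auto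
    show "\<not> nul [z, X (i + 1), z, X (i + 2)]"
      using not_nul_loop(1)[OF rh_star(1)[of "i + 1"]] nul_append[of "[z, X (i + 1), z, X (i + 2)]" "[z]"] by (auto simp: eq)
    have "eqp [z, X (i + 1), z, X i] [z, X i, Y i, X i]" using eqp_trans[OF socle_turn(2) loop_turn(1)] .
    then have "eqp [z, X (i + 1), z, X i, z] [z, X i, Y i, X i, z]"
      using eqp_append[of "[z, X (i + 1), z, X i]" "[z, X i, Y i, X i]" "[z]"] by simp
    then show "\<not> nul [z, X i, Y i, X i, z]"
      using not_nul_loop(1)[OF rh_star(2)[of i]] eqp_nul by blast
  qed

  \<comment> \<open>The path to \<open>Y i\<close> is shared by b_1 and b_2 up to sign, so it comes
    first; modulo it, b_1 keeps just the rhombus on its other side, and then so does b_2.\<close>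
  define K0 where "K0 = {\<zero>\<^bsub>regular_module A\<^esub>}"
  define K1 where "K1 = R.extend K0 (R.gp [z, X i, Y i])"
  define K2 where "K2 = R.extend K1 (R.gp [z, X i])"
  define K3 where "K3 = R.extend K2 (R.gp [z, X (i + 1)])"
  have c: "sg p 1 \<in> combs" if "is_path p" for p using that by simp
  have Kc: "R.gp p \<in> carrier (regular_module A)" if "is_path p" for p using that by simp
  have sK0: "submodule K0 A (regular_module A)" unfolding K0_def by (rule R.zero_submodule)
  have sK1: "submodule K1 A (regular_module A)" and K01: "K0 \<subseteq> K1" and mK1: "R.gp [z, X i, Y i] \<in> K1"
    unfolding K1_def by (rule R.extend_gp[OF sK0 paths(1)])+
  have sK2: "submodule K2 A (regular_module A)" and K12: "K1 \<subseteq> K2" and mK2: "R.gp [z, X i] \<in> K2"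
    unfolding K2_def by (rule R.extend_gp[OF sK1 paths(4)])+
  have sK3: "submodule K3 A (regular_module A)" and K23: "K2 \<subseteq> K3" and mK3: "R.gp [z, X (i + 1)] \<in> K3"
    unfolding K3_def by (rule R.extend_gp[OF sK2 paths(4)])+
  have gK1: "R.generator K0 (R.gp [z, X i, Y i]) (Y i) (X i) (X (i + 1)) z" by (rule R.generator_corner[OF sK0])
  have gK2: "R.generator K1 (R.gp [z, X i]) (X i) z (Y (i - 1)) (X (i - 1))" by (rule R.generator_side[OF sK1 rhombus_star' rhombus_star _ mK1]) simp
  have gK3: "R.generator K2 (R.gp [z, X (i + 1)]) (X (i + 1)) z (Y (i + 1)) (X (i + 2))"
    by (rule R.generator_B'[OF sK2 mK2])
  have k0: "R.act y (sg [r] 1) = \<zero>\<^bsub>regular_module A\<^esub>" if "y \<in> K0" "tvertex r" for y r using that by (simp add: K0_def)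
  \<comment> \<open>Both vertices are ends of the paths across later rhombi and are absent from this
    step, so such a path lies outside it as soon as it is nonzero. The facts \<open>c1\<close> and
    \<open>c2\<close> below play the same part in the cokernel.\<close>
  have k1: "R.act y (sg [r] 1) = \<zero>\<^bsub>regular_module A\<^esub>" if "y \<in> K1" "r \<in> {X (i - 1), X (i + 2)}" for y r
    using that(2) R.extend_kill[OF sK0 gK1 _ _ k0 that(1)[unfolded K1_def], of r] by (auto simp: Xne Xne0 Xm)
  have k2: "R.act y (sg [X (i + 2)] 1) = \<zero>\<^bsub>regular_module A\<^esub>" if "y \<in> K2" for y
    using R.extend_kill[OF sK1 gK2 _ _ k1 that[unfolded K2_def], of "X (i + 2)"] by (auto simp: Xne Xne0 Xm)
  have nK1: "R.act (R.gp [z, X i, Y i]) (sg [Y i, X i, z] 1) \<notin> K0"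
    using corner0(3) by (simp add: act_gp K0_def R_zero is_path_Cons)
  have nK2: "R.act (R.gp [z, X i]) (sg [X i, z, X (i - 1)] 1) \<notin> K1"
  proof -
    have "R.gp [z, X i, z, X (i - 1)] \<notin> K1"
      by (rule R.not_in_killed[where r = "X (i - 1)"]) (use k1 corner0(1) in \<open>auto simp: R_zero is_path_Cons\<close>)
    then show ?thesis by (simp add: act_gp is_path_Cons)
  qed
  have nK3: "R.act (R.gp [z, X (i + 1)]) (sg [X (i + 1), z, X (i + 2)] 1) \<notin> K2"
  proof -
    have "R.gp [z, X (i + 1), z, X (i + 2)] \<notin> K2"
      by (rule R.not_in_killed[where r = "X (i + 2)"]) (use k2 corner0(2) in \<open>auto simp: R_zero is_path_Cons\<close>)
    then show ?thesis by (simp add: act_gp is_path_Cons)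
  qed
  have fK: "rhombus_filtration s (restrict_module (regular_module A) K3) 3"
    by (rule rhombus_filtration_3[OF I_eq R.pmod_axioms K0_def K1_def K2_def K3_def gK1 gK2 gK3 nK1 nK2 nK3])

  have K3_elem: "\<exists>f\<in>combs. \<exists>g\<in>combs. x = cl I (path_mult (sg [z, X i] 1) f + path_mult (sg [z, X (i + 1)] 1) g)" if xK: "x \<in> K3" for x
  proof -
    obtain f g h where x: "f \<in> combs" "g \<in> combs" "h \<in> combs"
      "x = ((\<zero>\<^bsub>regular_module A\<^esub> \<oplus>\<^bsub>regular_module A\<^esub> R.act (R.gp [z, X i, Y i]) f) \<oplus>\<^bsub>regular_module A\<^esub> R.act (R.gp [z, X i]) g)
         \<oplus>\<^bsub>regular_module A\<^esub> R.act (R.gp [z, X (i + 1)]) h"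
      using xK unfolding K3_def K2_def K1_def K0_def R.extend_def by blast
    \<comment> \<open>The first generator is a multiple of b_1, so adjoining it does not lead out of
      the sum of the two right ideals.\<close>
    have "path_mult (sg [z, X i, Y i] 1) f = path_mult (sg [z, X i] 1) (path_mult (sg [X i, Y i] 1) f)"
      using x(1) by (simp add: path_mult_single flip: path_mult_assoc)
    then have "x = cl I (path_mult (sg [z, X i] 1) (path_mult (sg [X i, Y i] 1) f + g) + path_mult (sg [z, X (i + 1)] 1) h)"
      using x paths by (simp add: R.act_\<gamma> regular_simps path_mult_add_right)
    then show ?thesis using x by (intro bexI[of _ "path_mult (sg [X i, Y i] 1) f + g"] bexI[of _ h]) simp_all
  qed
  have K3_in: "cl I (path_mult (sg [z, X i] 1) f + path_mult (sg [z, X (i + 1)] 1) g) \<in> K3" if "f \<in> combs" "g \<in> combs" for f g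
  proof -
    have "R.act (R.gp [z, X i]) f \<oplus>\<^bsub>regular_module A\<^esub> R.act (R.gp [z, X (i + 1)]) g \<in> K3"
      using sK3 mK2 mK3 K23 that unfolding R.submodule_iff_act by blast
    then show ?thesis using that paths by (simp add: R.act_\<gamma> regular_simps)
  qed
  have "pri (sg [z, X i] 1) <+>\<^bsub>A\<^esub> pri (sg [z, X (i + 1)] 1) = K3"
  proof -
    have mem: "x \<in> pri (sg [z, X i] 1) <+>\<^bsub>A\<^esub> pri (sg [z, X (i + 1)] 1) \<longleftrightarrow>
      (\<exists>f\<in>combs. \<exists>g\<in>combs. x = cl I (path_mult (sg [z, X i] 1) f + path_mult (sg [z, X (i + 1)] 1) g))" for x
      unfolding set_add_def' pri_def by (simp add: bex_simps)
    show ?thesis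
    proof (rule subset_antisym; rule subsetI)
      show "x \<in> K3" if "x \<in> pri (sg [z, X i] 1) <+>\<^bsub>A\<^esub> pri (sg [z, X (i + 1)] 1)" for x
        using that K3_in unfolding mem by blast
      show "x \<in> pri (sg [z, X i] 1) <+>\<^bsub>A\<^esub> pri (sg [z, X (i + 1)] 1)" if "x \<in> K3" for x
        using K3_elem[OF that] unfolding mem .
    qed
  qed
  then have K: "K = restrict_module (regular_module A) K3" unfolding K_def by (simp add: arrows_sum_eq)

  have Dz: "D.gp p = \<zero>\<^bsub>?D\<^esub> \<longleftrightarrow> nul (?x # p) \<and> nul (?y # p)" if "p \<noteq> []" "hd p = z" for p
    using ladj_zero_iff[of ?x ?y "tl p"] that by (cases p) simp_all
  \<comment> \<open>The arrows b_1, b_2 point at least 120 degrees away from b_4, b_5, so all four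
    products vanish by the first relation.\<close>
  have D1: "D.gp [z, X i] = \<zero>\<^bsub>?D\<^esub>" "D.gp [z, X (i + 1)] = \<zero>\<^bsub>?D\<^esub>"
    using straight_zero[of 0 3 i] straight_zero[of 0 4 i] straight_zero[of 1 3 i] straight_zero[of 1 4 i] by (simp_all add: Dz)
  \<comment> \<open>As b_1 and b_2 become zero, each of b_3 and b_6 has a neighbouring arrow in the
    zero submodule and generates a rhombus module on its other side.\<close>
  define C0 where "C0 = {\<zero>\<^bsub>?D\<^esub>}"
  define C1 where "C1 = D.extend C0 (D.gp [z, X (i + 2)])"
  define C2 where "C2 = D.extend C1 (D.gp [z, X (i + 5)])"
  define C3 where "C3 = D.extend C2 (D.gp [z])"
  have Dc: "D.gp p \<in> carrier ?D" if "is_path p" for p using that by simp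
  have pz: "is_path [z]" by simp
  have sC0: "submodule C0 A ?D" unfolding C0_def by (rule D.zero_submodule)
  have sC1: "submodule C1 A ?D" and C01: "C0 \<subseteq> C1" and mC1: "D.gp [z, X (i + 2)] \<in> C1"
    unfolding C1_def by (rule D.extend_gp[OF sC0 paths(4)])+
  have sC2: "submodule C2 A ?D" and C12: "C1 \<subseteq> C2" and mC2: "D.gp [z, X (i + 5)] \<in> C2"
    unfolding C2_def by (rule D.extend_gp[OF sC1 paths(4)])+
  have sC3: "submodule C3 A ?D" and mC3: "D.gp [z] \<in> C3"
    unfolding C3_def by (rule D.extend_gp[OF sC2 pz])+
  have zC0: "D.gp [z, X i] \<in> C0" "D.gp [z, X (i + 1)] \<in> C0" using D1 by (simp_all add: C0_def)
  have gC1: "D.generator C0 (D.gp [z, X (i + 2)]) (X (i + 2)) z (Y (i + 2)) (X (i + 3))"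
    using D.generator_B'[OF sC0 zC0(2)] by (simp add: add.assoc)
  have gC2: "D.generator C1 (D.gp [z, X (i + 5)]) (X (i + 5)) z (Y (i + 4)) (X (i + 4))"
    using D.generator_A'[OF sC1, of "i + 5", unfolded X_periodic eq] zC0(1) C01 by blast
  have gC3: "D.generator C2 (D.gp [z]) z (X (i + 3)) (X (i + 4)) (Y (i + 3))"
    by (rule D.generator_vertex[OF sC2]) (use zC0 mC1 mC2 C01 C12 in blast)+
  have c0: "D.act y (sg [r] 1) = \<zero>\<^bsub>?D\<^esub>" if "y \<in> C0" "tvertex r" for y r using that by (simp add: C0_def)
  have c1: "D.act y (sg [r] 1) = \<zero>\<^bsub>?D\<^esub>" if "y \<in> C1" "r \<in> {X (i + 4), Y (i + 3)}" for y r
    using that(2) D.extend_kill[OF sC0 gC1 _ _ c0 that(1)[unfolded C1_def], of r] Yne by (auto simp: Xne Xne0)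
  have c2: "D.act y (sg [Y (i + 3)] 1) = \<zero>\<^bsub>?D\<^esub>" if "y \<in> C2" for y
    using D.extend_kill[OF sC1 gC2 _ _ c1 that[unfolded C2_def], of "Y (i + 3)"] Yne by (auto simp: Xne Xne0)
  have nz1: "D.gp [z, X (i + 2), z, X (i + 3)] \<noteq> \<zero>\<^bsub>?D\<^esub>"
    using not_nul_loop(2)[OF rh_star(2)[of "i + 2"]] by (simp add: Dz eq)
  have nz2: "D.gp [z, X (i + 5), z, X (i + 4)] \<noteq> \<zero>\<^bsub>?D\<^esub>"
    using not_nul_loop(2)[OF rh_star(1)[of "i + 4"]] by (simp add: Dz add.assoc)
  have nz3: "D.gp [z, X (i + 3), Y (i + 3)] \<noteq> \<zero>\<^bsub>?D\<^esub>"
    using not_nul_loop(1)[OF rh_star(3)[of "i + 3"]] nul_append[of "[?x, z, ?x, Y (i + 3)]" "[?x]"] by (auto simp: Dz)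
  have nC1: "D.act (D.gp [z, X (i + 2)]) (sg [X (i + 2), z, X (i + 3)] 1) \<notin> C0"
    using nz1 by (simp add: Dact_gp C0_def is_path_Cons)
  have nC2: "D.act (D.gp [z, X (i + 5)]) (sg [X (i + 5), z, X (i + 4)] 1) \<notin> C1"
  proof -
    have "D.gp [z, X (i + 5), z, X (i + 4)] \<notin> C1"
      by (rule D.not_in_killed[where r = "X (i + 4)"]) (use c1 nz2 in \<open>auto simp: is_path_Cons\<close>)
    then show ?thesis by (simp add: Dact_gp is_path_Cons)
  qed
  have nC3: "D.act (D.gp [z]) (sg [z, X (i + 3), Y (i + 3)] 1) \<notin> C2"
  proof -
    have "D.gp [z, X (i + 3), Y (i + 3)] \<notin> C2"
      by (rule D.not_in_killed[where r = "Y (i + 3)"]) (use c2 nz3 in \<open>auto simp: is_path_Cons\<close>)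
    then show ?thesis by (simp add: Dact_gp is_path_Cons)
  qed
  have fC: "rhombus_filtration s (restrict_module ?D C3) 3"
    by (rule rhombus_filtration_3[OF I_eq D.pmod_axioms C0_def C1_def C2_def C3_def gC1 gC2 gC3 nC1 nC2 nC3])

  have least: "C3 \<subseteq> Q" if Q: "submodule Q A ?D" "D.gp [z] \<in> Q" for Q
  proof -
    have q: "D.gp [z, X j] \<in> Q" for j using D.gp_extend[OF Q, of "[X j]"] by simp
    have "C0 \<subseteq> Q" using submoduleD(2)[OF Q(1)] by (simp add: C0_def)
    then have "C1 \<subseteq> Q" unfolding C1_def using D.extend_least[OF Q(1)] q by blast
    then have "C2 \<subseteq> Q" unfolding C2_def using D.extend_least[OF Q(1)] q by blast
    then show ?thesis unfolding C3_def using D.extend_least[OF Q(1)] Q(2) by blast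
  qed
  have "generated_submodule A ?D {D.gp [z]} = C3"
    unfolding generated_submodule_def using least sC3 mC3 by blast
  moreover have "D.gp [z] = (path_class s [?x, z], path_class s [?y, z])"
    by (simp add: ladj_def path_class_eq path_mult_single)
  ultimately have C: "C = restrict_module ?D C3"
    unfolding C_def arrow_pair_module_def algebra_eq by simp
  have C3_act: "C3 = D.act (D.gp [z]) ` combs"
  proof
    have "C3 \<subseteq> D.extend {\<zero>\<^bsub>?D\<^esub>} (D.gp [z])"
      using least D.extend_gp[OF D.zero_submodule pz] by blast
    then show "C3 \<subseteq> D.act (D.gp [z]) ` combs" by (simp only: D.extend_zero[OF Dc[OF pz]])
    show "D.act (D.gp [z]) ` combs \<subseteq> C3" using D.submodule_act[OF sC3 mC3] by blast
  qed

  define g where "g m = (cl I (sg [?x, z] 1) \<otimes>\<^bsub>A\<^esub> m, cl I (sg [?y, z] 1) \<otimes>\<^bsub>A\<^esub> m)" for m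
  have g: "g (cl I f) = ladj ?x ?y f" if "f \<in> combs" for f
    using that by (simp add: g_def ladj_def)
  define E where "E = pri (sg [z] 1)"
  have eA: "eA s z = restrict_module (regular_module A) E" unfolding E_def by (rule eA_eq) simp
  have sE: "submodule E A (regular_module A)" unfolding E_def by (rule pri_submodule) simp
  have E_act: "E = R.act (R.gp [z]) ` combs"
    unfolding E_def pri_def by (rule image_cong) (simp_all add: R.act_\<gamma>)
  have K3E: "K3 \<subseteq> E"
  proof
    fix k assume "k \<in> K3"
    then obtain a b where ab: "a \<in> combs" "b \<in> combs" "k = cl I (path_mult (sg [z, X i] 1) a + path_mult (sg [z, X (i + 1)] 1) b)"
      using K3_elem by blast
    have "path_mult (sg [z] 1) (path_mult (sg [z, X j] 1) a) = path_mult (sg [z, X j] 1) a" if "a \<in> combs" for j and a :: "'k pathcomb"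
      using that by (simp add: path_mult_single flip: path_mult_assoc)
    then have "k = cl I (path_mult (sg [z] 1) (path_mult (sg [z, X i] 1) a + path_mult (sg [z, X (i + 1)] 1) b))"
      using ab by (simp add: path_mult_add_right)
    then show "k \<in> E" unfolding E_def pri_def using ab by simp
  qed
  have gK: "g k = \<zero>\<^bsub>?D\<^esub>" if kK: "k \<in> K3" for k
  proof -
    obtain a b where ab: "a \<in> combs" "b \<in> combs" "k = cl I (path_mult (sg [z, X i] 1) a + path_mult (sg [z, X (i + 1)] 1) b)"
      using kK K3_elem by blast
    have "g k = D.act (D.gp [z, X i]) a \<oplus>\<^bsub>?D\<^esub> D.act (D.gp [z, X (i + 1)]) b"
      using ab by (simp add: g D.act_\<gamma> D.\<gamma>_add)
    then show ?thesis using ab D1 by simp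
  qed
  have gRD: "g (R.act (R.gp p) f) = D.act (D.gp p) f" if "is_path p" "f \<in> combs" for p f
    using that by (simp add: R.act_\<gamma> D.act_\<gamma> g)
  have g_add: "g (k \<oplus>\<^bsub>regular_module A\<^esub> l) = g k \<oplus>\<^bsub>?D\<^esub> g l" if kl: "k \<in> carrier A" "l \<in> carrier A" for k l
  proof -
    obtain a b where "a \<in> combs" "k = cl I a" "b \<in> combs" "l = cl I b" using kl by (auto elim!: carrier_A_E)
    then show ?thesis by (simp add: regular_simps g D.\<gamma>_add)
  qed
  have g_smult: "g (a \<odot>\<^bsub>regular_module A\<^esub> k) = a \<odot>\<^bsub>?D\<^esub> g k" if ka: "k \<in> carrier A" "a \<in> carrier A" for k a
  proof -
    obtain b h where "b \<in> combs" "k = cl I b" "h \<in> combs" "a = cl I h" using ka by (auto elim!: carrier_A_E)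
    then show ?thesis using D.act_\<gamma>[of b h] by (simp add: regular_simps g D.act_def)
  qed
  have Ec: "E \<subseteq> carrier A" using submoduleD(1)[OF sE] by (simp add: regular_simps)

  \<comment> \<open>Counterparts of \<open>C1\<close> and \<open>C2\<close> above the kernel inside
    A, with the same generators.\<close>
  define S1 where "S1 = R.extend K3 (R.gp [z, X (i + 2)])"
  define S2 where "S2 = R.extend S1 (R.gp [z, X (i + 5)])"
  have sS1: "submodule S1 A (regular_module A)" and S1: "K3 \<subseteq> S1" "R.gp [z, X (i + 2)] \<in> S1"
    unfolding S1_def by (rule R.extend_gp[OF sK3 paths(4)])+
  have sS2: "submodule S2 A (regular_module A)" and S2: "S1 \<subseteq> S2" "R.gp [z, X (i + 5)] \<in> S2"
    unfolding S2_def by (rule R.extend_gp[OF sS1 paths(4)])+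
  have gR1: "R.generator K3 (R.gp [z, X (i + 2)]) (X (i + 2)) z (Y (i + 2)) (X (i + 3))"
    using R.generator_B'[OF sK3 mK3] by (simp add: add.assoc)
  \<comment> \<open>Stated over \<open>K3\<close> rather than \<open>S1\<close>, thanks to b_1 in
    \<open>K3\<close>: the transfer below then lands in the kernel directly.\<close>
  have gR2: "R.generator K3 (R.gp [z, X (i + 5)]) (X (i + 5)) z (Y (i + 4)) (X (i + 4))"
    using R.generator_A'[OF sK3, of "i + 5", unfolded X_periodic eq] mK2 K23 by blast
  have gR3: "R.generator S2 (R.gp [z]) z (X (i + 3)) (X (i + 4)) (Y (i + 3))"
    by (rule R.generator_vertex[OF sS2]) (use mK2 mK3 K23 S1 S2 in blast)+
  have ker: "m \<in> K3" if m: "m \<in> E" "g m = \<zero>\<^bsub>?D\<^esub>" for m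
  proof -
    obtain f0 where f0: "f0 \<in> combs" "m = R.act (R.gp [z]) f0" using m(1) E_act by blast
    have "D.act (D.gp [z]) f0 \<in> C2" using m(2) f0 gRD[OF pz f0(1)] submoduleD(2)[OF sC2] by simp
    \<comment> \<open>The coefficients along the top rhombus vanish because they do in the
      cokernel.\<close>
    then have "m \<in> S2"
      unfolding f0(2) using generator_transfer[OF R.pmod_axioms D.pmod_axioms sS2 gR3 sC2 gC3 f0(1) _ nC3] by blast
    then obtain k f3 f6 where k: "k \<in> K3" "f3 \<in> combs" "f6 \<in> combs"
      "m = (k \<oplus>\<^bsub>regular_module A\<^esub> R.act (R.gp [z, X (i + 2)]) f3) \<oplus>\<^bsub>regular_module A\<^esub> R.act (R.gp [z, X (i + 5)]) f6"
      unfolding S2_def S1_def R.extend_def by blast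
    let ?a = "R.act (R.gp [z, X (i + 2)]) f3" and ?b = "R.act (R.gp [z, X (i + 5)]) f6"
    have car: "k \<in> carrier A" "?a \<in> carrier A" "?b \<in> carrier A"
      using k K3E Ec R.act_carrier[OF Kc] paths by (auto simp: regular_simps)
    have ka: "k \<oplus>\<^bsub>regular_module A\<^esub> ?a \<in> carrier A"
      using car R.RM.M.a_closed[of k ?a] by (simp add: regular_simps)
    let ?a' = "D.act (D.gp [z, X (i + 2)]) f3" and ?b' = "D.act (D.gp [z, X (i + 5)]) f6"
    have c': "?a' \<in> carrier ?D" "?b' \<in> carrier ?D" using k paths Dc D.act_carrier by blast+
    have "g m = ?a' \<oplus>\<^bsub>?D\<^esub> ?b'"
      using k(4) g_add[OF ka car(3)] g_add[OF car(1,2)] gK[OF k(1)] gRD[OF _ k(2)] gRD[OF _ k(3)] paths c' by simp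
    then have s: "?a' \<oplus>\<^bsub>?D\<^esub> ?b' = \<zero>\<^bsub>?D\<^esub>" using m(2) by simp
    have "?b' \<oplus>\<^bsub>?D\<^esub> ?a' = \<zero>\<^bsub>?D\<^esub>" using s c' by (simp add: D.RM.M.a_comm)
    then have "?b' = \<ominus>\<^bsub>?D\<^esub> ?a'" using c' D.RM.M.minus_equality by metis
    \<comment> \<open>The b_6 part is the negative of the b_3 part, which lies in \<open>C1\<close>;
      since b_6 is still independent modulo \<open>C1\<close>, its contribution already lies in the
      kernel. After that the b_3 part vanishes on its own.\<close>
    then have "?b' \<in> C1" using D.submodule_act[OF sC1 mC1 k(2)] submoduleD(4)[OF sC1] by simp
    then have b: "?b \<in> K3"
      using generator_transfer[OF R.pmod_axioms D.pmod_axioms sK3 gR2 sC1 gC2 k(3) _ nC2] by blast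
    then have "?b' = \<zero>\<^bsub>?D\<^esub>" using gK gRD[OF _ k(3)] paths by metis
    then have "?a' \<in> C0" using s c' by (simp add: C0_def)
    then have a: "?a \<in> K3"
      using generator_transfer[OF R.pmod_axioms D.pmod_axioms sK3 gR1 sC0 gC1 k(2) _ nC1] by blast
    show ?thesis unfolding k(4) using k(1) a b submoduleD(3)[OF sK3] by blast
  qed
  have "short_exact A K (eA s z) C (\<lambda>m. m) g"
    unfolding short_exact_def
  proof (intro conjI)
    show "right_module A K" unfolding K by (rule R.right_module_restrict[OF sK3])
    show "right_module A (eA s z)" unfolding eA by (rule R.right_module_restrict[OF sE])
    show "right_module A C" unfolding C by (rule D.right_module_restrict[OF sC3])
    show "(\<lambda>m. m) \<in> module_hom A K (eA s z)"
      using K3E by (auto simp: module_hom_def K eA restrict_module_def)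
    have gE: "g m \<in> C3" if "m \<in> E" for m
      using that gRD[OF pz] unfolding E_act C3_act by auto
    show "g \<in> module_hom A (eA s z) C"
      using gE g_add[OF subsetD[OF Ec] subsetD[OF Ec]] g_smult[OF subsetD[OF Ec]]
      by (simp add: module_hom_def C eA restrict_module_def)
    show "inj_on (\<lambda>m. m) (carrier K)" by simp
    show "(\<lambda>m. m) ` carrier K = a_kernel (eA s z) C g"
      using ker gK K3E by (auto simp: a_kernel_def' K C eA restrict_module_def)
    show "g ` carrier (eA s z) = carrier C"
    proof -
      have "g ` E = C3" unfolding E_act C3_act image_image by (rule image_cong) (simp_all add: gRD)
      then show ?thesis by (simp add: C eA restrict_module_def)
    qed
  qed
  then show ?thesis using fK fC unfolding K[symmetric] C[symmetric] algebra_eq by blast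
qed

end

theorem lemma11:
  fixes s :: "3 \<Rightarrow> real^2 \<Rightarrow> int" and z :: "real^2" and x :: "nat \<Rightarrow> real^2"
    and K :: "(((real^2) list \<Rightarrow>\<^sub>0 'k::field) set, ((real^2) list \<Rightarrow>\<^sub>0 'k) set) module"
    and C :: "(((real^2) list \<Rightarrow>\<^sub>0 'k) set,
               ((real^2) list \<Rightarrow>\<^sub>0 'k) set \<times> ((real^2) list \<Rightarrow>\<^sub>0 'k) set) module"
  assumes "sign_choice s"
    and "n_vertex 6 z"
    and "ccw_labelling z 6 x"
    and K: "K = arrows_sum s z (x 1) (x 2)"
    and C: "C = arrow_pair_module s z (x 4) (x 5)"
  shows "(\<exists>g. short_exact (rauzy_algebra s) K (eA s z) C (\<lambda>m. m) g)
       \<and> rhombus_filtration s K 3 \<and> rhombus_filtration s C 3"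
proof -
  interpret star s z "rauzy_ideal s :: 'k pathcomb set"
    by unfold_locales (use assms in simp_all)
  obtain c where c: "\<And>j. j \<in> {1..6} \<Longrightarrow> x j = z + dir (c + int j)"
    using ccw_labelling_6[OF assms(2,3)] by blast
  \<comment> \<open>The neighbour \<open>x j\<close> has direction \<open>c + j\<close>, so the base
    index is \<open>c + 1\<close>.\<close>
  have "x 1 = X (c + 1)" "x 2 = X (c + 1 + 1)" "x 4 = X (c + 1 + 3)" "x 5 = X (c + 1 + 4)"
    using c[of 1] c[of 2] c[of 4] c[of 5] by (simp_all add: X_def add.assoc)
  then show ?thesis unfolding K C using sequence[of "c + 1"] by simp
qed

end
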